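(* Let $(P,\le_P)$ be a finite (3+1)-free poset, and let $C$ be a connected component of the $P$-array crystal $(\mathcal A_P,e_r,f_r,\mathbf{wt})$. Then $\mathrm{char}(C)=\sum_{\lambda}c_\lambda s_\lambda$ (sum over partitions $\lambda$, with $s_\lambda$ the Schur function), where $c_\lambda$ is the number of $P$-tableaux in $C$ of weight $\lambda$.
   Context: A poset is (3+1)-free if it does not contain as an induced subposet the disjoint union of a 3-element chain and a 1-element chain. $\mathbb Z_+$ is the set of positive integers. $P$-arrays. A $P$-array is an indexing $A=\{A_{i,j}\}$ of the elements of $P$ (each element of $P$ occurs exactly once) by positions $(i,j)\in\mathbb Z_+\times\mathbb Z_+$ such that if $A_{i,j}$ is defined with $j>1$ then $A_{i,j-1}$ is defined and $A_{i,j-1}<_P A_{i,j}$. So a $P$-array amounts to an assignment of the elements of $P$ to rows indexed by $\mathbb Z_+$, each row being a chain listed in increasing order. $\mathcal A_P$ is the set of $P$-arrays. The weight $\mathbf{wt}(A)$ is the sequence whose $i$th entry is the number of elements in row $i$. A $P$-tableau is a $P$-array such that whenever $A_{i,j}$ is defined with $i>1$, then $A_{i-1,j}$ is defined and $A_{i-1,j}\not>_P A_{i,j}$ (its weight is then a partition). The $r$ alignment. Let $A$ be a $P$-array, $r\ge1$, and let $a_1<_P\cdots<_Pa_m$ and $b_1<_P\cdots<_Pb_n$ be the elements of rows $r$ and $r+1$ of $A$. Define $C(b_k)=k$ and, inductively, $C(a_k)=\max(\{C(b_i)\mid b_i<_Pa_k\}\cup\{C(a_i)\mid 1\le i<k\})+1$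 (with $\max\emptyset=0$). The $r$ pre-alignment $\phi_0:\{a_1,\dots,a_m,b_1,\dots,b_n\}\to\{r,r+1\}\times\mathbb Z_+$ sends $a_k\mapsto(r,C(a_k))$ and $b_k\mapsto(r+1,C(b_k))$; the second coordinate is called the column. Given $\phi_k$, select the rightmost element $x$, say mapped to $(i,c)$, such that column $c+1$ of $\phi_k$ is nonempty and contains no $y>_Px$, if such $x$ exists; then $\phi_{k+1}(x)=(i,c+1)$ and $\phi_{k+1}=\phi_k$ elsewhere. If no such $x$ exists, $\phi_k$ is the $r$ alignment of $A$. Operators $f_r,e_r:\mathcal A_P\to\mathcal A_P\cup\{0\}$ ($r\ge 1$), where, for $A\in\mathcal A_P$, $a_1<_P\cdots<_Pa_m$ and $b_1<_P\cdots<_Pb_n$ are the elements of rows $r$ and $r+1$ of $A$, and "column" means column in the $r$ alignment of $A$. Lowering: if every column with an entry in row $r$ also contains an entry in row $r+1$, then $f_r(A)=0$. Otherwise let $p$ be minimal such that $a_p$ does not share a column with an element of row $r+1$, and let $t\ge0$ be minimal such that there is no $b_i\not>_Pa_{p+t}$ one column right of $a_{p+t}$. Then $f_r(A)$ is obtained from $A$ by moving $a_p,\dots,a_{p+t}$ to row $r+1$ and any $b_i$ that shares a column with one of these entries to row $r$. Raising: if every column with an entry in row $r+1$ also contains an entry in row $r$, then $e_r(A)=0$. Otherwise let $p$ be maximal such that $b_p$ does not share a column with an entry of row $r$, and let $t\ge0$ be minimal such that there is no $a_i\not>_Pb_{p+t}$ one column right of $b_{p+t}$. Then $e_r(A)$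 is obtained from $A$ by moving $b_p,\dots,b_{p+t}$ to row $r$ and any $a_i$ that shares a column with one of these entries to row $r+1$. The $P$-array crystal is the directed colored graph with vertex set $\mathcal A_P$ and an edge of color $r$ from $A$ to $f_r(A)$ whenever $f_r(A)\neq0$ (equivalently, from $e_r(A)$ to $A$ whenever $e_r(A)\ne0$). Connected components are those of the underlying undirected graph. For $S\subseteq\mathcal A_P$, $\mathrm{char}(S)=\sum_{A\in S}\prod_{i\ge1}x_i^{\mathbf{wt}(A)_i}$. *)

theory Defs
  imports Main "HOL-Library.FuncSet" "HOL-Library.While_Combinator"
begin

definition three_plus_one_free :: "'a::order set \<Rightarrow> bool" where
  "three_plus_one_free P \<longleftrightarrow>
     \<not> (\<exists>a\<in>P. \<exists>b\<in>P. \<exists>c\<in>P. \<exists>d\<in>P. a < b \<and> b < c \<and>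
          (\<forall>x\<in>{a, b, c}. \<not> d \<le> x \<and> \<not> x \<le> d))"

(* Positions (i, j) are pairs of positive integers (row, index in the row); A (i, j) = None
   means that A_{i,j} is undefined. *)

type_synonym 'a filling = "nat \<times> nat \<rightharpoonup> 'a"

definition P_arrays :: "'a::order set \<Rightarrow> 'a filling set" where
  "P_arrays P = {A. dom A \<subseteq> {1..} \<times> {1..} \<and> ran A = P \<and> inj_on A (dom A) \<and>
     (\<forall>i j. (i, j) \<in> dom A \<and> j > 1 \<longrightarrow>
        (i, j - 1) \<in> dom A \<and> the (A (i, j - 1)) < the (A (i, j)))}"

definition row :: "'a filling \<Rightarrow> nat \<Rightarrow> 'a set" where
  "row A i = {x. \<exists>j. A (i, j) = Some x}"

definition wt :: "'a filling \<Rightarrow> nat \<Rightarrow> nat" where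
  "wt A i = card (row A i)"

definition P_tableaux :: "'a::order set \<Rightarrow> 'a filling set" where
  "P_tableaux P = {A \<in> P_arrays P. \<forall>i j. (i, j) \<in> dom A \<and> i > 1 \<longrightarrow>
     (i - 1, j) \<in> dom A \<and> \<not> the (A (i - 1, j)) > the (A (i, j))}"

(* C(a_k), where a_k = A (r, k) and b_i = A (r + 1, i), so that C(b_i) = i. *)

function upper_column :: "'a::order filling \<Rightarrow> nat \<Rightarrow> nat \<Rightarrow> nat" where
  "upper_column A r k =
     Max ({0} \<union> {i. \<exists>b. A (r + 1, i) = Some b \<and> b < the (A (r, k))}
              \<union> upper_column A r ` {1..<k}) + 1"
  by auto
termination
  by (relation "measure (\<lambda>(A, r, k). k)") auto

declare upper_column.simps [simp del]

(* Since an element keeps its row throughout the alignment procedure, only the column,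
   i.e. the second coordinate of the maps phi_k, is recorded. The value at elements outside
   rows r and r + 1 is irrelevant. *)

definition pre_alignment :: "'a::order filling \<Rightarrow> nat \<Rightarrow> 'a \<Rightarrow> nat" where
  "pre_alignment A r x =
     (let (i, k) = (THE p. A p = Some x)
      in if i = r then upper_column A r k else if i = r + 1 then k else 0)"

definition shiftable :: "'a::order set \<Rightarrow> ('a \<Rightarrow> nat) \<Rightarrow> 'a \<Rightarrow> bool" where
  "shiftable X \<phi> x \<longleftrightarrow> x \<in> X \<and> (\<exists>y\<in>X. \<phi> y = \<phi> x + 1) \<and>
     \<not> (\<exists>y\<in>X. \<phi> y = \<phi> x + 1 \<and> y > x)"

(* Among two elements in a common column at most one is shiftable at any stage of the procedure,
   so that the rightmost shiftable element chosen by ARG_MAX is unique. *)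

definition alignment :: "'a::order filling \<Rightarrow> nat \<Rightarrow> 'a \<Rightarrow> nat" where
  "alignment A r =
     (let X = row A r \<union> row A (r + 1)
      in while (\<lambda>\<phi>. \<exists>x. shiftable X \<phi> x)
               (\<lambda>\<phi>. let x = (ARG_MAX \<phi> x. shiftable X \<phi> x) in \<phi>(x := \<phi> x + 1))
               (pre_alignment A r))"

(* The P-array obtained from A by moving the elements of S from row r to row r + 1
   and those of T from row r + 1 to row r. *)

definition exchange :: "nat \<Rightarrow> 'a::order set \<Rightarrow> 'a set \<Rightarrow> 'a filling \<Rightarrow> 'a filling" where
  "exchange r S T A = (THE B. B \<in> P_arrays (ran A) \<and>
     row B r = (row A r - S) \<union> T \<and>
     row B (r + 1) = (row A (r + 1) - T) \<union> S \<and>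
     (\<forall>i. i \<noteq> r \<and> i \<noteq> r + 1 \<longrightarrow> row B i = row A i))"

(* The operator f_r, with None for the value 0. *)

definition lowering :: "nat \<Rightarrow> 'a::order filling \<Rightarrow> 'a filling option" where
  "lowering r A =
     (let \<phi> = alignment A r in
      if \<forall>a\<in>row A r. \<exists>b\<in>row A (r + 1). \<phi> b = \<phi> a then None
      else
        let p = (LEAST p. \<exists>a. A (r, p) = Some a \<and> \<not> (\<exists>b\<in>row A (r + 1). \<phi> b = \<phi> a));
            t = (LEAST t. \<exists>a. A (r, p + t) = Some a \<and>
                   \<not> (\<exists>b\<in>row A (r + 1). \<phi> b = \<phi> a + 1 \<and> \<not> b > a));
            S = {a. \<exists>k\<in>{p..p + t}. A (r, k) = Some a};
            T = {b \<in> row A (r + 1). \<exists>a\<in>S. \<phi> b = \<phi> a}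
        in Some (exchange r S T A))"

definition crystal_edges :: "'a::order set \<Rightarrow> ('a filling \<times> 'a filling) set" where
  "crystal_edges P = {(A, B). A \<in> P_arrays P \<and> (\<exists>r\<ge>1. lowering r A = Some B)}"

definition crystal_components :: "'a::order set \<Rightarrow> 'a filling set set" where
  "crystal_components P = P_arrays P // (crystal_edges P \<union> (crystal_edges P)\<inverse>)\<^sup>*"

(* A formal power series in x_1, x_2, ... is given by its coefficient function; the monomial
   x_1^(m 1) x_2^(m 2) ... is represented by m :: nat => nat with m 0 = 0.
   All coefficients here are cardinalities of finite sets. *)

type_synonym power_series = "(nat \<Rightarrow> nat) \<Rightarrow> nat"

definition character :: "'a filling set \<Rightarrow> power_series" where
  "character S = (\<lambda>m. card {A \<in> S. wt A = m})"

(* Parts are indexed from 1, and the entry at the unused index 0 is 0. *)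

definition is_partition :: "(nat \<Rightarrow> nat) \<Rightarrow> bool" where
  "is_partition l \<longleftrightarrow> l 0 = 0 \<and> (\<forall>i\<ge>1. l (i + 1) \<le> l i) \<and> finite {i. l i \<noteq> 0}"

definition diagram :: "(nat \<Rightarrow> nat) \<Rightarrow> (nat \<times> nat) set" where
  "diagram l = {(i, j). 1 \<le> i \<and> 1 \<le> j \<and> j \<le> l i}"

definition ssyt :: "(nat \<Rightarrow> nat) \<Rightarrow> (nat \<times> nat \<Rightarrow> nat) set" where
  "ssyt l = {T \<in> diagram l \<rightarrow>\<^sub>E {1..}.
     (\<forall>i j. (i, j) \<in> diagram l \<and> (i, j + 1) \<in> diagram l \<longrightarrow> T (i, j) \<le> T (i, j + 1)) \<and>
     (\<forall>i j. (i, j) \<in> diagram l \<and> (i + 1, j) \<in> diagram l \<longrightarrow> T (i, j) < T (i + 1, j))}"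

definition schur :: "(nat \<Rightarrow> nat) \<Rightarrow> power_series" where
  "schur l = (\<lambda>m. card {T \<in> ssyt l. \<forall>k. card {c \<in> diagram l. T c = k} = m k})"

definition tableau_count :: "'a::order set \<Rightarrow> 'a filling set \<Rightarrow> (nat \<Rightarrow> nat) \<Rightarrow> nat" where
  "tableau_count P C l = card {A \<in> C. A \<in> P_tableaux P \<and> wt A = l}"

end

theory Submission
  imports Defs "HOL-Combinatorics.Permutations"
begin

text \<open>
An array is the same as a chain coloring of \<open>P\<close>: color each element by its row. Let \<open>X\<close> be the
set of elements in two adjacent rows \<open>r\<close> and \<open>r + 1\<close>. A subset \<open>D\<close> of \<open>X\<close> is a cut if each of
its elements is below each element of \<open>X - D\<close>. Cuts depend on \<open>X\<close> alone, they are linearly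
ordered by inclusion, and exchanging the two colors between two cuts turns a chain coloring into a
chain coloring. The height of a cut is its number of elements in row \<open>r\<close> minus its number of
elements in row \<open>r + 1\<close>. Being (3+1)-free matters through \<open>fail_gives_cut\<close>: if the element
of rank \<open>i\<close> in row \<open>r\<close> is missing or above the element of rank \<open>i + s\<close> in row \<open>r + 1\<close>, then
some cut has height \<open>- (s + 1)\<close>. It follows that the heights of consecutive cuts differ by at most
one (\<open>covers_step\<close>). So the heights trace a lattice walk, and exchanging the colors between the
last lowest cut and its successor is the bracketing rule familiar from words: with the analogous
operator at the first lowest cut it arranges the chain colorings into strings (\<open>low_string\<close>,
\<open>raise_string\<close>).

The alignment computes this rule (\<open>lowering_eq_low\<close>, \<open>lowering_eq_None\<close>). Let the last lowest cut
\<open>D\<close> have \<open>p\<close> elements in row \<open>r\<close> and \<open>q\<close> in row \<open>r + 1\<close>. At every stage \<open>D\<close> occupies the first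
\<open>q\<close> columns, and the element of rank \<open>k > p\<close> in row \<open>r\<close> stays in column \<open>k + (q - p)\<close>. When no
shift is possible any more, the first unpaired element of row \<open>r\<close> is the first one beyond \<open>D\<close>,
since otherwise there would be another lowest cut beyond \<open>D\<close>; and the elements that move are those
up to the next cut. A component is therefore closed under both string operators.

Let \<open>Y\<close> be any set of chain colorings closed under these operators. Reflecting strings shows that
the number of elements of \<open>Y\<close> with a given weight is symmetric in the weight
(\<open>weights_symmetric\<close>). The other reflection, which replaces the weights \<open>(a, b)\<close> of the two rows by
\<open>(b - 1, a + 1)\<close>, does not touch the first cut of height \<open>-1\<close>. This cut consists of the columns in
which the tableau condition holds and of one more element of row \<open>r + 1\<close>. Applied to the first
failing column, and there to the failing pair of rows with the largest index, this reflection is hence an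
involution on the colorings that are not tableaux. It is Gasharov's sign-reversing involution,
adapted so that it stays inside a string. So the sum over \<open>Y\<close> of the signs with which weights
occur as \<open>\<pi> (\<lambda> + \<delta>) - \<delta>\<close> counts the tableaux of weight \<open>\<lambda>\<close> (\<open>alternating_count\<close>).

A symmetric function of the weights is determined by these alternating sums
(\<open>symmetric_vanishing\<close>). It remains to compute them for a Schur function. Semistandard tableaux are
chain colorings of the cells of the diagram, where a cell is smaller if its column is further to
the right. They are closed under the string operators, and the only tableau among them, in the
above sense, has all entries of row \<open>i\<close> equal to \<open>i\<close> (\<open>ssyt_tableaux\<close>). Comparing alternating sums
gives the expansion (\<open>schur_expansion\<close>).
\<close>


section \<open>Cuts of two disjoint chains\<close>

text \<open>The order is a parameter because the theory is used twice: for the order of a type and for the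
cells of a diagram, ordered by columns. The last assumption is (3+1)-freeness for the chain
\<open>x, y, z\<close> and the element \<open>w\<close>: comparability of \<open>w\<close> with one of \<open>x, y, z\<close>, or equality, gives
\<open>x \<prec> w\<close> or \<open>w \<prec> z\<close> by transitivity.\<close>
locale three_one_free =
  fixes P :: "'a set" and lt :: "'a \<Rightarrow> 'a \<Rightarrow> bool" (infix "\<prec>" 50)
  assumes fin: "finite P"
    and irr: "\<not> x \<prec> x"
    and tr: "x \<prec> y \<Longrightarrow> y \<prec> z \<Longrightarrow> x \<prec> z"
    and free: "\<lbrakk>x \<in> P; y \<in> P; z \<in> P; w \<in> P; x \<prec> y; y \<prec> z\<rbrakk> \<Longrightarrow> x \<prec> w \<or> w \<prec> z"
begin

definition is_chain :: "'a set \<Rightarrow> bool" where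
  "is_chain U \<longleftrightarrow> U \<subseteq> P \<and> (\<forall>x\<in>U. \<forall>y\<in>U. x = y \<or> x \<prec> y \<or> y \<prec> x)"

definition rk :: "'a set \<Rightarrow> 'a \<Rightarrow> nat" where
  "rk U x = card {y \<in> U. y \<prec> x \<or> y = x}"

definition cuts :: "'a set \<Rightarrow> 'a set set" where
  "cuts X = {D. D \<subseteq> X \<and> (\<forall>x\<in>D. \<forall>y\<in>X - D. x \<prec> y)}"

lemma chain_finite: "is_chain U \<Longrightarrow> finite U"
  using fin finite_subset by (auto simp: is_chain_def)

lemma rk_mono:
  assumes "is_chain U" "x \<in> U" "y \<in> U" "x \<prec> y"
  shows "rk U x < rk U y"
  unfolding rk_def
proof (rule psubset_card_mono)
  show "finite {z \<in> U. z \<prec> y \<or> z = y}" using chain_finite assms by auto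
  have "y \<notin> {z \<in> U. z \<prec> x \<or> z = x}" using assms irr tr by blast
  moreover have "{z \<in> U. z \<prec> x \<or> z = x} \<subseteq> {z \<in> U. z \<prec> y \<or> z = y}" using assms tr by blast
  ultimately show "{z \<in> U. z \<prec> x \<or> z = x} \<subset> {z \<in> U. z \<prec> y \<or> z = y}" using assms by blast
qed

lemma rk_less_iff:
  assumes "is_chain U" "x \<in> U" "y \<in> U"
  shows "rk U x < rk U y \<longleftrightarrow> x \<prec> y"
  using rk_mono[OF assms(1)] assms unfolding is_chain_def by (metis less_asym less_irrefl)

lemma rk_eq_iff:
  assumes "is_chain U" "x \<in> U" "y \<in> U"
  shows "rk U x = rk U y \<longleftrightarrow> x = y"
  using rk_mono[OF assms(1)] assms unfolding is_chain_def by (metis less_irrefl)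

lemma rk_le_iff:
  assumes "is_chain U" "x \<in> U" "y \<in> U"
  shows "rk U x \<le> rk U y \<longleftrightarrow> x = y \<or> x \<prec> y"
  using rk_less_iff[OF assms] rk_eq_iff[OF assms] by (simp add: le_less) blast

lemma rk_range:
  assumes "is_chain U"
  shows "rk U ` U = {1..card U}"
proof (rule card_subset_eq)
  show "rk U ` U \<subseteq> {1..card U}"
  proof safe
    fix x assume x: "x \<in> U"
    have "{y \<in> U. y \<prec> x \<or> y = x} \<noteq> {}" using x by blast
    then have "rk U x \<ge> 1" using chain_finite[OF assms] unfolding rk_def by (simp add: Suc_le_eq card_gt_0_iff)
    moreover have "rk U x \<le> card U" unfolding rk_def by (rule card_mono) (use chain_finite[OF assms] in auto)
    ultimately show "rk U x \<in> {1..card U}" by simp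
  qed
  have "inj_on (rk U) U" using rk_eq_iff[OF assms] by (auto simp: inj_on_def)
  then show "card (rk U ` U) = card {1..card U}" by (simp add: card_image)
qed auto

lemma rk_bounds: "is_chain U \<Longrightarrow> x \<in> U \<Longrightarrow> 1 \<le> rk U x \<and> rk U x \<le> card U"
  using rk_range by fastforce

lemma rk_obtain:
  assumes "is_chain U" "1 \<le> k" "k \<le> card U"
  obtains x where "x \<in> U" "rk U x = k"
proof -
  have "k \<in> rk U ` U" using rk_range assms by auto
  then show ?thesis using that by auto
qed

lemma card_rk_le:
  assumes "is_chain U" "k \<le> card U"
  shows "card {x \<in> U. rk U x \<le> k} = k"
proof -
  have "rk U ` {x \<in> U. rk U x \<le> k} = {1..k}"
  proof safe
    fix j assume "j \<in> {1..k}"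
    then obtain x where "x \<in> U" "rk U x = j" using rk_obtain[of U j] assms by auto
    then show "j \<in> rk U ` {x \<in> U. rk U x \<le> k}" using \<open>j \<in> {1..k}\<close> by auto
  qed (use rk_bounds assms in auto)
  moreover have "inj_on (rk U) {x \<in> U. rk U x \<le> k}" using rk_eq_iff[OF assms(1)] by (auto simp: inj_on_def)
  ultimately show ?thesis by (metis card_atLeastAtMost card_image diff_Suc_1)
qed

lemma down_closed_rk:
  assumes "is_chain U" "D \<subseteq> U" "\<And>x y. x \<in> D \<Longrightarrow> y \<in> U \<Longrightarrow> y \<prec> x \<Longrightarrow> y \<in> D" "x \<in> U"
  shows "x \<in> D \<longleftrightarrow> rk U x \<le> card D"
proof -
  note f = chain_finite[OF assms(1)]
  have fD: "finite D" using f assms(2) finite_subset by blast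
  show ?thesis
  proof
    assume "x \<in> D"
    then show "rk U x \<le> card D" unfolding rk_def by (intro card_mono fD) (use assms in blast)
  next
    assume le: "rk U x \<le> card D"
    show "x \<in> D"
    proof (rule ccontr)
      assume n: "x \<notin> D"
      have "D \<subset> {y \<in> U. y \<prec> x \<or> y = x}"
      proof -
        have "y \<prec> x" if "y \<in> D" for y
          using assms n that unfolding is_chain_def by (metis subsetD)
        then show ?thesis using assms n by blast
      qed
      then have "card D < rk U x" unfolding rk_def by (rule psubset_card_mono[rotated]) (use f in auto)
      then show False using le by simp
    qed
  qed
qed

lemma cut_rk:
  assumes "is_chain U" "U \<subseteq> X" "D \<in> cuts X" "x \<in> U"
  shows "x \<in> D \<longleftrightarrow> rk U x \<le> card (D \<inter> U)"
proof -
  have "x \<in> D \<inter> U \<longleftrightarrow> rk U x \<le> card (D \<inter> U)"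
  proof (rule down_closed_rk[OF assms(1) _ _ assms(4)])
    fix x y assume "x \<in> D \<inter> U" "y \<in> U" "y \<prec> x"
    then show "y \<in> D \<inter> U" using assms irr tr unfolding cuts_def by blast
  qed auto
  then show ?thesis using assms by blast
qed

lemma cuts_linear:
  assumes "E \<in> cuts X" "F \<in> cuts X"
  shows "E \<subseteq> F \<or> F \<subseteq> E"
  using assms irr tr unfolding cuts_def by blast

lemma cuts_empty: "{} \<in> cuts X" and cuts_self: "X \<in> cuts X"
  by (auto simp: cuts_def)

lemma cuts_finite: "finite X \<Longrightarrow> finite (cuts X)"
  by (rule finite_subset[of _ "Pow X"]) (auto simp: cuts_def)

text \<open>The source of all cuts. At the first \<open>j\<close> where \<open>V\<close>, advanced by \<open>s\<close>, lies below \<open>U\<close>, everything up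
to that place lies below everything beyond it. For \<open>s = 0\<close> this is the first failure of the tableau
condition, and the argument is the one that makes Gasharov's exchange of tails well defined.\<close>
lemma fail_gives_cut:
  assumes U: "is_chain U" and V: "is_chain V" and disj: "U \<inter> V = {}"
    and b: "b \<in> V" "rk V b = i + s" "1 \<le> i"
    and fail: "\<And>a. a \<in> U \<Longrightarrow> rk U a = i \<Longrightarrow> b \<prec> a"
  obtains j where "1 \<le> j" "j \<le> i"
    "{a \<in> U. rk U a < j} \<union> {b \<in> V. rk V b \<le> j + s} \<in> cuts (U \<union> V)"
    "card {a \<in> U. rk U a < j} = j - 1" "card {b \<in> V. rk V b \<le> j + s} = j + s"
proof -
  \<comment> \<open>Minimality of \<open>j\<close> supplies an element of \<open>U\<close> of rank \<open>j - 1\<close> that is not above the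
      element of \<open>V\<close> of rank \<open>j - 1 + s\<close>. Then it is below all of \<open>V\<close> beyond rank \<open>j + s\<close>.\<close>
  define Q where "Q j \<longleftrightarrow> 1 \<le> j \<and> (\<exists>b\<in>V. rk V b = j + s \<and> (\<forall>a\<in>U. rk U a = j \<longrightarrow> b \<prec> a))" for j
  define j where "j = (LEAST j. Q j)"
  have Qi: "Q i" unfolding Q_def using b fail by blast
  have Qj: "Q j" unfolding j_def by (rule LeastI[of Q, OF Qi])
  have ji: "j \<le> i" unfolding j_def by (rule Least_le[of Q, OF Qi])
  have min: "\<not> Q (j - 1)" if "1 < j"
    using not_less_Least[of "j - 1" Q] that unfolding j_def by auto
  from Qj obtain c where c: "1 \<le> j" "c \<in> V" "rk V c = j + s" "\<And>a. a \<in> U \<Longrightarrow> rk U a = j \<Longrightarrow> c \<prec> a"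
    unfolding Q_def by blast
  have cV: "j + s \<le> card V" using rk_bounds[OF V c(2)] c(3) by simp
  have prev: "\<exists>b'\<in>V. \<exists>a'\<in>U. rk V b' = j - 1 + s \<and> rk U a' = j - 1 \<and> \<not> b' \<prec> a'" if j1: "1 < j"
  proof -
    have "1 \<le> j - 1 + s" "j - 1 + s \<le> card V" using j1 cV by auto
    then obtain b' where b': "b' \<in> V" "rk V b' = j - 1 + s"
      by (rule rk_obtain[OF V])
    then show ?thesis using min[OF j1] j1 unfolding Q_def
      by (metis One_nat_def Suc_leI zero_less_diff)
  qed
  have UP: "U \<subseteq> P" and VP: "V \<subseteq> P" using U V by (auto simp: is_chain_def)
  let ?D = "{a \<in> U. rk U a < j} \<union> {b \<in> V. rk V b \<le> j + s}"
  have "?D \<in> cuts (U \<union> V)"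
    unfolding cuts_def
  proof (intro CollectI conjI ballI)
    fix x y assume x: "x \<in> ?D" and y: "y \<in> (U \<union> V) - ?D"
    from x y consider (1) "x \<in> U" "rk U x < j" "y \<in> U" "\<not> rk U y < j"
      | (2) "x \<in> U" "rk U x < j" "y \<in> V" "\<not> rk V y \<le> j + s"
      | (3) "x \<in> V" "rk V x \<le> j + s" "y \<in> U" "\<not> rk U y < j"
      | (4) "x \<in> V" "rk V x \<le> j + s" "y \<in> V" "\<not> rk V y \<le> j + s" by blast
    then show "x \<prec> y"
    proof cases
      case xy: 1
      then show ?thesis using rk_less_iff[OF U] by force
    next
      case xy: 2
      have "1 < j" using rk_bounds[OF U xy(1)] xy by simp
      from prev[OF this] obtain b' a' where p: "b' \<in> V" "a' \<in> U" "rk V b' = j - 1 + s" "rk U a' = j - 1" "\<not> b' \<prec> a'"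
        by blast
      have "b' \<prec> c" "c \<prec> y" using rk_less_iff[OF V] p xy c \<open>1 < j\<close> by force+
      then have "a' \<prec> y" using free[of b' c y a'] p xy c UP VP by blast
      moreover have "x = a' \<or> x \<prec> a'" using rk_le_iff[OF U xy(1) p(2)] p(4) xy(2) by linarith
      ultimately show ?thesis using tr by blast
    next
      case xy: 3
      obtain a where a: "a \<in> U" "rk U a = j"
        using rk_obtain[OF U, of j] c(1) xy rk_bounds[OF U xy(3)] by auto
      have "x = c \<or> x \<prec> c" "a = y \<or> a \<prec> y" using rk_le_iff[OF V xy(1) c(2)] rk_le_iff[OF U a(1) xy(3)] c a xy by auto
      then show ?thesis using c(4)[OF a] tr by blast
    next
      case xy: 4
      then show ?thesis using rk_less_iff[OF V] by force
    qed
  qed auto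
  moreover have "card {a \<in> U. rk U a < j} = j - 1"
  proof -
    have "j - 1 \<le> card U"
    proof (cases "1 < j")
      case True
      then show ?thesis using prev rk_bounds[OF U] by metis
    qed simp
    then have "card {a \<in> U. rk U a \<le> j - 1} = j - 1" by (rule card_rk_le[OF U])
    moreover have "{a \<in> U. rk U a < j} = {a \<in> U. rk U a \<le> j - 1}" using c(1) by auto
    ultimately show ?thesis by simp
  qed
  moreover have "card {b \<in> V. rk V b \<le> j + s} = j + s" by (rule card_rk_le[OF V cV])
  ultimately show ?thesis using that c(1) ji by blast
qed

lemma cut_gives_fail:
  assumes U: "is_chain U" and V: "is_chain V" and D: "D \<in> cuts (U \<union> V)"
    and less: "card (D \<inter> U) < card (D \<inter> V)"
  shows "\<exists>b\<in>V. rk V b = card (D \<inter> U) + 1 \<and> (\<forall>a\<in>U. rk U a = card (D \<inter> U) + 1 \<longrightarrow> b \<prec> a)"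
proof -
  have "card (D \<inter> V) \<le> card V" using chain_finite[OF V] by (intro card_mono) auto
  then obtain b where b: "b \<in> V" "rk V b = card (D \<inter> U) + 1"
    using rk_obtain[OF V, of "card (D \<inter> U) + 1"] less by auto
  have "b \<in> D" using cut_rk[OF V _ D b(1)] b less by auto
  moreover have "a \<notin> D" if "a \<in> U" "rk U a = card (D \<inter> U) + 1" for a
    using cut_rk[OF U _ D that(1)] that by auto
  ultimately have "b \<prec> a" if "a \<in> U" "rk U a = card (D \<inter> U) + 1" for a
    using that D unfolding cuts_def by blast
  then show ?thesis using b by blast
qed

lemma cut_difference:
  assumes "D \<in> cuts X" "D' \<in> cuts X" "E \<in> cuts (D' - D)"
  shows "D \<union> E \<in> cuts X"
  using assms unfolding cuts_def by blast

text \<open>If \<open>V\<close> had two elements more than \<open>U\<close>, its element of rank \<open>card U + 1\<close> would be a failure; the cut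
obtained from it is not empty and leaves out the top of \<open>V\<close>.\<close>
lemma indecomposable_excess:
  assumes U: "is_chain U" and V: "is_chain V" and disj: "U \<inter> V = {}"
    and indec: "cuts (U \<union> V) \<subseteq> {{}, U \<union> V}"
  shows "card V \<le> card U + 1"
proof (rule ccontr)
  assume n: "\<not> ?thesis"
  then obtain b where b: "b \<in> V" "rk V b = (card U + 1) + 0"
    using rk_obtain[OF V, of "card U + 1"] by auto
  obtain j where j: "1 \<le> j" "j \<le> card U + 1"
    and D: "{a \<in> U. rk U a < j} \<union> {b \<in> V. rk V b \<le> j + 0} \<in> cuts (U \<union> V)" (is "?A \<union> ?B \<in> _")
    and c: "card {a \<in> U. rk U a < j} = j - 1" "card {b \<in> V. rk V b \<le> j + 0} = j + 0"
    by (rule fail_gives_cut[OF U V disj b]) (use rk_bounds[OF U] in force)+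
  have "?A \<union> ?B = {} \<or> ?A \<union> ?B = U \<union> V" using indec D by blast
  moreover have "?A \<union> ?B \<noteq> {}" using c(2) j(1) by (metis Un_empty add_0_right card.empty not_one_le_zero)
  ultimately have "?B = V" using disj by blast
  then show False using c(2) n j by simp
qed

end

section \<open>Raising and lowering a pair of colors\<close>

context three_one_free
begin

definition covers :: "'a set \<Rightarrow> 'a set \<Rightarrow> 'a set \<Rightarrow> bool" where
  "covers X D D' \<longleftrightarrow> D \<in> cuts X \<and> D' \<in> cuts X \<and> D \<subset> D' \<and> (\<forall>E\<in>cuts X. E \<subseteq> D \<or> D' \<subseteq> E)"

lemma exists_largest_set:
  assumes "finite X" "Q D" "\<And>E. Q E \<Longrightarrow> E \<subseteq> X"
  shows "\<exists>D. Q D \<and> (\<forall>E. Q E \<longrightarrow> card E \<le> card D)"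
proof -
  have "card E < Suc (card X)" if "Q E" for E
    using card_mono[OF assms(1) assms(3)[OF that]] by simp
  then show ?thesis
    using assms(2) by (intro ex_has_greatest_nat[of Q D card "Suc (card X)"]) simp_all
qed

lemma next_cut:
  assumes "finite X" "D \<in> cuts X" "D \<noteq> X"
  obtains D' where "covers X D D'"
proof -
  let ?Q = "\<lambda>E. E \<in> cuts X \<and> D \<subset> E"
  have "?Q X" using assms cuts_self by (auto simp: cuts_def)
  from ex_has_least_nat[of ?Q, OF this, of card]
  obtain D' where Q: "?Q D'" and least: "\<forall>E. ?Q E \<longrightarrow> card D' \<le> card E" by blast
  then have D': "D' \<in> cuts X" "D \<subset> D'" by simp_all
  have fin': "finite D'" using D'(1) assms(1) finite_subset by (auto simp: cuts_def)
  have "E \<subseteq> D \<or> D' \<subseteq> E" if E: "E \<in> cuts X" for E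
  proof (rule ccontr)
    assume n: "\<not> ?thesis"
    have "D \<subset> E" using n cuts_linear[OF assms(2) E] by blast
    moreover have "E \<subset> D'" using n cuts_linear[OF D'(1) E] by blast
    ultimately show False using least E psubset_card_mono[OF fin', of E] by (metis leD)
  qed
  then have "covers X D D'" using D' assms(2) by (simp add: covers_def)
  then show ?thesis by (rule that)
qed

lemma previous_cut:
  assumes "finite X" "D' \<in> cuts X" "D' \<noteq> {}"
  obtains D where "covers X D D'"
proof -
  let ?Q = "\<lambda>E. E \<in> cuts X \<and> E \<subset> D'"
  have fX: "finite E" if "E \<in> cuts X" for E using that assms(1) finite_subset by (auto simp: cuts_def)
  have "?Q {}" using assms cuts_empty by auto
  moreover have "E \<subseteq> X" if "?Q E" for E using that by (simp add: cuts_def)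
  ultimately obtain D where Q: "?Q D" and greatest: "\<forall>E. ?Q E \<longrightarrow> card E \<le> card D"
    using exists_largest_set[of X ?Q "{}", OF assms(1)] by blast
  then have D: "D \<in> cuts X" "D \<subset> D'" by simp_all
  have "E \<subseteq> D \<or> D' \<subseteq> E" if E: "E \<in> cuts X" for E
  proof (rule ccontr)
    assume n: "\<not> ?thesis"
    have "E \<subset> D'" using n cuts_linear[OF assms(2) E] by blast
    moreover have "D \<subset> E" using n cuts_linear[OF D(1) E] by blast
    ultimately show False using greatest E psubset_card_mono[OF fX[OF E], of D] by (metis leD)
  qed
  then have "covers X D D'" using D assms(2) by (simp add: covers_def)
  then show ?thesis by (rule that)
qed

definition color_class :: "('a \<Rightarrow> nat) \<Rightarrow> nat \<Rightarrow> 'a set" where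
  "color_class \<kappa> r = {x \<in> P. \<kappa> x = r}"

definition chain_coloring :: "('a \<Rightarrow> nat) \<Rightarrow> bool" where
  "chain_coloring \<kappa> \<longleftrightarrow> (\<forall>r. is_chain (color_class \<kappa> r))"

definition two_rows :: "('a \<Rightarrow> nat) \<Rightarrow> nat \<Rightarrow> 'a set" where
  "two_rows \<kappa> r = color_class \<kappa> r \<union> color_class \<kappa> (Suc r)"

definition height :: "('a \<Rightarrow> nat) \<Rightarrow> nat \<Rightarrow> 'a set \<Rightarrow> int" where
  "height \<kappa> r D = int (card (D \<inter> color_class \<kappa> r)) - int (card (D \<inter> color_class \<kappa> (Suc r)))"

definition flip :: "nat \<Rightarrow> 'a set \<Rightarrow> ('a \<Rightarrow> nat) \<Rightarrow> 'a \<Rightarrow> nat" where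
  "flip r K \<kappa> x = (if x \<in> K then (if \<kappa> x = r then Suc r else if \<kappa> x = Suc r then r else \<kappa> x) else \<kappa> x)"

lemma finite_color_class [simp]: "finite (color_class \<kappa> r)"
  using fin by (simp add: color_class_def)

lemma finite_two_rows [simp]: "finite (two_rows \<kappa> r)"
  by (simp add: two_rows_def)

lemma chain_color_class: "chain_coloring \<kappa> \<Longrightarrow> is_chain (color_class \<kappa> r)"
  by (simp add: chain_coloring_def)

lemma color_class_disjoint: "r \<noteq> s \<Longrightarrow> color_class \<kappa> r \<inter> color_class \<kappa> s = {}"
  by (auto simp: color_class_def)

lemma height_split:
  assumes "E \<subseteq> F"
  shows "height \<kappa> r F = height \<kappa> r E + height \<kappa> r (F - E)"
proof -
  have "card (F \<inter> color_class \<kappa> s) = card (E \<inter> color_class \<kappa> s) + card ((F - E) \<inter> color_class \<kappa> s)" for s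
  proof -
    have "F \<inter> color_class \<kappa> s = (E \<inter> color_class \<kappa> s) \<union> ((F - E) \<inter> color_class \<kappa> s)" using assms by auto
    then show ?thesis by (metis (no_types, lifting) Diff_Int_distrib2 Diff_disjoint card_Un_disjoint finite_Int finite_color_class)
  qed
  then show ?thesis by (simp add: height_def)
qed

lemma height_empty [simp]: "height \<kappa> r {} = 0"
  by (simp add: height_def)

lemma flip_flip [simp]: "flip r K (flip r K \<kappa>) = \<kappa>"
  by (auto simp: flip_def fun_eq_iff)

lemma two_rows_flip [simp]: "two_rows (flip r K \<kappa>) r = two_rows \<kappa> r"
  by (auto simp: two_rows_def color_class_def flip_def)

lemma height_flip_outside: "E \<inter> K = {} \<Longrightarrow> height (flip r K \<kappa>) r E = height \<kappa> r E"
proof -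
  assume "E \<inter> K = {}"
  then have "E \<inter> color_class (flip r K \<kappa>) s = E \<inter> color_class \<kappa> s" for s by (auto simp: color_class_def flip_def)
  then show ?thesis by (simp add: height_def)
qed

lemma height_flip_inside: "E \<subseteq> K \<Longrightarrow> height (flip r K \<kappa>) r E = - height \<kappa> r E"
proof -
  assume "E \<subseteq> K"
  then have "E \<inter> color_class (flip r K \<kappa>) r = E \<inter> color_class \<kappa> (Suc r)" "E \<inter> color_class (flip r K \<kappa>) (Suc r) = E \<inter> color_class \<kappa> r"
    by (auto simp: color_class_def flip_def split: if_splits)
  then show ?thesis by (simp add: height_def)
qed

lemma height_flip_above:
  assumes "D \<subseteq> D'" "D' \<subseteq> E"
  shows "height (flip r (D' - D) \<kappa>) r E = height \<kappa> r E - 2 * (height \<kappa> r D' - height \<kappa> r D)"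
proof -
  let ?\<kappa> = "flip r (D' - D) \<kappa>"
  have "height ?\<kappa> r E = height ?\<kappa> r D + height ?\<kappa> r (D' - D) + height ?\<kappa> r (E - D')"
    using height_split[OF assms(1)] height_split[OF assms(2)] by simp
  also have "\<dots> = height \<kappa> r D - height \<kappa> r (D' - D) + height \<kappa> r (E - D')"
  proof -
    have "D \<inter> (D' - D) = {}" "(E - D') \<inter> (D' - D) = {}" by auto
    then show ?thesis by (simp add: height_flip_outside height_flip_inside)
  qed
  also have "\<dots> = height \<kappa> r E - 2 * (height \<kappa> r D' - height \<kappa> r D)"
    using height_split[OF assms(1), of \<kappa> r] height_split[OF assms(2), of \<kappa> r] by simp
  finally show ?thesis .
qed

text \<open>Elements of the exchanged part are comparable with all other elements of the two rows, because they
are separated from them by a cut.\<close>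
lemma chain_coloring_flip:
  assumes \<kappa>: "chain_coloring \<kappa>" and D: "D \<in> cuts (two_rows \<kappa> r)" and D': "D' \<in> cuts (two_rows \<kappa> r)"
  shows "chain_coloring (flip r (D' - D) \<kappa>)"
proof -
  have "x = y \<or> x \<prec> y \<or> y \<prec> x"
    if x: "x \<in> P" and y: "y \<in> P" and eq: "flip r (D' - D) \<kappa> x = flip r (D' - D) \<kappa> y" for x y
  proof (cases "\<kappa> x = \<kappa> y")
    case True
    then show ?thesis using \<kappa> x y by (auto simp: chain_coloring_def is_chain_def color_class_def)
  next
    case False
    \<comment> \<open>One of the two elements lies in the swapped part, the other outside.\<close>
    then have "x \<in> two_rows \<kappa> r" "y \<in> two_rows \<kappa> r" "(x \<in> D' - D) \<noteq> (y \<in> D' - D)"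
      using x y eq by (auto simp: flip_def two_rows_def color_class_def split: if_splits)
    then show ?thesis using D D' unfolding cuts_def by blast
  qed
  then show ?thesis unfolding chain_coloring_def is_chain_def by (auto simp: color_class_def)
qed

text \<open>The part between consecutive cuts has no cuts of its own, so that neither color can exceed the
other by more than one there.\<close>
lemma covers_step:
  assumes \<kappa>: "chain_coloring \<kappa>" and c: "covers (two_rows \<kappa> r) D D'"
  shows "\<bar>height \<kappa> r D' - height \<kappa> r D\<bar> \<le> 1"
proof -
  let ?K = "D' - D" and ?U = "(D' - D) \<inter> color_class \<kappa> r" and ?V = "(D' - D) \<inter> color_class \<kappa> (Suc r)"
  have "?K \<subseteq> two_rows \<kappa> r" using c by (auto simp: covers_def cuts_def)
  then have K: "?U \<union> ?V = ?K" "?V \<union> ?U = ?K" by (auto simp: two_rows_def)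
  have "E \<in> {{}, ?K}" if "E \<in> cuts ?K" for E
  proof -
    have "D \<union> E \<in> cuts (two_rows \<kappa> r)" using cut_difference that c by (auto simp: covers_def)
    then have "D \<union> E \<subseteq> D \<or> D' \<subseteq> D \<union> E" using c[unfolded covers_def] by metis
    moreover have "E \<subseteq> ?K" using that by (simp add: cuts_def)
    ultimately show ?thesis by blast
  qed
  then have indec: "cuts ?K \<subseteq> {{}, ?K}" by blast
  have ch: "is_chain ?U" "is_chain ?V" using chain_color_class[OF \<kappa>] by (auto simp: is_chain_def)
  have dj: "?U \<inter> ?V = {}" "?V \<inter> ?U = {}" using color_class_disjoint[of r "Suc r" \<kappa>] by auto
  have "card ?V \<le> card ?U + 1" "card ?U \<le> card ?V + 1"
    using indecomposable_excess[OF ch(1,2) dj(1)] indecomposable_excess[OF ch(2,1) dj(2)] indec K by simp_all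
  then have "\<bar>height \<kappa> r ?K\<bar> \<le> 1" unfolding height_def by simp
  moreover have "height \<kappa> r D' = height \<kappa> r D + height \<kappa> r ?K" using height_split c by (auto simp: covers_def)
  ultimately show ?thesis by simp
qed

definition min_height :: "('a \<Rightarrow> nat) \<Rightarrow> nat \<Rightarrow> int" where
  "min_height \<kappa> r = Min (height \<kappa> r ` cuts (two_rows \<kappa> r))"

lemma min_height_le: "E \<in> cuts (two_rows \<kappa> r) \<Longrightarrow> min_height \<kappa> r \<le> height \<kappa> r E"
  unfolding min_height_def by (intro Min_le finite_imageI cuts_finite) simp_all

lemma min_height_attained: obtains E where "E \<in> cuts (two_rows \<kappa> r)" "height \<kappa> r E = min_height \<kappa> r"
proof -
  have "min_height \<kappa> r \<in> height \<kappa> r ` cuts (two_rows \<kappa> r)"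
    unfolding min_height_def using cuts_empty cuts_finite by (intro Min_in) auto
  then show ?thesis using that by auto
qed

lemma min_height_eqI:
  assumes "\<And>E. E \<in> cuts (two_rows \<kappa> r) \<Longrightarrow> v \<le> height \<kappa> r E" "E \<in> cuts (two_rows \<kappa> r)" "height \<kappa> r E = v"
  shows "min_height \<kappa> r = v"
  using assms min_height_le[of E \<kappa> r] min_height_attained[of \<kappa> r] by (metis order_antisym)

lemma min_height_nonpos: "min_height \<kappa> r \<le> 0"
  using min_height_le[OF cuts_empty] by simp

definition total :: "('a \<Rightarrow> nat) \<Rightarrow> nat \<Rightarrow> int" where
  "total \<kappa> r = int (card (color_class \<kappa> r)) - int (card (color_class \<kappa> (Suc r)))"

lemma total_height: "total \<kappa> r = height \<kappa> r (two_rows \<kappa> r)"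
  by (simp add: total_def height_def two_rows_def Int_absorb1)

definition eps :: "('a \<Rightarrow> nat) \<Rightarrow> nat \<Rightarrow> int" where "eps \<kappa> r = - min_height \<kappa> r"
text \<open>As usual in a crystal, \<open>eps\<close> and \<open>phi\<close> are the numbers of raising and lowering steps that remain.\<close>
definition phi :: "('a \<Rightarrow> nat) \<Rightarrow> nat \<Rightarrow> int" where "phi \<kappa> r = total \<kappa> r - min_height \<kappa> r"

lemma eps_nonneg: "0 \<le> eps \<kappa> r"
  using min_height_nonpos by (simp add: eps_def)

lemma phi_nonneg: "0 \<le> phi \<kappa> r"
  using min_height_le[OF cuts_self] by (simp add: phi_def total_height)

text \<open>In terms of brackets, the part between the two cuts holds the first unmatched opening bracket.\<close>
definition low_pair :: "('a \<Rightarrow> nat) \<Rightarrow> nat \<Rightarrow> 'a set \<Rightarrow> 'a set \<Rightarrow> bool" where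
  "low_pair \<kappa> r D D' \<longleftrightarrow> covers (two_rows \<kappa> r) D D' \<and> height \<kappa> r D = min_height \<kappa> r \<and>
     (\<forall>E\<in>cuts (two_rows \<kappa> r). D \<subset> E \<longrightarrow> min_height \<kappa> r < height \<kappa> r E)"

text \<open>In terms of brackets, the part between the two cuts holds the last unmatched closing bracket.\<close>
definition raise_pair :: "('a \<Rightarrow> nat) \<Rightarrow> nat \<Rightarrow> 'a set \<Rightarrow> 'a set \<Rightarrow> bool" where
  "raise_pair \<kappa> r D D' \<longleftrightarrow> covers (two_rows \<kappa> r) D D' \<and> height \<kappa> r D' = min_height \<kappa> r \<and>
     (\<forall>E\<in>cuts (two_rows \<kappa> r). E \<subset> D' \<longrightarrow> min_height \<kappa> r < height \<kappa> r E)"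

lemma cut_in_finite: "E \<in> cuts (two_rows \<kappa> r) \<Longrightarrow> finite E"
  using finite_two_rows[of \<kappa> r] unfolding cuts_def by (blast intro: finite_subset)

lemma low_pair_exists:
  assumes "0 < phi \<kappa> r"
  obtains D D' where "low_pair \<kappa> r D D'"
proof -
  let ?X = "two_rows \<kappa> r"
  let ?Q = "\<lambda>E. E \<in> cuts ?X \<and> height \<kappa> r E = min_height \<kappa> r"
  obtain E0 where "E0 \<in> cuts ?X" "height \<kappa> r E0 = min_height \<kappa> r" by (rule min_height_attained)
  then have "?Q E0" by simp
  moreover have "E \<subseteq> ?X" if "?Q E" for E using that by (simp add: cuts_def)
  ultimately obtain D where D: "?Q D" "\<forall>E. ?Q E \<longrightarrow> card E \<le> card D"
    using exists_largest_set[of ?X ?Q E0, OF finite_two_rows] by blast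
  have "D \<noteq> ?X" using assms D by (auto simp: phi_def total_height)
  then obtain D' where "covers ?X D D'" using next_cut[OF finite_two_rows, of D \<kappa> r] D(1) by metis
  moreover have "min_height \<kappa> r < height \<kappa> r E" if "E \<in> cuts ?X" "D \<subset> E" for E
  proof -
    have "\<not> card E \<le> card D" using psubset_card_mono[OF cut_in_finite[OF that(1)] that(2)] by simp
    then have "height \<kappa> r E \<noteq> min_height \<kappa> r" using D(2) that(1) by blast
    then show ?thesis using min_height_le[OF that(1)] by simp
  qed
  ultimately have "low_pair \<kappa> r D D'" using D unfolding low_pair_def by simp
  then show ?thesis by (rule that)
qed

lemma raise_pair_exists:
  assumes "0 < eps \<kappa> r"
  obtains D D' where "raise_pair \<kappa> r D D'"
proof -
  let ?X = "two_rows \<kappa> r"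
  let ?Q = "\<lambda>E. E \<in> cuts ?X \<and> height \<kappa> r E = min_height \<kappa> r"
  obtain E0 where "E0 \<in> cuts ?X" "height \<kappa> r E0 = min_height \<kappa> r" by (rule min_height_attained)
  then have "?Q E0" by simp
  from ex_has_least_nat[of ?Q, OF this, of card]
  obtain D' where D: "?Q D'" "\<forall>E. ?Q E \<longrightarrow> card D' \<le> card E" by blast
  have "D' \<noteq> {}" using assms D by (auto simp: eps_def)
  then obtain D where "covers ?X D D'" using previous_cut[OF finite_two_rows, of D' \<kappa> r] D(1) by metis
  moreover have "min_height \<kappa> r < height \<kappa> r E" if "E \<in> cuts ?X" "E \<subset> D'" for E
  proof -
    have "D' \<in> cuts ?X" using D(1) by blast
    then have "\<not> card D' \<le> card E" using psubset_card_mono[OF cut_in_finite[of D' \<kappa> r] that(2)] by simp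
    then have "height \<kappa> r E \<noteq> min_height \<kappa> r" using D(2) that(1) by blast
    then show ?thesis using min_height_le[OF that(1)] by simp
  qed
  ultimately have "raise_pair \<kappa> r D D'" using D unfolding raise_pair_def by simp
  then show ?thesis by (rule that)
qed

lemma coversD:
  assumes "covers X D D'"
  shows "D \<in> cuts X" "D' \<in> cuts X" "D \<subset> D'" "E \<in> cuts X \<Longrightarrow> E \<subseteq> D \<or> D' \<subseteq> E"
  using assms by (simp_all add: covers_def)

lemma low_pairD:
  assumes "low_pair \<kappa> r D D'"
  shows "covers (two_rows \<kappa> r) D D'" "height \<kappa> r D = min_height \<kappa> r"
    "E \<in> cuts (two_rows \<kappa> r) \<Longrightarrow> D \<subset> E \<Longrightarrow> min_height \<kappa> r < height \<kappa> r E"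
  using assms by (simp_all add: low_pair_def)

lemma raise_pairD:
  assumes "raise_pair \<kappa> r D D'"
  shows "covers (two_rows \<kappa> r) D D'" "height \<kappa> r D' = min_height \<kappa> r"
    "E \<in> cuts (two_rows \<kappa> r) \<Longrightarrow> E \<subset> D' \<Longrightarrow> min_height \<kappa> r < height \<kappa> r E"
  using assms by (simp_all add: raise_pair_def)

lemma covers_unique:
  assumes "covers X D D'" "covers X E E'"
  shows "E = D \<longleftrightarrow> E' = D'"
proof
  note D = coversD[OF assms(1)] and E = coversD[OF assms(2)]
  { assume "E = D"
    then have "D' \<subseteq> E'" "E' \<subseteq> D'" using D(4)[OF E(2)] E(4)[OF D(2)] D(3) E(3) by auto
    then show "E' = D'" by simp }
  { assume "E' = D'"
    then have "D \<subseteq> E" "E \<subseteq> D" using D(4)[OF E(1)] E(4)[OF D(1)] D(3) E(3) by auto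
    then show "E = D" by simp }
qed

lemma low_pair_unique:
  assumes "low_pair \<kappa> r D D'" "low_pair \<kappa> r E E'"
  shows "E = D \<and> E' = D'"
proof -
  note D = low_pairD[OF assms(1)] and E = low_pairD[OF assms(2)]
  have "\<not> D \<subset> E" "\<not> E \<subset> D" using D(3)[of E] E(3)[of D] D(2) E(2) coversD(1)[OF D(1)] coversD(1)[OF E(1)] by auto
  then have "E = D" using cuts_linear[OF coversD(1)[OF D(1)] coversD(1)[OF E(1)]] by auto
  then show ?thesis using covers_unique[OF D(1) E(1)] by simp
qed

lemma raise_pair_unique:
  assumes "raise_pair \<kappa> r D D'" "raise_pair \<kappa> r E E'"
  shows "E = D \<and> E' = D'"
proof -
  note D = raise_pairD[OF assms(1)] and E = raise_pairD[OF assms(2)]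
  have "\<not> D' \<subset> E'" "\<not> E' \<subset> D'" using D(3)[of E'] E(3)[of D'] D(2) E(2) coversD(2)[OF D(1)] coversD(2)[OF E(1)] by auto
  then have "E' = D'" using cuts_linear[OF coversD(2)[OF D(1)] coversD(2)[OF E(1)]] by auto
  then show ?thesis using covers_unique[OF D(1) E(1)] by simp
qed

text \<open>Exchanging the colors lowers all heights from \<open>D'\<close> on by two and leaves those up to \<open>D\<close> unchanged.
The heights beyond \<open>D\<close> exceeded the minimum, so that \<open>D'\<close> becomes the first lowest cut, and \<open>D\<close> is
still the cut before it.\<close>
lemma low_pair_flip:
  assumes \<kappa>: "chain_coloring \<kappa>" and p: "low_pair \<kappa> r D D'"
  defines "\<kappa>' \<equiv> flip r (D' - D) \<kappa>"
  shows "raise_pair \<kappa>' r D D'" "eps \<kappa>' r = eps \<kappa> r + 1" "phi \<kappa>' r = phi \<kappa> r - 1"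
proof -
  let ?X = "two_rows \<kappa> r"
  have X: "two_rows \<kappa>' r = ?X" by (simp add: \<kappa>'_def)
  note c = low_pairD(1)[OF p] and hD = low_pairD(2)[OF p] and last = low_pairD(3)[OF p]
  note D = coversD(1-3)[OF c]
  have hD': "height \<kappa> r D' = min_height \<kappa> r + 1" using covers_step[OF \<kappa> c] last[OF D(2,3)] hD by simp
  have below: "height \<kappa>' r E = height \<kappa> r E" if "E \<subseteq> D" for E
    unfolding \<kappa>'_def by (rule height_flip_outside) (use that in auto)
  have above: "height \<kappa>' r E = height \<kappa> r E - 2" if "D' \<subseteq> E" for E
    unfolding \<kappa>'_def using height_flip_above[of D D' E r \<kappa>] that D hD hD' by auto
  note split = coversD(4)[OF c]
  have ge: "min_height \<kappa> r - 1 \<le> height \<kappa>' r E" if "E \<in> cuts ?X" for E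
    using split[OF that]
  proof
    assume "E \<subseteq> D" then show ?thesis using below min_height_le[OF that] by simp
  next
    assume *: "D' \<subseteq> E" then have "D \<subset> E" using D by blast
    then show ?thesis using above[OF *] last[OF that] by simp
  qed
  have min_height': "min_height \<kappa>' r = min_height \<kappa> r - 1"
    by (rule min_height_eqI[of _ _ _ D']) (use ge D hD' above X in auto)
  have "min_height \<kappa>' r < height \<kappa>' r E" if "E \<in> cuts ?X" "E \<subset> D'" for E
    using split[OF that(1)]
  proof
    assume "E \<subseteq> D" then show ?thesis using below min_height_le[OF that(1)] min_height' by simp
  qed (use that in auto)
  then show "raise_pair \<kappa>' r D D'" using c X min_height' above[of D'] hD' by (simp add: raise_pair_def)
  show "eps \<kappa>' r = eps \<kappa> r + 1" using min_height' by (simp add: eps_def)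
  have "D' \<subseteq> ?X" using D(2) by (simp add: cuts_def)
  from above[OF this] have "total \<kappa>' r = total \<kappa> r - 2" by (simp add: total_height X)
  then show "phi \<kappa>' r = phi \<kappa> r - 1" using min_height' by (simp add: phi_def)
qed

lemma raise_pair_flip:
  assumes \<kappa>: "chain_coloring \<kappa>" and p: "raise_pair \<kappa> r D D'"
  defines "\<kappa>' \<equiv> flip r (D' - D) \<kappa>"
  shows "low_pair \<kappa>' r D D'" "eps \<kappa>' r = eps \<kappa> r - 1" "phi \<kappa>' r = phi \<kappa> r + 1"
proof -
  let ?X = "two_rows \<kappa> r"
  have X: "two_rows \<kappa>' r = ?X" by (simp add: \<kappa>'_def)
  note c = raise_pairD(1)[OF p] and hD' = raise_pairD(2)[OF p] and first = raise_pairD(3)[OF p]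
  note D = coversD(1-3)[OF c]
  have hD: "height \<kappa> r D = min_height \<kappa> r + 1" using covers_step[OF \<kappa> c] first[OF D(1,3)] hD' by simp
  have below: "height \<kappa>' r E = height \<kappa> r E" if "E \<subseteq> D" for E
    unfolding \<kappa>'_def by (rule height_flip_outside) (use that in auto)
  have above: "height \<kappa>' r E = height \<kappa> r E + 2" if "D' \<subseteq> E" for E
    unfolding \<kappa>'_def using height_flip_above[of D D' E r \<kappa>] that D hD hD' by auto
  note split = coversD(4)[OF c]
  have gt: "min_height \<kappa> r + 1 < height \<kappa>' r E" if "E \<in> cuts ?X" "D' \<subseteq> E" for E
    using above[OF that(2)] min_height_le[OF that(1)] by simp
  have ge: "min_height \<kappa> r + 1 \<le> height \<kappa>' r E" if "E \<in> cuts ?X" for E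
    using split[OF that]
  proof
    assume *: "E \<subseteq> D" then have "E \<subset> D'" using D by blast
    then show ?thesis using below[OF *] first[OF that] by simp
  next
    assume "D' \<subseteq> E" then show ?thesis using gt[OF that] by simp
  qed
  have min_height': "min_height \<kappa>' r = min_height \<kappa> r + 1"
    by (rule min_height_eqI[of _ _ _ D]) (use ge D hD below X in auto)
  have "min_height \<kappa>' r < height \<kappa>' r E" if "E \<in> cuts ?X" "D \<subset> E" for E
    using split[OF that(1)]
  proof
    assume "D' \<subseteq> E" then show ?thesis using gt[OF that(1)] min_height' by simp
  qed (use that in auto)
  then show "low_pair \<kappa>' r D D'" using c X min_height' below[of D] hD by (simp add: low_pair_def)
  show "eps \<kappa>' r = eps \<kappa> r - 1" using min_height' by (simp add: eps_def)
  have "D' \<subseteq> ?X" using D(2) by (simp add: cuts_def)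
  from above[OF this] have "total \<kappa>' r = total \<kappa> r + 2" by (simp add: total_height X)
  then show "phi \<kappa>' r = phi \<kappa> r + 1" using min_height' by (simp add: phi_def)
qed

definition low :: "nat \<Rightarrow> ('a \<Rightarrow> nat) \<Rightarrow> 'a \<Rightarrow> nat" where
  "low r \<kappa> = flip r (SOME K. \<exists>D D'. low_pair \<kappa> r D D' \<and> K = D' - D) \<kappa>"

definition raise :: "nat \<Rightarrow> ('a \<Rightarrow> nat) \<Rightarrow> 'a \<Rightarrow> nat" where
  "raise r \<kappa> = flip r (SOME K. \<exists>D D'. raise_pair \<kappa> r D D' \<and> K = D' - D) \<kappa>"

lemma low_eq: "low_pair \<kappa> r D D' \<Longrightarrow> low r \<kappa> = flip r (D' - D) \<kappa>"
  unfolding low_def by (rule arg_cong[where f = "\<lambda>K. flip r K \<kappa>"], rule some_equality) (auto dest: low_pair_unique)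

lemma raise_eq: "raise_pair \<kappa> r D D' \<Longrightarrow> raise r \<kappa> = flip r (D' - D) \<kappa>"
  unfolding raise_def by (rule arg_cong[where f = "\<lambda>K. flip r K \<kappa>"], rule some_equality) (auto dest: raise_pair_unique)

lemma low_string:
  assumes "chain_coloring \<kappa>" "0 < phi \<kappa> r"
  shows "chain_coloring (low r \<kappa>)" "raise r (low r \<kappa>) = \<kappa>"
    "eps (low r \<kappa>) r = eps \<kappa> r + 1" "phi (low r \<kappa>) r = phi \<kappa> r - 1"
proof -
  obtain D D' where p: "low_pair \<kappa> r D D'" by (rule low_pair_exists[OF assms(2)])
  note q = low_pair_flip[OF assms(1) p] low_eq[OF p]
  show "chain_coloring (low r \<kappa>)" using chain_coloring_flip[OF assms(1)] coversD(1,2)[OF low_pairD(1)[OF p]] q(4) by simp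
  show "raise r (low r \<kappa>) = \<kappa>" using raise_eq[OF q(1)] q(4) by simp
  show "eps (low r \<kappa>) r = eps \<kappa> r + 1" "phi (low r \<kappa>) r = phi \<kappa> r - 1" using q by simp_all
qed

lemma raise_string:
  assumes "chain_coloring \<kappa>" "0 < eps \<kappa> r"
  shows "chain_coloring (raise r \<kappa>)" "low r (raise r \<kappa>) = \<kappa>"
    "eps (raise r \<kappa>) r = eps \<kappa> r - 1" "phi (raise r \<kappa>) r = phi \<kappa> r + 1"
proof -
  obtain D D' where p: "raise_pair \<kappa> r D D'" by (rule raise_pair_exists[OF assms(2)])
  note q = raise_pair_flip[OF assms(1) p] raise_eq[OF p]
  show "chain_coloring (raise r \<kappa>)" using chain_coloring_flip[OF assms(1)] coversD(1,2)[OF raise_pairD(1)[OF p]] q(4) by simp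
  show "low r (raise r \<kappa>) = \<kappa>" using low_eq[OF q(1)] q(4) by simp
  show "eps (raise r \<kappa>) r = eps \<kappa> r - 1" "phi (raise r \<kappa>) r = phi \<kappa> r + 1" using q by simp_all
qed

end

section \<open>Failures of the tableau condition\<close>

context three_one_free
begin

definition at_rank :: "('a \<Rightarrow> nat) \<Rightarrow> nat \<Rightarrow> nat \<Rightarrow> 'a set" where
  "at_rank \<kappa> s c = {x \<in> color_class \<kappa> s. rk (color_class \<kappa> s) x = c}"

text \<open>The tableau condition for rows \<open>r\<close> and \<open>r + 1\<close> is violated in column \<open>c\<close>; the quantifier over the
entries of row \<open>r\<close> includes the case that this entry is missing.\<close>
definition fails :: "('a \<Rightarrow> nat) \<Rightarrow> nat \<Rightarrow> nat \<Rightarrow> bool" where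
  "fails \<kappa> r c \<longleftrightarrow> (\<exists>b\<in>at_rank \<kappa> (Suc r) c. \<forall>a\<in>at_rank \<kappa> r c. b \<prec> a)"

definition tableau :: "('a \<Rightarrow> nat) \<Rightarrow> bool" where
  "tableau \<kappa> \<longleftrightarrow> (\<forall>r\<ge>1. \<forall>c. \<not> fails \<kappa> r c)"

definition first_fail :: "('a \<Rightarrow> nat) \<Rightarrow> nat \<Rightarrow> nat \<Rightarrow> bool" where
  "first_fail \<kappa> r c \<longleftrightarrow> fails \<kappa> r c \<and> (\<forall>c'<c. \<not> fails \<kappa> r c')"

text \<open>The first cut of negative height. Heights decrease in steps of one, so the value there is \<open>-1\<close>.\<close>
definition negcut :: "('a \<Rightarrow> nat) \<Rightarrow> nat \<Rightarrow> 'a set \<Rightarrow> bool" where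
  "negcut \<kappa> r D \<longleftrightarrow> D \<in> cuts (two_rows \<kappa> r) \<and> height \<kappa> r D = -1 \<and>
     (\<forall>E\<in>cuts (two_rows \<kappa> r). E \<subset> D \<longrightarrow> 0 \<le> height \<kappa> r E)"

lemma negcutD:
  assumes "negcut \<kappa> r D"
  shows "D \<in> cuts (two_rows \<kappa> r)" "height \<kappa> r D = -1"
    "E \<in> cuts (two_rows \<kappa> r) \<Longrightarrow> E \<subset> D \<Longrightarrow> 0 \<le> height \<kappa> r E"
  using assms by (simp_all add: negcut_def)

lemma negcut_unique:
  assumes "negcut \<kappa> r D" "negcut \<kappa> r E"
  shows "D = E"
proof -
  note D = negcutD[OF assms(1)] and E = negcutD[OF assms(2)]
  have "\<not> D \<subset> E" "\<not> E \<subset> D" using D(2) E(2) D(3)[OF E(1)] E(3)[OF D(1)] by auto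
  then show ?thesis using cuts_linear[OF D(1) E(1)] by auto
qed

lemma cut_fails:
  assumes \<kappa>: "chain_coloring \<kappa>" and D: "D \<in> cuts (two_rows \<kappa> r)" and neg: "height \<kappa> r D < 0"
  shows "fails \<kappa> r (card (D \<inter> color_class \<kappa> r) + 1)"
proof -
  have "D \<in> cuts (color_class \<kappa> r \<union> color_class \<kappa> (Suc r))" "card (D \<inter> color_class \<kappa> r) < card (D \<inter> color_class \<kappa> (Suc r))"
    using D neg by (simp_all add: two_rows_def height_def)
  from cut_gives_fail[OF chain_color_class[OF \<kappa>] chain_color_class[OF \<kappa>] this]
  show ?thesis by (auto simp: fails_def at_rank_def)
qed

text \<open>Both descriptions of the place where the tableau condition breaks down agree: with this lemma and
the next one, the first failing column can be read off from the first negative cut. This is what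
makes it robust under changes beyond that cut.\<close>
lemma first_fail_negcut:
  assumes \<kappa>: "chain_coloring \<kappa>" and f: "first_fail \<kappa> r c"
  obtains D where "negcut \<kappa> r D" "card (D \<inter> color_class \<kappa> r) + 1 = c"
proof -
  let ?U = "color_class \<kappa> r" and ?V = "color_class \<kappa> (Suc r)"
  have fail: "fails \<kappa> r c" using f unfolding first_fail_def by (rule conjunct1)
  have nofail: "\<forall>c'<c. \<not> fails \<kappa> r c'" using f unfolding first_fail_def by (rule conjunct2)
  have least: "c \<le> c'" if "fails \<kappa> r c'" for c' using nofail that by (meson not_le)
  obtain b where b: "b \<in> ?V" "rk ?V b = c + 0" and ba: "\<And>a. a \<in> ?U \<Longrightarrow> rk ?U a = c \<Longrightarrow> b \<prec> a"
    using fail unfolding fails_def at_rank_def by auto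
  have c1: "1 \<le> c" using rk_bounds[OF chain_color_class[OF \<kappa>] b(1)] b(2) by simp
  have dj: "?U \<inter> ?V = {}" by (rule color_class_disjoint) simp
  obtain j where j: "1 \<le> j" "j \<le> c"
    and cut: "{a \<in> ?U. rk ?U a < j} \<union> {b \<in> ?V. rk ?V b \<le> j + 0} \<in> cuts (?U \<union> ?V)" (is "?D \<in> _")
    and cU: "card {a \<in> ?U. rk ?U a < j} = j - 1" and cV: "card {b \<in> ?V. rk ?V b \<le> j + 0} = j + 0"
    by (rule fail_gives_cut[OF chain_color_class[OF \<kappa>] chain_color_class[OF \<kappa>] dj b c1 ba])
  have int: "?D \<inter> ?U = {a \<in> ?U. rk ?U a < j}" "?D \<inter> ?V = {b \<in> ?V. rk ?V b \<le> j + 0}" using dj by auto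
  have D: "?D \<in> cuts (two_rows \<kappa> r)" using cut by (simp add: two_rows_def)
  have h: "height \<kappa> r ?D = -1" unfolding height_def int cU cV using j(1) by simp
  have cD: "card (?D \<inter> ?U) + 1 = j" unfolding int cU using j(1) by simp
  have jc: "j = c" using least[OF cut_fails[OF \<kappa> D]] h cD j by simp
  have "0 \<le> height \<kappa> r E" if E: "E \<in> cuts (two_rows \<kappa> r)" "E \<subset> ?D" for E
  proof (rule ccontr)
    assume n: "\<not> 0 \<le> height \<kappa> r E"
    then have "c \<le> card (E \<inter> ?U) + 1" using least[OF cut_fails[OF \<kappa> E(1)]] by simp
    moreover have "card (E \<inter> ?U) < card (E \<inter> ?V)" using n by (simp add: height_def)
    moreover have "card (E \<inter> ?U) \<le> card (?D \<inter> ?U)" "card (E \<inter> ?V) \<le> card (?D \<inter> ?V)"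
      using E(2) by (intro card_mono; auto)+
    ultimately have "card (E \<inter> ?U) = card (?D \<inter> ?U)" "card (E \<inter> ?V) = card (?D \<inter> ?V)"
      using cD jc cV int by simp_all
    then have "E \<inter> ?U = ?D \<inter> ?U" "E \<inter> ?V = ?D \<inter> ?V"
      using E(2) by (intro card_subset_eq; auto)+
    then have "E \<inter> (?U \<union> ?V) = ?D \<inter> (?U \<union> ?V)" by auto
    then show False using E(2) by auto
  qed
  then have "negcut \<kappa> r ?D" using D h by (simp add: negcut_def)
  then show ?thesis using that[of ?D] cD jc by simp
qed

lemma negcut_first_fail:
  assumes \<kappa>: "chain_coloring \<kappa>" and D: "negcut \<kappa> r D"
  shows "first_fail \<kappa> r (card (D \<inter> color_class \<kappa> r) + 1)"
proof -
  have f: "fails \<kappa> r (card (D \<inter> color_class \<kappa> r) + 1)"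
    using cut_fails[OF \<kappa> negcutD(1)[OF D]] negcutD(2)[OF D] by simp
  define c where "c = (LEAST c. fails \<kappa> r c)"
  have "fails \<kappa> r c" unfolding c_def by (rule LeastI[of "fails \<kappa> r", OF f])
  moreover have "\<not> fails \<kappa> r c'" if "c' < c" for c' using that not_less_Least[of c' "fails \<kappa> r"] unfolding c_def by simp
  ultimately have ff: "first_fail \<kappa> r c" by (simp add: first_fail_def)
  obtain E where E: "negcut \<kappa> r E" "card (E \<inter> color_class \<kappa> r) + 1 = c" by (rule first_fail_negcut[OF \<kappa> ff])
  then show ?thesis using negcut_unique[OF D E(1)] ff by simp
qed

lemma negcut_eps:
  assumes "negcut \<kappa> r D" shows "1 \<le> eps \<kappa> r"
  using min_height_le[OF negcutD(1)[OF assms]] negcutD(2)[OF assms] by (simp add: eps_def)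

definition row_equiv :: "nat \<Rightarrow> ('a \<Rightarrow> nat) \<Rightarrow> ('a \<Rightarrow> nat) \<Rightarrow> bool" where
  "row_equiv r \<kappa> \<kappa>' \<longleftrightarrow> two_rows \<kappa>' r = two_rows \<kappa> r \<and> (\<forall>x. x \<notin> two_rows \<kappa> r \<longrightarrow> \<kappa>' x = \<kappa> x)"

lemma row_equiv_refl: "row_equiv r \<kappa> \<kappa>"
  by (simp add: row_equiv_def)

lemma row_equiv_trans: "row_equiv r \<kappa> \<kappa>' \<Longrightarrow> row_equiv r \<kappa>' \<kappa>'' \<Longrightarrow> row_equiv r \<kappa> \<kappa>''"
  by (simp add: row_equiv_def)

lemma row_equiv_flip: "K \<subseteq> two_rows \<kappa> r \<Longrightarrow> row_equiv r \<kappa> (flip r K \<kappa>)"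
  by (auto simp: row_equiv_def flip_def)

lemma row_equiv_color_class:
  assumes "row_equiv r \<kappa> \<kappa>'" "s \<noteq> r" "s \<noteq> Suc r"
  shows "color_class \<kappa>' s = color_class \<kappa> s"
proof -
  have two: "two_rows \<kappa>' r = two_rows \<kappa> r"
    using assms(1) unfolding row_equiv_def by (rule conjunct1)
  have eq: "\<kappa>' x = \<kappa> x" if "x \<notin> two_rows \<kappa> r" for x
    using assms(1) that unfolding row_equiv_def by blast
  have "x \<in> color_class \<kappa>' s \<longleftrightarrow> x \<in> color_class \<kappa> s" for x
  proof (cases "x \<in> two_rows \<kappa> r")
    case True
    then have "x \<in> two_rows \<kappa>' r" using two by simp
    then show ?thesis using True assms(2,3) by (auto simp: two_rows_def color_class_def)
  next
    case False
    then show ?thesis using eq[OF False] by (simp add: color_class_def)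
  qed
  then show ?thesis by blast
qed

text \<open>Lowering acts beyond the last lowest cut, and this cut contains the first negative one.\<close>
lemma negcut_low:
  assumes \<kappa>: "chain_coloring \<kappa>" and D: "negcut \<kappa> r D" and phi: "0 < phi \<kappa> r"
  shows "negcut (low r \<kappa>) r D \<and> (\<forall>x\<in>D. low r \<kappa> x = \<kappa> x)"
proof -
  obtain E E' where p: "low_pair \<kappa> r E E'" by (rule low_pair_exists[OF phi])
  note c = coversD[OF low_pairD(1)[OF p]] and n = negcutD[OF D]
  have "height \<kappa> r E < 0" using low_pairD(2)[OF p] min_height_le[OF n(1)] n(2) by simp
  then have "\<not> E \<subset> D" using n(3)[OF c(1)] by auto
  then have DE: "D \<subseteq> E" using cuts_linear[OF n(1) c(1)] by auto
  have "F \<inter> (E' - E) = {}" if "F \<subseteq> D" for F using that DE by auto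
  then have "negcut (low r \<kappa>) r D"
    using n by (simp add: negcut_def low_eq[OF p] height_flip_outside psubset_imp_subset)
  moreover have "\<forall>x\<in>D. low r \<kappa> x = \<kappa> x" using DE by (auto simp: low_eq[OF p] flip_def)
  ultimately show ?thesis by simp
qed

text \<open>Raising acts between the first lowest cut and its predecessor. As long as the minimum is below
\<open>-1\<close>, the predecessor contains the first negative cut.\<close>
lemma negcut_raise:
  assumes \<kappa>: "chain_coloring \<kappa>" and D: "negcut \<kappa> r D" and eps: "1 < eps \<kappa> r"
  shows "negcut (raise r \<kappa>) r D \<and> (\<forall>x\<in>D. raise r \<kappa> x = \<kappa> x)"
proof -
  have "0 < eps \<kappa> r" using eps by simp
  then obtain E E' where p: "raise_pair \<kappa> r E E'" by (rule raise_pair_exists)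
  note c = coversD[OF raise_pairD(1)[OF p]] and n = negcutD[OF D]
  have "height \<kappa> r E' < -1" using raise_pairD(2)[OF p] eps by (simp add: eps_def)
  then have "\<not> E' \<subseteq> D" using n(2) n(3)[OF c(2)] by fastforce
  then have DE: "D \<subseteq> E" using c(4)[OF n(1)] by blast
  have "F \<inter> (E' - E) = {}" if "F \<subseteq> D" for F using that DE by auto
  then have "negcut (raise r \<kappa>) r D"
    using n by (simp add: negcut_def raise_eq[OF p] height_flip_outside psubset_imp_subset)
  moreover have "\<forall>x\<in>D. raise r \<kappa> x = \<kappa> x" using DE by (auto simp: raise_eq[OF p] flip_def)
  ultimately show ?thesis by simp
qed

lemma row_equiv_low:
  assumes "0 < phi \<kappa> r" shows "row_equiv r \<kappa> (low r \<kappa>)"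
proof -
  obtain E E' where p: "low_pair \<kappa> r E E'" by (rule low_pair_exists[OF assms])
  have "E' - E \<subseteq> two_rows \<kappa> r" using coversD(2)[OF low_pairD(1)[OF p]] by (auto simp: cuts_def)
  then show ?thesis using row_equiv_flip low_eq[OF p] by simp
qed

lemma row_equiv_raise:
  assumes "0 < eps \<kappa> r" shows "row_equiv r \<kappa> (raise r \<kappa>)"
proof -
  obtain E E' where p: "raise_pair \<kappa> r E E'" by (rule raise_pair_exists[OF assms])
  have "E' - E \<subseteq> two_rows \<kappa> r" using coversD(2)[OF raise_pairD(1)[OF p]] by (auto simp: cuts_def)
  then show ?thesis using row_equiv_flip raise_eq[OF p] by simp
qed

definition closed_at :: "nat \<Rightarrow> ('a \<Rightarrow> nat) set \<Rightarrow> bool" where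
  "closed_at r Y \<longleftrightarrow> (\<forall>\<kappa>\<in>Y. (0 < phi \<kappa> r \<longrightarrow> low r \<kappa> \<in> Y) \<and> (0 < eps \<kappa> r \<longrightarrow> raise r \<kappa> \<in> Y))"

lemma closed_atD:
  assumes "closed_at r Y" "\<kappa> \<in> Y"
  shows "0 < phi \<kappa> r \<Longrightarrow> low r \<kappa> \<in> Y" "0 < eps \<kappa> r \<Longrightarrow> raise r \<kappa> \<in> Y"
  using assms unfolding closed_at_def by blast+

text \<open>Steps along a string, lowering for positive and raising for negative numbers.\<close>
definition shift :: "nat \<Rightarrow> int \<Rightarrow> ('a \<Rightarrow> nat) \<Rightarrow> 'a \<Rightarrow> nat" where
  "shift r n \<kappa> = (if 0 \<le> n then (low r ^^ nat n) \<kappa> else (raise r ^^ nat (- n)) \<kappa>)"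

lemma low_iterate:
  assumes \<kappa>: "chain_coloring \<kappa>" and k: "int k \<le> phi \<kappa> r"
  shows "chain_coloring ((low r ^^ k) \<kappa>)" "phi ((low r ^^ k) \<kappa>) r = phi \<kappa> r - int k"
    "eps ((low r ^^ k) \<kappa>) r = eps \<kappa> r + int k" "(raise r ^^ k) ((low r ^^ k) \<kappa>) = \<kappa>"
    "row_equiv r \<kappa> ((low r ^^ k) \<kappa>)"
proof -
  have "chain_coloring ((low r ^^ k) \<kappa>) \<and> phi ((low r ^^ k) \<kappa>) r = phi \<kappa> r - int k \<and>
    eps ((low r ^^ k) \<kappa>) r = eps \<kappa> r + int k \<and> (raise r ^^ k) ((low r ^^ k) \<kappa>) = \<kappa> \<and>
    row_equiv r \<kappa> ((low r ^^ k) \<kappa>)"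
    using k
  proof (induction k)
    case 0
    show ?case using \<kappa> by (simp add: row_equiv_refl)
  next
    case (Suc k)
    let ?\<kappa> = "(low r ^^ k) \<kappa>"
    have "int k \<le> phi \<kappa> r" using Suc.prems by simp
    from Suc.IH[OF this] have IH: "chain_coloring ?\<kappa>" "phi ?\<kappa> r = phi \<kappa> r - int k" "eps ?\<kappa> r = eps \<kappa> r + int k"
      "(raise r ^^ k) ?\<kappa> = \<kappa>" "row_equiv r \<kappa> ?\<kappa>" by simp_all
    have pos: "0 < phi ?\<kappa> r" using IH(2) Suc.prems by simp
    note step = low_string[OF IH(1) pos]
    have "(raise r ^^ Suc k) (low r ?\<kappa>) = (raise r ^^ k) ?\<kappa>"
      by (simp only: funpow_Suc_right o_apply step(2))
    moreover have "row_equiv r \<kappa> (low r ?\<kappa>)" by (rule row_equiv_trans[OF IH(5) row_equiv_low[OF pos]])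
    ultimately show ?case using step IH by simp
  qed
  then show "chain_coloring ((low r ^^ k) \<kappa>)" "phi ((low r ^^ k) \<kappa>) r = phi \<kappa> r - int k"
    "eps ((low r ^^ k) \<kappa>) r = eps \<kappa> r + int k" "(raise r ^^ k) ((low r ^^ k) \<kappa>) = \<kappa>"
    "row_equiv r \<kappa> ((low r ^^ k) \<kappa>)" by blast+
qed

lemma low_iterate_closed:
  assumes \<kappa>: "chain_coloring \<kappa>" and k: "int k \<le> phi \<kappa> r" and Y: "closed_at r Y" "\<kappa> \<in> Y"
  shows "(low r ^^ k) \<kappa> \<in> Y"
  using k
proof (induction k)
  case (Suc k)
  have k: "int k \<le> phi \<kappa> r" using Suc.prems by simp
  have "0 < phi ((low r ^^ k) \<kappa>) r" using low_iterate(2)[OF \<kappa> k] Suc.prems by simp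
  then show ?case using closed_atD(1)[OF Y(1) Suc.IH[OF k]] by simp
qed (use Y in simp)

lemma low_iterate_negcut:
  assumes \<kappa>: "chain_coloring \<kappa>" and k: "int k <= phi \<kappa> r" and D: "negcut \<kappa> r D"
  shows "negcut ((low r ^^ k) \<kappa>) r D \<and> (\<forall>x\<in>D. (low r ^^ k) \<kappa> x = \<kappa> x)"
  using k
proof (induction k)
  case (Suc k)
  let ?\<kappa> = "(low r ^^ k) \<kappa>"
  have k: "int k \<le> phi \<kappa> r" "int k <= phi \<kappa> r" using Suc.prems by simp_all
  have "0 < phi ?\<kappa> r" using low_iterate(2)[OF \<kappa> k(1)] Suc.prems by simp
  then have "negcut (low r ?\<kappa>) r D \<and> (\<forall>x\<in>D. low r ?\<kappa> x = ?\<kappa> x)"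
    using negcut_low[OF low_iterate(1)[OF \<kappa> k(1)]] Suc.IH[OF k(2)] by blast
  then show ?case using Suc.IH[OF k(2)] by simp
qed (use D in simp)

lemma raise_iterate:
  assumes \<kappa>: "chain_coloring \<kappa>" and k: "int k \<le> eps \<kappa> r"
  shows "chain_coloring ((raise r ^^ k) \<kappa>)" "eps ((raise r ^^ k) \<kappa>) r = eps \<kappa> r - int k"
    "phi ((raise r ^^ k) \<kappa>) r = phi \<kappa> r + int k" "(low r ^^ k) ((raise r ^^ k) \<kappa>) = \<kappa>"
    "row_equiv r \<kappa> ((raise r ^^ k) \<kappa>)"
proof -
  have "chain_coloring ((raise r ^^ k) \<kappa>) \<and> eps ((raise r ^^ k) \<kappa>) r = eps \<kappa> r - int k \<and>
    phi ((raise r ^^ k) \<kappa>) r = phi \<kappa> r + int k \<and> (low r ^^ k) ((raise r ^^ k) \<kappa>) = \<kappa> \<and>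
    row_equiv r \<kappa> ((raise r ^^ k) \<kappa>)"
    using k
  proof (induction k)
    case 0
    show ?case using \<kappa> by (simp add: row_equiv_refl)
  next
    case (Suc k)
    let ?\<kappa> = "(raise r ^^ k) \<kappa>"
    have "int k \<le> eps \<kappa> r" using Suc.prems by simp
    from Suc.IH[OF this] have IH: "chain_coloring ?\<kappa>" "eps ?\<kappa> r = eps \<kappa> r - int k" "phi ?\<kappa> r = phi \<kappa> r + int k"
      "(low r ^^ k) ?\<kappa> = \<kappa>" "row_equiv r \<kappa> ?\<kappa>" by simp_all
    have pos: "0 < eps ?\<kappa> r" using IH(2) Suc.prems by simp
    note step = raise_string[OF IH(1) pos]
    have "(low r ^^ Suc k) (raise r ?\<kappa>) = (low r ^^ k) ?\<kappa>"
      by (simp only: funpow_Suc_right o_apply step(2))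
    moreover have "row_equiv r \<kappa> (raise r ?\<kappa>)" by (rule row_equiv_trans[OF IH(5) row_equiv_raise[OF pos]])
    ultimately show ?case using step IH by simp
  qed
  then show "chain_coloring ((raise r ^^ k) \<kappa>)" "eps ((raise r ^^ k) \<kappa>) r = eps \<kappa> r - int k"
    "phi ((raise r ^^ k) \<kappa>) r = phi \<kappa> r + int k" "(low r ^^ k) ((raise r ^^ k) \<kappa>) = \<kappa>"
    "row_equiv r \<kappa> ((raise r ^^ k) \<kappa>)" by blast+
qed

lemma raise_iterate_closed:
  assumes \<kappa>: "chain_coloring \<kappa>" and k: "int k \<le> eps \<kappa> r" and Y: "closed_at r Y" "\<kappa> \<in> Y"
  shows "(raise r ^^ k) \<kappa> \<in> Y"
  using k
proof (induction k)
  case (Suc k)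
  have k: "int k \<le> eps \<kappa> r" using Suc.prems by simp
  have "0 < eps ((raise r ^^ k) \<kappa>) r" using raise_iterate(2)[OF \<kappa> k] Suc.prems by simp
  then show ?case using closed_atD(2)[OF Y(1) Suc.IH[OF k]] by simp
qed (use Y in simp)

lemma raise_iterate_negcut:
  assumes \<kappa>: "chain_coloring \<kappa>" and k: "int k < eps \<kappa> r" and D: "negcut \<kappa> r D"
  shows "negcut ((raise r ^^ k) \<kappa>) r D \<and> (\<forall>x\<in>D. (raise r ^^ k) \<kappa> x = \<kappa> x)"
  using k
proof (induction k)
  case (Suc k)
  let ?\<kappa> = "(raise r ^^ k) \<kappa>"
  have k: "int k \<le> eps \<kappa> r" "int k < eps \<kappa> r" using Suc.prems by simp_all
  have "1 < eps ?\<kappa> r" using raise_iterate(2)[OF \<kappa> k(1)] Suc.prems by simp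
  then have "negcut (raise r ?\<kappa>) r D \<and> (\<forall>x\<in>D. raise r ?\<kappa> x = ?\<kappa> x)"
    using negcut_raise[OF raise_iterate(1)[OF \<kappa> k(1)]] Suc.IH[OF k(2)] by blast
  then show ?case using Suc.IH[OF k(2)] by simp
qed (use D in simp)

lemma shift_props:
  assumes \<kappa>: "chain_coloring \<kappa>" and n: "- eps \<kappa> r \<le> n" "n \<le> phi \<kappa> r"
  shows "chain_coloring (shift r n \<kappa>)" "eps (shift r n \<kappa>) r = eps \<kappa> r + n"
    "phi (shift r n \<kappa>) r = phi \<kappa> r - n" "shift r (- n) (shift r n \<kappa>) = \<kappa>"
    "row_equiv r \<kappa> (shift r n \<kappa>)"
    "closed_at r Y \<Longrightarrow> \<kappa> \<in> Y \<Longrightarrow> shift r n \<kappa> \<in> Y"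
    "- eps \<kappa> r < n \<Longrightarrow> negcut \<kappa> r D \<Longrightarrow> negcut (shift r n \<kappa>) r D \<and> (\<forall>x\<in>D. shift r n \<kappa> x = \<kappa> x)"
proof -
  have 1: "int (nat n) \<le> phi \<kappa> r" if "0 \<le> n" using n that by simp
  have 2: "int (nat (- n)) \<le> eps \<kappa> r" if "\<not> 0 \<le> n" using n that by simp
  note L = low_iterate[OF \<kappa> 1] and R = raise_iterate[OF \<kappa> 2]
  show "chain_coloring (shift r n \<kappa>)" using L(1) R(1) by (simp add: shift_def)
  show "eps (shift r n \<kappa>) r = eps \<kappa> r + n"
    by (cases "0 \<le> n") (simp_all add: shift_def L(3) R(2))
  show "phi (shift r n \<kappa>) r = phi \<kappa> r - n"
    by (cases "0 \<le> n") (simp_all add: shift_def L(2) R(3))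
  show "shift r (- n) (shift r n \<kappa>) = \<kappa>"
  proof (cases "0 < n")
    case True
    then show ?thesis using L(4) by (simp add: shift_def)
  next
    case False
    then show ?thesis using R(4) by (cases "n = 0") (simp_all add: shift_def)
  qed
  show "row_equiv r \<kappa> (shift r n \<kappa>)" using L(5) R(5) by (simp add: shift_def)
  show "shift r n \<kappa> \<in> Y" if "closed_at r Y" "\<kappa> \<in> Y"
    using low_iterate_closed[OF \<kappa> 1 that] raise_iterate_closed[OF \<kappa> 2 that] by (simp add: shift_def)
  show "negcut (shift r n \<kappa>) r D \<and> (\<forall>x\<in>D. shift r n \<kappa> x = \<kappa> x)" if "- eps \<kappa> r < n" "negcut \<kappa> r D"
  proof (cases "0 \<le> n")
    case True
    then show ?thesis using low_iterate_negcut[OF \<kappa> 1 that(2)] by (simp add: shift_def)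
  next
    case False
    then have "int (nat (- n)) < eps \<kappa> r" using that(1) by simp
    then show ?thesis using raise_iterate_negcut[OF \<kappa> _ that(2)] False by (simp add: shift_def)
  qed
qed

lemma row_equiv_cards:
  assumes "row_equiv r \<kappa> \<kappa>'" "total \<kappa>' r = total \<kappa> r - 2 * n"
  shows "int (card (color_class \<kappa>' r)) = int (card (color_class \<kappa> r)) - n" "int (card (color_class \<kappa>' (Suc r))) = int (card (color_class \<kappa> (Suc r))) + n"
proof -
  have "card (two_rows \<mu> r) = card (color_class \<mu> r) + card (color_class \<mu> (Suc r))" for \<mu>
    unfolding two_rows_def by (rule card_Un_disjoint) (auto simp: color_class_def fin)
  then have "card (color_class \<kappa>' r) + card (color_class \<kappa>' (Suc r)) = card (color_class \<kappa> r) + card (color_class \<kappa> (Suc r))"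
    using assms(1) unfolding row_equiv_def by metis
  then show "int (card (color_class \<kappa>' r)) = int (card (color_class \<kappa> r)) - n" "int (card (color_class \<kappa>' (Suc r))) = int (card (color_class \<kappa> (Suc r))) + n"
    using assms(2) by (simp_all add: total_def)
qed

lemma total_eq: "total \<kappa> r = phi \<kappa> r - eps \<kappa> r"
  by (simp add: phi_def eps_def)

text \<open>Ranks inside \<open>D\<close> do not depend on the elements beyond \<open>D\<close>, since all of these are larger.\<close>
lemma at_rank_agree:
  assumes \<kappa>: "chain_coloring \<kappa>" and \<kappa>': "chain_coloring \<kappa>'"
    and re: "row_equiv r \<kappa> \<kappa>'" and D: "D \<in> cuts (two_rows \<kappa> r)" and agree: "\<forall>x\<in>D. \<kappa>' x = \<kappa> x"
    and s: "s \<noteq> r \<and> s \<noteq> Suc r \<or> c \<le> card (D \<inter> color_class \<kappa> s)"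
  shows "at_rank \<kappa>' s c = at_rank \<kappa> s c"
proof (cases "s \<noteq> r \<and> s \<noteq> Suc r")
  case True
  then show ?thesis using row_equiv_color_class[OF re] by (simp add: at_rank_def)
next
  case False
  have two: "two_rows \<kappa>' r = two_rows \<kappa> r" using re by (simp add: row_equiv_def)
  have sub: "color_class \<kappa> s \<subseteq> two_rows \<kappa> r" "color_class \<kappa>' s \<subseteq> two_rows \<kappa> r"
    using False two[symmetric] by (auto simp: two_rows_def)
  have DP: "D \<subseteq> P" using D by (auto simp: cuts_def two_rows_def color_class_def)
  have Dcolor_class: "D \<inter> color_class \<kappa>' s = D \<inter> color_class \<kappa> s" using agree by (auto simp: color_class_def)
  have c: "c \<le> card (D \<inter> color_class \<kappa> s)" "c \<le> card (D \<inter> color_class \<kappa>' s)" using False s Dcolor_class by auto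
  have rk: "rk (color_class \<kappa>' s) x = rk (color_class \<kappa> s) x" if x: "x \<in> D" for x
  proof -
    have "y \<in> D" if "y \<in> two_rows \<kappa> r" "y \<prec> x \<or> y = x" for y
    proof (rule ccontr)
      assume "y \<notin> D"
      then have xy: "x \<prec> y" using D x that(1) unfolding cuts_def by blast
      show False using that(2)
      proof
        assume "y \<prec> x"
        then show False using tr[OF xy] irr by blast
      next
        assume "y = x"
        then show False using xy irr by blast
      qed
    qed
    then have "{y \<in> color_class \<kappa>' s. y \<prec> x \<or> y = x} = {y \<in> D \<inter> color_class \<kappa>' s. y \<prec> x \<or> y = x}"
      "{y \<in> color_class \<kappa> s. y \<prec> x \<or> y = x} = {y \<in> D \<inter> color_class \<kappa> s. y \<prec> x \<or> y = x}" using sub by auto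
    then show ?thesis unfolding rk_def Dcolor_class by simp
  qed
  have 1: "x \<in> D" if "x \<in> at_rank \<kappa>' s c" for x
  proof -
    have x: "x \<in> color_class \<kappa>' s" "rk (color_class \<kappa>' s) x = c" using that by (simp_all add: at_rank_def)
    show ?thesis using cut_rk[OF chain_color_class[OF \<kappa>'] sub(2) D x(1)] x(2) c(2) by simp
  qed
  have 2: "x \<in> D" if "x \<in> at_rank \<kappa> s c" for x
  proof -
    have x: "x \<in> color_class \<kappa> s" "rk (color_class \<kappa> s) x = c" using that by (simp_all add: at_rank_def)
    show ?thesis using cut_rk[OF chain_color_class[OF \<kappa>] sub(1) D x(1)] x(2) c(1) by simp
  qed
  have 3: "x \<in> at_rank \<kappa>' s c \<longleftrightarrow> x \<in> at_rank \<kappa> s c" if "x \<in> D" for x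
  proof -
    have "x \<in> color_class \<kappa>' s \<longleftrightarrow> x \<in> color_class \<kappa> s" using that agree by (simp add: color_class_def)
    then show ?thesis using rk[OF that] by (simp add: at_rank_def)
  qed
  show ?thesis by (rule set_eqI) (metis 1 2 3)
qed

end

section \<open>The cancelling involution\<close>

context three_one_free
begin

definition content :: "('a \<Rightarrow> nat) \<Rightarrow> nat \<Rightarrow> nat" where
  "content \<kappa> s = card (color_class \<kappa> s)"

text \<open>A failure in the first failing column, and in this column for the largest row index. With the
largest index, a change of rows \<open>r\<close> and \<open>r + 1\<close> that keeps the entries of row \<open>r\<close> before column
\<open>c\<close> and those of row \<open>r + 1\<close> up to column \<open>c\<close> creates no failure that would take precedence.\<close>
definition canonical_failure :: "('a \<Rightarrow> nat) \<Rightarrow> nat \<Rightarrow> nat \<Rightarrow> bool" where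
  "canonical_failure \<kappa> c r \<longleftrightarrow> 1 \<le> r \<and> fails \<kappa> r c \<and> (\<forall>s c'. 1 \<le> s \<longrightarrow> c' < c \<or> c' = c \<and> r < s \<longrightarrow> \<not> fails \<kappa> s c')"

lemma canonical_failureD:
  assumes "canonical_failure \<kappa> c r"
  shows "1 \<le> r" "fails \<kappa> r c" "1 \<le> s \<Longrightarrow> c' < c \<or> c' = c \<and> r < s \<Longrightarrow> \<not> fails \<kappa> s c'"
  using assms unfolding canonical_failure_def by blast+

lemma fails_nonempty:
  assumes "fails \<kappa> r c" shows "\<exists>b\<in>P. \<kappa> b = Suc r"
  using assms by (auto simp: fails_def at_rank_def color_class_def)

lemma canonical_failure_exists:
  assumes "\<not> tableau \<kappa>"
  obtains c r where "canonical_failure \<kappa> c r"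
proof -
  define Q where "Q c \<longleftrightarrow> (\<exists>r\<ge>1. fails \<kappa> r c)" for c
  define c where "c = (LEAST c. Q c)"
  obtain c0 where "Q c0" using assms by (auto simp: tableau_def Q_def)
  then have "Q c" unfolding c_def by (rule LeastI[of Q])
  have least: "\<not> Q c'" if "c' < c" for c' using that not_less_Least[of c' Q] by (simp add: c_def)
  define R where "R r \<longleftrightarrow> 1 \<le> r \<and> fails \<kappa> r c" for r
  obtain r0 where r0: "R r0" using \<open>Q c\<close> by (auto simp: Q_def R_def)
  have "\<forall>r. R r \<longrightarrow> r < Suc (Max (\<kappa> ` P))"
  proof (intro allI impI)
    fix r assume "R r"
    then obtain b where "b \<in> P" "\<kappa> b = Suc r" using fails_nonempty[of \<kappa> r c] by (auto simp: R_def)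
    then have "Suc r \<le> Max (\<kappa> ` P)" using fin by (metis Max_ge finite_imageI imageI)
    then show "r < Suc (Max (\<kappa> ` P))" by simp
  qed
  from ex_has_greatest_nat[of R r0 "\<lambda>r. r", OF r0 this]
  obtain r where r: "R r" "\<forall>s. R s \<longrightarrow> s \<le> r" by blast
  have "\<not> fails \<kappa> s c'" if "1 \<le> s" "c' < c \<or> c' = c \<and> r < s" for s c'
    using that least[of c'] r(2)[rule_format, of s] by (auto simp: Q_def R_def)
  then have "canonical_failure \<kappa> c r" using r(1) by (simp add: canonical_failure_def R_def)
  then show ?thesis by (rule that)
qed

lemma canonical_failure_unique:
  assumes "canonical_failure \<kappa> c r" "canonical_failure \<kappa> c' r'"
  shows "c = c' \<and> r = r'"
proof -
  note b = canonical_failureD[OF assms(1)] and b' = canonical_failureD[OF assms(2)]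
  have "c = c'" using b(3)[OF b'(1), of c'] b'(2) b'(3)[OF b(1), of c] b(2) by (metis linorder_neqE_nat)
  moreover have "r = r'" using b(3)[OF b'(1), of c'] b'(2) b'(3)[OF b(1), of c] b(2) by (metis linorder_neqE_nat)
  ultimately show ?thesis ..
qed

lemma canonical_failure_not_tableau: "canonical_failure \<kappa> c r \<Longrightarrow> \<not> tableau \<kappa>"
  unfolding canonical_failure_def tableau_def by blast

text \<open>The simple reflection in the shifted action \<open>m \<mapsto> s (m + \<delta>) - \<delta>\<close> on weights, realized inside a
string.\<close>
definition dot :: "nat \<Rightarrow> ('a \<Rightarrow> nat) \<Rightarrow> 'a \<Rightarrow> nat" where
  "dot r \<kappa> = shift r (total \<kappa> r + 1) \<kappa>"

lemma dot_props:
  assumes \<kappa>: "chain_coloring \<kappa>" and D: "negcut \<kappa> r D"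
  shows "chain_coloring (dot r \<kappa>)" "row_equiv r \<kappa> (dot r \<kappa>)"
    "negcut (dot r \<kappa>) r D" "\<forall>x\<in>D. dot r \<kappa> x = \<kappa> x" "dot r (dot r \<kappa>) = \<kappa>"
    "closed_at r Y \<Longrightarrow> \<kappa> \<in> Y \<Longrightarrow> dot r \<kappa> \<in> Y"
    "content (dot r \<kappa>) r + 1 = content \<kappa> (Suc r)" "content (dot r \<kappa>) (Suc r) = content \<kappa> r + 1"
    "s \<noteq> r \<Longrightarrow> s \<noteq> Suc r \<Longrightarrow> content (dot r \<kappa>) s = content \<kappa> s"
proof -
  let ?n = "total \<kappa> r + 1"
  have n: "- eps \<kappa> r \<le> ?n" "?n \<le> phi \<kappa> r" "- eps \<kappa> r < ?n"
    using phi_nonneg[of \<kappa> r] negcut_eps[OF D] by (simp_all add: total_eq)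
  note S = shift_props[OF \<kappa> n(1,2), folded dot_def]
  have t: "total (dot r \<kappa>) r = total \<kappa> r - 2 * ?n" using S(2,3) by (simp add: total_eq)
  show "chain_coloring (dot r \<kappa>)" by (rule S(1))
  show re: "row_equiv r \<kappa> (dot r \<kappa>)" by (rule S(5))
  show "negcut (dot r \<kappa>) r D" "\<forall>x\<in>D. dot r \<kappa> x = \<kappa> x" using S(7)[OF n(3) D] by blast+
  have "total (dot r \<kappa>) r + 1 = - ?n" using t by simp
  then have "dot r (dot r \<kappa>) = shift r (- ?n) (dot r \<kappa>)" unfolding dot_def[of r "dot r \<kappa>"] by (rule arg_cong)
  then show "dot r (dot r \<kappa>) = \<kappa>" using S(4) by (rule trans)
  show "dot r \<kappa> \<in> Y" if "closed_at r Y" "\<kappa> \<in> Y" by (rule S(6)[OF that])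
  show "content (dot r \<kappa>) r + 1 = content \<kappa> (Suc r)" "content (dot r \<kappa>) (Suc r) = content \<kappa> r + 1"
    using row_equiv_cards[OF re t] by (simp_all add: content_def total_def)
  show "content (dot r \<kappa>) s = content \<kappa> s" if "s \<noteq> r" "s \<noteq> Suc r"
    using row_equiv_color_class[OF re that] by (simp add: content_def)
qed

lemma canonical_failure_negcut:
  assumes \<kappa>: "chain_coloring \<kappa>" and b: "canonical_failure \<kappa> c r"
  obtains D where "negcut \<kappa> r D" "card (D \<inter> color_class \<kappa> r) + 1 = c" "card (D \<inter> color_class \<kappa> (Suc r)) = c"
proof -
  have "first_fail \<kappa> r c" using canonical_failureD[OF b] by (simp add: first_fail_def)
  then obtain D where D: "negcut \<kappa> r D" "card (D \<inter> color_class \<kappa> r) + 1 = c" by (rule first_fail_negcut[OF \<kappa>])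
  moreover have "card (D \<inter> color_class \<kappa> (Suc r)) = c" using negcutD(2)[OF D(1)] D(2) by (simp add: height_def)
  ultimately show ?thesis by (rule that)
qed

text \<open>The first negative cut survives with its coloring. It consists of the entries of row \<open>r\<close> before
column \<open>c\<close> and those of row \<open>r + 1\<close> up to column \<open>c\<close>, which decide about all failures
that could take precedence.\<close>
lemma canonical_failure_dot:
  assumes \<kappa>: "chain_coloring \<kappa>" and b: "canonical_failure \<kappa> c r"
  shows "canonical_failure (dot r \<kappa>) c r"
proof -
  obtain D where D: "negcut \<kappa> r D" "card (D \<inter> color_class \<kappa> r) + 1 = c" "card (D \<inter> color_class \<kappa> (Suc r)) = c"
    by (rule canonical_failure_negcut[OF assms])
  note d = dot_props[OF \<kappa> D(1)]
  have "D \<inter> color_class (dot r \<kappa>) r = D \<inter> color_class \<kappa> r" using d(4) by (auto simp: color_class_def)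
  then have "first_fail (dot r \<kappa>) r c" using negcut_first_fail[OF d(1,3)] D(2) by simp
  then have f: "fails (dot r \<kappa>) r c" and ff: "\<And>c'. c' < c \<Longrightarrow> \<not> fails (dot r \<kappa>) r c'"
    unfolding first_fail_def by blast+
  have "\<not> fails (dot r \<kappa>) s c'" if s: "1 \<le> s" "c' < c \<or> c' = c \<and> r < s" for s c'
  proof (cases "s = r")
    case True
    then show ?thesis using s ff by auto
  next
    case False
    note A = at_rank_agree[OF \<kappa> d(1,2) negcutD(1)[OF D(1)] d(4)]
    have "at_rank (dot r \<kappa>) (Suc s) c' = at_rank \<kappa> (Suc s) c'"
    proof (rule A)
      show "Suc s \<noteq> r \<and> Suc s \<noteq> Suc r \<or> c' \<le> card (D \<inter> color_class \<kappa> (Suc s))"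
        using False s D(2) by (cases "Suc s = r") auto
    qed
    moreover have "at_rank (dot r \<kappa>) s c' = at_rank \<kappa> s c'"
    proof (rule A)
      show "s \<noteq> r \<and> s \<noteq> Suc r \<or> c' \<le> card (D \<inter> color_class \<kappa> s)"
        using False s D(3) by (cases "s = Suc r") auto
    qed
    ultimately show ?thesis using canonical_failureD(3)[OF b s] by (simp add: fails_def)
  qed
  then show ?thesis using f canonical_failureD(1)[OF b] unfolding canonical_failure_def by blast
qed

definition cancel :: "('a \<Rightarrow> nat) \<Rightarrow> 'a \<Rightarrow> nat" where
  "cancel \<kappa> = dot (SOME r. \<exists>c. canonical_failure \<kappa> c r) \<kappa>"

lemma cancel_eq:
  assumes "canonical_failure \<kappa> c r" shows "cancel \<kappa> = dot r \<kappa>"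
proof -
  have "(SOME r. \<exists>c. canonical_failure \<kappa> c r) = r"
  proof (rule some_equality)
    show "\<exists>c. canonical_failure \<kappa> c r" using assms by blast
    fix r' assume "\<exists>c. canonical_failure \<kappa> c r'"
    then show "r' = r" using canonical_failure_unique[OF assms] by blast
  qed
  then show ?thesis by (simp add: cancel_def)
qed

lemma row_equiv_bound:
  assumes "row_equiv r \<kappa> \<kappa>'" "\<kappa> ` P \<subseteq> {..N}" "Suc r \<le> N"
  shows "\<kappa>' ` P \<subseteq> {..N}"
proof
  fix k assume "k \<in> \<kappa>' ` P"
  then obtain x where x: "x \<in> P" "k = \<kappa>' x" by blast
  show "k \<in> {..N}"
  proof (cases "x \<in> two_rows \<kappa> r")
    case True
    then have "x \<in> two_rows \<kappa>' r" using assms(1) by (simp add: row_equiv_def)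
    then show ?thesis using x assms(3) by (auto simp: two_rows_def color_class_def)
  next
    case False
    then have "\<kappa>' x = \<kappa> x" using assms(1) by (simp add: row_equiv_def)
    then show ?thesis using x assms(2) by auto
  qed
qed

text \<open>The hypothesis on \<open>g\<close> is antisymmetry under the shifted reflections; the involution cancels all
colorings that are not tableaux. The bound \<open>N\<close> on the colors makes the sum finite, and the
involution respects it because a failure for rows \<open>r\<close> and \<open>r + 1\<close> requires row \<open>r + 1\<close> to be
nonempty.\<close>
lemma signed_sum_tableaux:
  fixes g :: "(nat \<Rightarrow> nat) \<Rightarrow> int"
  assumes Y: "\<And>\<kappa>. \<kappa> \<in> Y \<Longrightarrow> \<kappa> \<in> P \<rightarrow>\<^sub>E {1..}" "\<And>\<kappa>. \<kappa> \<in> Y \<Longrightarrow> chain_coloring \<kappa>"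
    and closed: "\<And>r. 1 \<le> r \<Longrightarrow> closed_at r Y"
    and g: "\<And>m m' r. \<lbrakk>1 \<le> r; Suc r \<le> N; m' r + 1 = m (Suc r); m' (Suc r) = m r + 1;
        \<And>s. s \<noteq> r \<Longrightarrow> s \<noteq> Suc r \<Longrightarrow> m' s = m s\<rbrakk> \<Longrightarrow> g m' = - g m"
  shows "(\<Sum>\<kappa>\<in>{\<kappa>\<in>Y. \<kappa> ` P \<subseteq> {..N}}. g (content \<kappa>)) = (\<Sum>\<kappa>\<in>{\<kappa>\<in>Y. \<kappa> ` P \<subseteq> {..N} \<and> tableau \<kappa>}. g (content \<kappa>))"
proof -
  let ?Y = "{\<kappa>\<in>Y. \<kappa> ` P \<subseteq> {..N}}" and ?T = "{\<kappa>\<in>Y. \<kappa> ` P \<subseteq> {..N} \<and> tableau \<kappa>}"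
  let ?Z = "{\<kappa>\<in>Y. \<kappa> ` P \<subseteq> {..N} \<and> \<not> tableau \<kappa>}"
  have "?Y \<subseteq> P \<rightarrow>\<^sub>E {..N}"
  proof
    fix \<kappa> assume "\<kappa> \<in> ?Y"
    then have "\<kappa> \<in> P \<rightarrow>\<^sub>E {1..}" "\<kappa> ` P \<subseteq> {..N}" using Y(1) by auto
    then show "\<kappa> \<in> P \<rightarrow>\<^sub>E {..N}" by (auto simp: PiE_iff)
  qed
  then have fY: "finite ?Y" using finite_PiE[OF fin, of "\<lambda>_. {..N}"] finite_subset by auto
  have Z: "cancel \<kappa> \<in> ?Z \<and> cancel (cancel \<kappa>) = \<kappa> \<and> g (content (cancel \<kappa>)) = - g (content \<kappa>)" if \<kappa>: "\<kappa> \<in> ?Z" for \<kappa>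
  proof -
    have ch: "chain_coloring \<kappa>" "\<kappa> \<in> Y" "\<kappa> ` P \<subseteq> {..N}" using \<kappa> Y by auto
    obtain c r where b: "canonical_failure \<kappa> c r" using \<kappa> canonical_failure_exists by blast
    obtain D where D: "negcut \<kappa> r D" by (rule canonical_failure_negcut[OF ch(1) b])
    note d = dot_props[OF ch(1) D]
    have b': "canonical_failure (dot r \<kappa>) c r" by (rule canonical_failure_dot[OF ch(1) b])
    have r: "1 \<le> r" "Suc r \<le> N" using canonical_failureD(1)[OF b] fails_nonempty[OF canonical_failureD(2)[OF b]] ch(3) by auto
    have 1: "dot r \<kappa> \<in> Y" by (rule d(6)[OF closed[OF r(1)] ch(2)])
    have 2: "dot r \<kappa> ` P \<subseteq> {..N}" by (rule row_equiv_bound[OF d(2) ch(3) r(2)])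
    have 3: "g (content (dot r \<kappa>)) = - g (content \<kappa>)" by (rule g[OF r d(7,8,9)])
    show ?thesis using 1 2 3 canonical_failure_not_tableau[OF b'] d(5) cancel_eq[OF b] cancel_eq[OF b'] by simp
  qed
  have "(\<Sum>\<kappa>\<in>?Z. g (content \<kappa>)) = (\<Sum>\<kappa>\<in>?Z. - g (content \<kappa>))"
    by (rule sum.reindex_bij_witness[of ?Z cancel cancel]) (use Z in simp_all)
  then have zero: "(\<Sum>\<kappa>\<in>?Z. g (content \<kappa>)) = 0" by (simp add: sum_negf)
  have "?Y = ?T \<union> ?Z" "?T \<inter> ?Z = {}" by auto
  then have "(\<Sum>\<kappa>\<in>?Y. g (content \<kappa>)) = (\<Sum>\<kappa>\<in>?T. g (content \<kappa>)) + (\<Sum>\<kappa>\<in>?Z. g (content \<kappa>))"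
    using fY by (metis (no_types, lifting) finite_Un sum.union_disjoint)
  then show ?thesis using zero by simp
qed

text \<open>Each string is symmetric: \<open>total = phi - eps\<close> is the number of steps to the opposite place in the
string.\<close>
lemma weights_symmetric:
  assumes Y: "\<And>\<kappa>. \<kappa> \<in> Y \<Longrightarrow> chain_coloring \<kappa>" and closed: "closed_at r Y"
    and m: "m' r = m (Suc r)" "m' (Suc r) = m r" "\<And>s. s \<noteq> r \<Longrightarrow> s \<noteq> Suc r \<Longrightarrow> m' s = m s"
  shows "card {\<kappa>\<in>Y. content \<kappa> = m} = card {\<kappa>\<in>Y. content \<kappa> = m'}"
proof -
  define S where "S \<kappa> = shift r (total \<kappa> r) \<kappa>" for \<kappa>
  have S: "S \<kappa> \<in> Y \<and> S (S \<kappa>) = \<kappa> \<and> content (S \<kappa>) r = content \<kappa> (Suc r) \<and> content (S \<kappa>) (Suc r) = content \<kappa> r \<and>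
      (\<forall>s. s \<noteq> r \<longrightarrow> s \<noteq> Suc r \<longrightarrow> content (S \<kappa>) s = content \<kappa> s)" if \<kappa>: "\<kappa> \<in> Y" for \<kappa>
  proof -
    have n: "- eps \<kappa> r \<le> total \<kappa> r" "total \<kappa> r \<le> phi \<kappa> r"
      using phi_nonneg[of \<kappa> r] eps_nonneg[of \<kappa> r] by (simp_all add: total_eq)
    note p = shift_props[OF Y[OF \<kappa>] n, folded S_def]
    have t: "total (S \<kappa>) r = total \<kappa> r - 2 * total \<kappa> r" using p(2,3) by (simp add: total_eq)
    have "S (S \<kappa>) = \<kappa>" using p(4) t by (simp add: S_def[of "S \<kappa>"])
    moreover have "content (S \<kappa>) r = content \<kappa> (Suc r)" "content (S \<kappa>) (Suc r) = content \<kappa> r"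
      using row_equiv_cards[OF p(5) t] by (simp_all add: content_def total_def)
    moreover have "content (S \<kappa>) s = content \<kappa> s" if "s \<noteq> r" "s \<noteq> Suc r" for s
      using row_equiv_color_class[OF p(5) that] by (simp add: content_def)
    ultimately show ?thesis using p(6)[OF closed \<kappa>] by blast
  qed
  have 1: "content (S \<kappa>) = m'" if "\<kappa> \<in> Y" "content \<kappa> = m" for \<kappa>
  proof
    fix s show "content (S \<kappa>) s = m' s" using S[OF that(1)] m that(2) by (cases "s = r"; cases "s = Suc r") auto
  qed
  have 2: "content (S \<kappa>) = m" if "\<kappa> \<in> Y" "content \<kappa> = m'" for \<kappa>
  proof
    fix s show "content (S \<kappa>) s = m s" using S[OF that(1)] m that(2) by (cases "s = r"; cases "s = Suc r") auto
  qed
  have "bij_betw S {\<kappa>\<in>Y. content \<kappa> = m} {\<kappa>\<in>Y. content \<kappa> = m'}"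
    by (rule bij_betw_byWitness[of _ S]) (use S 1 2 in auto)
  then show ?thesis by (rule bij_betw_same_card)
qed

lemma tableau_content_decreasing:
  assumes "chain_coloring \<kappa>" "tableau \<kappa>" "1 \<le> r"
  shows "content \<kappa> (Suc r) \<le> content \<kappa> r"
proof (rule ccontr)
  assume "\<not> ?thesis"
  then have "total \<kappa> r < 0" by (simp add: content_def total_def)
  then have "fails \<kappa> r (card (two_rows \<kappa> r \<inter> color_class \<kappa> r) + 1)"
    by (intro cut_fails[OF assms(1) cuts_self]) (simp add: total_height)
  then show False using assms(2,3) by (simp add: tableau_def)
qed

end

section \<open>Symmetric weight functions and alternating sums\<close>

definition weights :: "nat \<Rightarrow> nat \<Rightarrow> (nat \<Rightarrow> nat) set" where
  "weights N n = {m. (\<forall>i. i \<notin> {1..N} \<longrightarrow> m i = 0) \<and> (\<Sum>i\<in>{1..N}. m i) = n}"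

lemma finite_weights: "finite (weights N n)"
proof -
  let ?F = "{m. \<forall>i. (i \<in> {1..N} \<longrightarrow> m i \<in> {..n}) \<and> (i \<notin> {1..N} \<longrightarrow> m i = (0::nat))}"
  have "m \<in> ?F" if m: "m \<in> weights N n" for m
  proof -
    have "m i \<le> n" if "i \<in> {1..N}" for i
    proof -
      have "m i \<le> (\<Sum>i\<in>{1..N}. m i)" by (rule member_le_sum[OF that]) simp_all
      then show ?thesis using m by (simp add: weights_def)
    qed
    then show ?thesis using m by (simp add: weights_def)
  qed
  then have "weights N n \<subseteq> ?F" by blast
  then show ?thesis by (rule finite_subset) (rule finite_set_of_finite_funs; simp)
qed

lemma weights_eq_iff:
  assumes "m \<in> weights N n" "l \<in> weights N n'"
  shows "(\<forall>i\<in>{1..N}. m i = l i) \<longleftrightarrow> m = l"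
proof
  assume eq: "\<forall>i\<in>{1..N}. m i = l i"
  show "m = l"
  proof
    fix i show "m i = l i"
      using eq assms unfolding weights_def by (cases "i \<in> {1..N}") simp_all
  qed
qed simp

text \<open>The sign of \<open>\<pi>\<close> if \<open>m + \<delta>\<close> is the rearrangement of \<open>l + \<delta>\<close> by \<open>\<pi>\<close>, where
\<open>\<delta> = (N - 1, ..., 1, 0)\<close>. The sum of a symmetric function of \<open>m\<close> against these signs is its
coefficient at the Schur function of \<open>l\<close>.\<close>
definition alternant :: "nat \<Rightarrow> (nat \<Rightarrow> nat) \<Rightarrow> (nat \<Rightarrow> nat) \<Rightarrow> int" where
  "alternant N l m = (\<Sum>\<pi> | \<pi> permutes {1..N}.
     if \<forall>i\<in>{1..N}. m i + (N - i) = l (\<pi> i) + (N - \<pi> i) then sign \<pi> else 0)"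

lemma alternant_dot:
  assumes r: "1 \<le> r" "Suc r \<le> N"
    and m': "m' r + 1 = m (Suc r)" "m' (Suc r) = m r + 1" "\<And>s. s \<noteq> r \<Longrightarrow> s \<noteq> Suc r \<Longrightarrow> m' s = m s"
  shows "alternant N l m' = - alternant N l m"
proof -
  let ?\<tau> = "transpose r (Suc r)"
  let ?y = "\<lambda>m i. m i + (N - i)"
  have \<tau>: "?\<tau> permutes {1..N}" by (rule permutes_swap_id) (use r in auto)
  have y: "?y m' i = ?y m (?\<tau> i)" for i
    using r m' by (cases "i = r"; cases "i = Suc r") (auto simp: transpose_def)
  let ?c = "\<lambda>m \<pi>. \<forall>i\<in>{1..N}. ?y m i = l (\<pi> i) + (N - \<pi> i)"
  have c: "?c m' \<pi> \<longleftrightarrow> ?c m (\<pi> \<circ> ?\<tau>)" for \<pi>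
  proof -
    have "?c m' \<pi> \<longleftrightarrow> (\<forall>i\<in>{1..N}. ?y m (?\<tau> i) = l (\<pi> i) + (N - \<pi> i))" using y by simp
    also have "\<dots> \<longleftrightarrow> (\<forall>j\<in>?\<tau> ` {1..N}. ?y m (?\<tau> j) = l (\<pi> j) + (N - \<pi> j))"
      by (simp only: permutes_image[OF \<tau>])
    also have "\<dots> \<longleftrightarrow> ?c m (\<pi> \<circ> ?\<tau>)" by simp
    finally show ?thesis .
  qed
  have s: "sign (\<pi> \<circ> ?\<tau>) = - sign \<pi>" if "\<pi> permutes {1..N}" for \<pi>
  proof -
    have "permutation \<pi>" "permutation ?\<tau>" using that \<tau> permutation_permutes by blast+
    then show ?thesis by (simp add: sign_compose sign_swap_id)
  qed
  have "alternant N l m' = (\<Sum>\<pi> | \<pi> permutes {1..N}. - (if ?c m \<pi> then sign \<pi> else 0))"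
    unfolding alternant_def
  proof (rule sum.reindex_bij_witness[of _ "\<lambda>\<pi>. \<pi> \<circ> ?\<tau>" "\<lambda>\<pi>. \<pi> \<circ> ?\<tau>"])
    fix \<pi> assume "\<pi> \<in> {\<pi>. \<pi> permutes {1..N}}"
    then have \<pi>: "\<pi> permutes {1..N}" by simp
    show "\<pi> \<circ> ?\<tau> \<circ> ?\<tau> = \<pi>" by (simp add: comp_assoc)
    show "\<pi> \<circ> ?\<tau> \<circ> ?\<tau> = \<pi>" by (simp add: comp_assoc)
    show "\<pi> \<circ> ?\<tau> \<in> {\<pi>. \<pi> permutes {1..N}}" using permutes_compose[OF \<tau> \<pi>] by simp
    show "\<pi> \<circ> ?\<tau> \<in> {\<pi>. \<pi> permutes {1..N}}" using permutes_compose[OF \<tau> \<pi>] by simp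
    show "- (if ?c m (\<pi> \<circ> ?\<tau>) then sign (\<pi> \<circ> ?\<tau>) else 0) = (if ?c m' \<pi> then sign \<pi> else 0)"
      unfolding c s[OF \<pi>] by simp
  qed
  also have "\<dots> = - alternant N l m" unfolding alternant_def by (rule sum_negf)
  finally show ?thesis .
qed

definition decreasing_upto :: "nat \<Rightarrow> (nat \<Rightarrow> nat) \<Rightarrow> bool" where
  "decreasing_upto N l \<longleftrightarrow> (\<forall>r. 1 \<le> r \<longrightarrow> Suc r \<le> N \<longrightarrow> l (Suc r) \<le> l r)"

lemma decreasing_upto_antimono:
  assumes "decreasing_upto N l" "1 \<le> i" "i \<le> j" "j \<le> N"
  shows "l j \<le> l i"
  using assms(3,4)
proof (induction j rule: dec_induct)
  case (step k)
  then have "l (Suc k) \<le> l k" using assms(1,2) by (simp add: decreasing_upto_def)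
  then show ?case using step by simp
qed simp

lemma decreasing_upto_delta_strict:
  assumes "decreasing_upto N l" "1 \<le> i" "i < j" "j \<le> N"
  shows "l j + (N - j) < l i + (N - i)"
  using decreasing_upto_antimono[OF assms(1,2), of j] assms(3,4) by simp

text \<open>Both shifted weights are strictly decreasing, and only the identity permutes one into the other.\<close>
lemma alternant_partition:
  assumes l: "decreasing_upto N l" and m: "decreasing_upto N m"
  shows "alternant N l m = (if \<forall>i\<in>{1..N}. m i = l i then 1 else 0)"
proof -
  let ?c = "\<lambda>\<pi>. \<forall>i\<in>{1..N}. m i + (N - i) = l (\<pi> i) + (N - \<pi> i)"
  have eq_id: "\<pi> = id" if \<pi>: "\<pi> permutes {1..N}" "?c \<pi>" for \<pi>
  proof -
    have mono: "\<pi> i < \<pi> j" if ij: "1 \<le> i" "i < j" "j \<le> N" for i j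
    proof (rule ccontr)
      assume n: "\<not> \<pi> i < \<pi> j"
      have r: "\<pi> i \<in> {1..N}" "\<pi> j \<in> {1..N}" using permutes_in_image[OF \<pi>(1)] ij by auto
      have "\<pi> i \<noteq> \<pi> j" using permutes_inj[OF \<pi>(1)] ij by (auto dest: injD)
      then have "\<pi> j < \<pi> i" using n by simp
      from decreasing_upto_delta_strict[OF l _ this] have "l (\<pi> i) + (N - \<pi> i) < l (\<pi> j) + (N - \<pi> j)" using r by simp
      moreover have "m j + (N - j) < m i + (N - i)" by (rule decreasing_upto_delta_strict[OF m ij])
      ultimately show False using \<pi>(2) ij by simp
    qed
    have "i \<le> N \<longrightarrow> i \<le> \<pi> i" for i
    proof (induction i)
      case (Suc i)
      show ?case
      proof (cases "i = 0")
        case True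
        then show ?thesis using permutes_in_image[OF \<pi>(1), of 1] by auto
      next
        case False
        then show ?thesis using Suc mono[of i "Suc i"] by auto
      qed
    qed simp
    then show ?thesis by (intro permutes_natset_ge[OF \<pi>(1)]) simp
  qed
  have "(if ?c \<pi> then sign \<pi> else 0) = (if \<pi> = id then (if ?c id then 1 else 0) else 0)"
    if "\<pi> permutes {1..N}" for \<pi>
  proof (cases "\<pi> = id")
    case True
    then show ?thesis by (simp add: sign_id)
  next
    case False
    have "\<not> ?c \<pi>"
    proof
      assume "?c \<pi>"
      from eq_id[OF that this] False show False by (rule notE[rotated])
    qed
    then show ?thesis using False by (simp only: if_False)
  qed
  then have "alternant N l m = (\<Sum>\<pi> | \<pi> permutes {1..N}. if \<pi> = id then (if ?c id then 1 else 0) else 0)"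
    unfolding alternant_def by (intro sum.cong) auto
  also have "\<dots> = (if ?c id then 1 else 0)"
    by (subst sum.delta) (simp_all add: permutes_id finite_permutations)
  also have "?c id \<longleftrightarrow> (\<forall>i\<in>{1..N}. m i = l i)" unfolding id_apply by (simp only: add_right_cancel)
  finally show ?thesis .
qed

text \<open>Exchange the elements of \<open>S\<close> beyond \<open>j\<close> for the equally many elements up to \<open>j\<close> that are missing
from \<open>S\<close>: \<open>x j\<close> separates the two sets of values.\<close>
lemma initial_sum_maximal:
  fixes x :: "nat \<Rightarrow> int"
  assumes dec: "\<And>i j. 1 \<le> i \<Longrightarrow> i < j \<Longrightarrow> j \<le> N \<Longrightarrow> x j < x i"
    and S: "S \<subseteq> {1..N}" "card S = j" "S \<noteq> {1..j}"
  shows "sum x S < sum x {1..j}"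
proof -
  have fS: "finite S" using S(1) finite_subset by auto
  have jN: "j \<le> N" using card_mono[OF _ S(1)] S(2) by simp
  let ?A = "S - {1..j}" and ?B = "{1..j} - S"
  have cS: "card S = card {1..j}" using S(2) by simp
  have card: "card ?A = card ?B"
    using card_Diff_subset_Int[of S "{1..j}"] card_Diff_subset_Int[of "{1..j}" S] fS cS by (simp add: Int_commute)
  have "?A \<noteq> {}"
  proof
    assume "?A = {}"
    then have "S = {1..j}" using card_subset_eq[of "{1..j}" S] cS by auto
    then show False using S(3) by simp
  qed
  then have pos: "0 < card ?A" using fS by (simp add: card_gt_0_iff)
  have j1: "1 \<le> j"
  proof (rule ccontr)
    assume "\<not> 1 \<le> j"
    then have "?B = {}" by simp
    then show False using pos card by (metis card.empty less_irrefl)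
  qed
  have xA: "x i \<le> x j - 1" if "i \<in> ?A" for i
  proof -
    have "i \<in> {1..N}" "\<not> i \<le> j" using that S(1) j1 by auto
    then have "x i < x j" by (intro dec j1) simp_all
    then show ?thesis by simp
  qed
  have xB: "x j \<le> x i" if "i \<in> ?B" for i
  proof (cases "i = j")
    case False
    then have "1 \<le> i" "i < j" using that by simp_all
    then show ?thesis using dec[OF _ _ jN] by (simp add: less_imp_le)
  qed simp
  have "sum x ?A \<le> of_nat (card ?A) * (x j - 1)" by (rule sum_bounded_above[OF xA])
  also have "\<dots> < of_nat (card ?A) * x j" using pos by (simp add: algebra_simps)
  also have "\<dots> \<le> sum x ?B" unfolding card by (rule sum_bounded_below[OF xB])
  finally have "sum x ?A < sum x ?B" .
  moreover have "sum x S = sum x (S \<inter> {1..j}) + sum x ?A" by (rule sum.Int_Diff[OF fS])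
  moreover have "sum x {1..j} = sum x ({1..j} \<inter> S) + sum x ?B" by (rule sum.Int_Diff) simp
  ultimately show ?thesis by (simp add: Int_commute)
qed

lemma rearrangement_strict:
  fixes x :: "nat \<Rightarrow> int"
  assumes dec: "\<And>i j. 1 \<le> i \<Longrightarrow> i < j \<Longrightarrow> j \<le> N \<Longrightarrow> x j < x i"
    and \<pi>: "\<pi> permutes {1..N}" "\<pi> \<noteq> id"
  shows "(\<Sum>i\<in>{1..N}. x (\<pi> i) * int (N - i)) < (\<Sum>i\<in>{1..N}. x i * int (N - i))"
proof -
  \<comment> \<open>Summation by parts: \<open>N - i\<close> is the number of all \<open>j < N\<close> with \<open>i \<le> j\<close>.\<close>
  have layer: "(\<Sum>i\<in>{1..N}. z i * int (N - i)) = (\<Sum>j\<in>{1..<N}. \<Sum>i\<in>{1..j}. z i)" for z :: "nat \<Rightarrow> int"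
  proof -
    have "(\<Sum>i\<in>{1..N}. z i * int (N - i)) = (\<Sum>i\<in>{1..N}. \<Sum>j\<in>{1..<N}. if i \<le> j then z i else 0)"
    proof (rule sum.cong)
      fix i assume i: "i \<in> {1..N}"
      have "(\<Sum>j\<in>{1..<N}. if i \<le> j then z i else 0) = (\<Sum>j\<in>{1..<N} \<inter> {j. i \<le> j}. z i)"
        using sum.inter_restrict[of "{1..<N}" "\<lambda>_. z i" "{j. i \<le> j}"] by simp
      also have "{1..<N} \<inter> {j. i \<le> j} = {i..<N}" using i by auto
      finally show "z i * int (N - i) = (\<Sum>j\<in>{1..<N}. if i \<le> j then z i else 0)" by simp
    qed simp
    also have "\<dots> = (\<Sum>j\<in>{1..<N}. \<Sum>i\<in>{1..N}. if i \<le> j then z i else 0)" by (rule sum.swap)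
    also have "\<dots> = (\<Sum>j\<in>{1..<N}. \<Sum>i\<in>{1..j}. z i)"
    proof (rule sum.cong)
      fix j assume j: "j \<in> {1..<N}"
      have "{1..N} \<inter> {i. i \<le> j} = {1..j}" using j by auto
      then show "(\<Sum>i\<in>{1..N}. if i \<le> j then z i else 0) = (\<Sum>i\<in>{1..j}. z i)"
        using sum.inter_restrict[of "{1..N}" z "{i. i \<le> j}"] by simp
    qed simp
    finally show ?thesis .
  qed
  have inj: "inj_on \<pi> {1..j}" for j using permutes_inj[OF \<pi>(1)] inj_on_subset by blast
  have img: "(\<Sum>i\<in>{1..j}. x (\<pi> i)) = sum x (\<pi> ` {1..j})" for j
    by (rule sum.reindex[OF inj, unfolded comp_def, symmetric])
  have sub: "\<pi> ` {1..j} \<subseteq> {1..N}" if jN: "j < N" for j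
  proof
    fix k assume "k \<in> \<pi> ` {1..j}"
    then obtain i where "i \<in> {1..j}" "k = \<pi> i" by blast
    then have "i \<in> {1..N}" "k = \<pi> i" using jN by simp_all
    then show "k \<in> {1..N}" using permutes_in_image[OF \<pi>(1)] by simp
  qed
  have le: "(\<Sum>i\<in>{1..j}. x (\<pi> i)) \<le> (\<Sum>i\<in>{1..j}. x i)" if "j \<in> {1..<N}" for j
  proof (cases "\<pi> ` {1..j} = {1..j}")
    case True
    then show ?thesis by (simp only: img)
  next
    case False
    have "j < N" using that by simp
    have "card (\<pi> ` {1..j}) = j" using card_image[OF inj, of j] by simp
    from initial_sum_maximal[OF dec sub[OF \<open>j < N\<close>] this False]
    show ?thesis by (simp only: img less_imp_le)
  qed
  have "\<exists>j\<in>{1..<N}. \<pi> ` {1..j} \<noteq> {1..j}"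
  proof (rule ccontr)
    assume "\<not> ?thesis"
    then have st: "\<pi> ` {1..j} = {1..j}" if "1 \<le> j" "j < N" for j using that by auto
    have st': "\<pi> ` {1..j} = {1..j}" if "j \<le> N" for j
      using st[of j] that permutes_image[OF \<pi>(1)] by (cases "j = 0"; cases "j = N") auto
    have "\<pi> i = i" if "i \<in> {1..N}" for i
    proof -
      have "\<pi> i \<in> {1..i}" using st'[of i] that by auto
      moreover have "\<pi> i \<notin> {1..i - 1}"
      proof
        assume "\<pi> i \<in> {1..i - 1}"
        then have "\<pi> i \<in> \<pi> ` {1..i - 1}" using st'[of "i - 1"] that by auto
        then obtain k where k: "k \<in> {1..i - 1}" "\<pi> i = \<pi> k" by blast
        then have "i = k" using permutes_inj[OF \<pi>(1)] by (simp add: inj_eq)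
        then show False using k(1) unfolding atLeastAtMost_iff by linarith
      qed
      ultimately show ?thesis unfolding atLeastAtMost_iff by linarith
    qed
    then have "\<pi> k = id k" for k using permutes_not_in[OF \<pi>(1), of k] by (cases "k \<in> {1..N}") simp_all
    then have "\<pi> = id" by (rule ext)
    then show False using \<pi>(2) by simp
  qed
  then obtain j where j: "j \<in> {1..<N}" "\<pi> ` {1..j} \<noteq> {1..j}" by blast
  have "(\<Sum>i\<in>{1..j}. x (\<pi> i)) < (\<Sum>i\<in>{1..j}. x i)"
  proof -
    have "j < N" using j(1) by simp
    have "card (\<pi> ` {1..j}) = j" using card_image[OF inj, of j] by simp
    from initial_sum_maximal[OF dec sub[OF \<open>j < N\<close>] this j(2)] show ?thesis by (simp only: img)
  qed
  then have "(\<Sum>j\<in>{1..<N}. \<Sum>i\<in>{1..j}. x (\<pi> i)) < (\<Sum>j\<in>{1..<N}. \<Sum>i\<in>{1..j}. x i)"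
    using le j(1) by (intro sum_strict_mono_ex1) auto
  then show ?thesis by (simp only: layer[of x] layer[of "\<lambda>i. x (\<pi> i)"])
qed

text \<open>The triangularity behind the extraction of Schur coefficients, with the sum of squares in place of
the dominance order.\<close>
lemma alternant_nonzero_larger:
  assumes l: "decreasing_upto N l" and a: "alternant N l m \<noteq> 0" and ne: "\<exists>i\<in>{1..N}. m i \<noteq> l i"
  shows "(\<Sum>i\<in>{1..N}. l i * l i) < (\<Sum>i\<in>{1..N}. m i * m i)"
proof -
  let ?c = "\<lambda>\<pi>. \<forall>i\<in>{1..N}. m i + (N - i) = l (\<pi> i) + (N - \<pi> i)"
  have "\<exists>\<pi>. \<pi> permutes {1..N} \<and> ?c \<pi>"
  proof (rule ccontr)
    assume none: "\<not> ?thesis"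
    have "alternant N l m = 0"
      unfolding alternant_def
    proof (rule sum.neutral, rule ballI)
      fix \<pi> assume "\<pi> \<in> {\<pi>. \<pi> permutes {1..N}}"
      then have "\<not> ?c \<pi>" using none by blast
      then show "(if ?c \<pi> then sign \<pi> else 0) = 0" by (rule if_not_P)
    qed
    then show False using a by simp
  qed
  then obtain \<pi> where "\<pi> permutes {1..N} \<and> ?c \<pi>" ..
  note both = this
  have \<pi>: "\<pi> permutes {1..N}" by (rule conjunct1[OF both])
  have c: "?c \<pi>" by (rule conjunct2[OF both])
  have "\<pi> \<noteq> id"
  proof
    assume "\<pi> = id"
    have "\<forall>i\<in>{1..N}. m i + (N - i) = l i + (N - i)" using c unfolding \<open>\<pi> = id\<close> id_apply .
    then have "\<forall>i\<in>{1..N}. m i = l i" unfolding add_right_cancel .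
    then show False using ne by blast
  qed
  \<comment> \<open>With \<open>x = l + \<delta>\<close> the weight \<open>m\<close> is a rearrangement of \<open>x\<close> minus \<open>\<delta>\<close>, so that the two
      sums of squares differ only in the products with \<open>\<delta>\<close>.\<close>
  define x where "x i = int (l i) + int (N - i)" for i
  have dec: "x j < x i" if "1 \<le> i" "i < j" "j \<le> N" for i j
    using decreasing_upto_delta_strict[OF l that] by (simp add: x_def)
  have square: "(u - c) * (u - c) = u * u - 2 * (u * c) + c * c" for u c :: int
    by (simp add: algebra_simps)
  have lx: "int (l i * l i) = x i * x i - 2 * (x i * int (N - i)) + int (N - i) * int (N - i)" for i
  proof -
    have "int (l i) = x i - int (N - i)" unfolding x_def by linarith
    then show ?thesis by (simp only: of_nat_mult square)
  qed
  have mx: "int (m i * m i) = x (\<pi> i) * x (\<pi> i) - 2 * (x (\<pi> i) * int (N - i)) + int (N - i) * int (N - i)"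
    if i: "i \<in> {1..N}" for i
  proof -
    have "int (m i + (N - i)) = x (\<pi> i)"
      unfolding x_def of_nat_add[symmetric] by (rule arg_cong[OF c[rule_format, OF i]])
    then have "int (m i) = x (\<pi> i) - int (N - i)" unfolding of_nat_add by linarith
    then show ?thesis by (simp only: of_nat_mult square)
  qed
  have perm: "(\<Sum>i\<in>{1..N}. x (\<pi> i) * x (\<pi> i)) = (\<Sum>i\<in>{1..N}. x i * x i)"
    by (rule sum.permute[OF \<pi>, of "\<lambda>i. x i * x i", unfolded comp_def, symmetric])
  have "int (\<Sum>i\<in>{1..N}. m i * m i) = (\<Sum>i\<in>{1..N}. x (\<pi> i) * x (\<pi> i)) - 2 * (\<Sum>i\<in>{1..N}. x (\<pi> i) * int (N - i)) + (\<Sum>i\<in>{1..N}. int (N - i) * int (N - i))"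
    unfolding of_nat_sum sum_distrib_left sum_subtractf[symmetric] sum.distrib[symmetric] by (rule sum.cong) (simp_all only: mx)
  moreover have "int (\<Sum>i\<in>{1..N}. l i * l i) = (\<Sum>i\<in>{1..N}. x i * x i) - 2 * (\<Sum>i\<in>{1..N}. x i * int (N - i)) + (\<Sum>i\<in>{1..N}. int (N - i) * int (N - i))"
    unfolding of_nat_sum sum_distrib_left sum_subtractf[symmetric] sum.distrib[symmetric] by (rule sum.cong) (simp_all only: lx)
  moreover have "(\<Sum>i\<in>{1..N}. x (\<pi> i) * int (N - i)) < (\<Sum>i\<in>{1..N}. x i * int (N - i))"
    by (rule rearrangement_strict[OF dec \<pi> \<open>\<pi> \<noteq> id\<close>])
  ultimately have "int (\<Sum>i\<in>{1..N}. l i * l i) < int (\<Sum>i\<in>{1..N}. m i * m i)" using perm by linarith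
  then show ?thesis by (simp only: of_nat_less_iff)
qed

lemma finite_max_nat:
  fixes f :: "'b \<Rightarrow> nat"
  assumes "finite B" "b \<in> B"
  shows "\<exists>l\<in>B. \<forall>m\<in>B. f m \<le> f l"
proof -
  have fin: "finite (f ` B)" using assms(1) by (rule finite_imageI)
  have "Max (f ` B) \<in> f ` B" by (rule Max_in[OF fin]) (use assms(2) in blast)
  then obtain l where l: "Max (f ` B) = f l" "l \<in> B" by (rule imageE)
  have "f m \<le> f l" if "m \<in> B" for m
    unfolding l(1)[symmetric] by (rule Max_ge[OF fin imageI[OF that]])
  then show ?thesis using l(2) by blast
qed

text \<open>A symmetric function whose product with the Vandermonde alternant vanishes is zero. At a partition
\<open>l\<close> with nonzero value and largest sum of squares, the alternating sum has no other nonzero term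
than the one for \<open>l\<close> itself.\<close>
lemma symmetric_vanishing:
  fixes D :: "(nat \<Rightarrow> nat) \<Rightarrow> int"
  assumes sym: "\<And>r m m'. \<lbrakk>1 \<le> r; Suc r \<le> N; m' r = m (Suc r); m' (Suc r) = m r;
        \<And>s. s \<noteq> r \<Longrightarrow> s \<noteq> Suc r \<Longrightarrow> m' s = m s\<rbrakk> \<Longrightarrow> D m = D m'"
    and zero: "\<And>l. l \<in> weights N n \<Longrightarrow> decreasing_upto N l \<Longrightarrow> (\<Sum>m\<in>weights N n. alternant N l m * D m) = 0"
    and m: "m \<in> weights N n"
  shows "D m = 0"
proof (rule ccontr)
  assume nz: "D m \<noteq> 0"
  \<comment> \<open>Among the weights with nonzero value, take the largest sum of squares and then the entries as far
      to the left as possible. Permuting entries does not change the sum of squares, so the second choice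
      makes the weight decreasing.\<close>
  let ?sq = "\<lambda>m. \<Sum>i\<in>{1..N}. m i * m i" and ?w = "\<lambda>m. \<Sum>i\<in>{1..N}. m i * (N - i)"
  let ?B = "{m \<in> weights N n. D m \<noteq> 0}"
  have fB: "finite ?B" using finite_weights by simp
  obtain k where k: "k \<in> ?B" "\<forall>m\<in>?B. ?sq m \<le> ?sq k"
    using finite_max_nat[OF fB, of m ?sq] m nz by auto
  let ?B' = "{m \<in> ?B. ?sq m = ?sq k}"
  have "finite ?B'" by (rule finite_subset[OF _ fB]) blast
  then obtain l where l: "l \<in> ?B'" "\<forall>m\<in>?B'. ?w m \<le> ?w l"
    using finite_max_nat[of ?B' k ?w] k(1) by auto
  have lW: "l \<in> weights N n" "D l \<noteq> 0" "?sq l = ?sq k" using l(1) by auto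
  have dl: "decreasing_upto N l"
    unfolding decreasing_upto_def
  proof (intro allI impI, rule ccontr)
    fix r assume r: "1 \<le> r" "Suc r \<le> N" and n: "\<not> l (Suc r) \<le> l r"
    define l' where "l' = l(r := l (Suc r), Suc r := l r)"
    have l': "l' r = l (Suc r)" "l' (Suc r) = l r" "\<And>s. s \<noteq> r \<Longrightarrow> s \<noteq> Suc r \<Longrightarrow> l' s = l s"
      by (auto simp: l'_def)
    have split: "(\<Sum>i\<in>{1..N}. f i) = f r + (f (Suc r) + (\<Sum>i\<in>{1..N} - {r} - {Suc r}. f i))" for f :: "nat \<Rightarrow> nat"
      using r sum.remove[of "{1..N}" r f] sum.remove[of "{1..N} - {r}" "Suc r" f] by simp
    have same: "(\<Sum>i\<in>{1..N} - {r} - {Suc r}. f (l' i) i) = (\<Sum>i\<in>{1..N} - {r} - {Suc r}. f (l i) i)" for f :: "nat \<Rightarrow> nat \<Rightarrow> nat"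
      by (rule sum.cong) (auto simp: l')
    have "(\<Sum>i\<in>{1..N}. l' i) = (\<Sum>i\<in>{1..N}. l i)"
      unfolding split[of l'] split[of l] using same[of "\<lambda>a i. a"] l' by simp
    moreover have "l' i = 0" if "i \<notin> {1..N}" for i
      using that r l'(3)[of i] lW(1) by (cases "i = r \<or> i = Suc r") (auto simp: weights_def)
    ultimately have "l' \<in> weights N n" using lW(1) by (simp add: weights_def)
    moreover have "D l' \<noteq> 0" using sym[of r l' l, OF r l'] lW(2) by simp
    moreover have "?sq l' = ?sq l"
      unfolding split[of "\<lambda>i. l' i * l' i"] split[of "\<lambda>i. l i * l i"] using same[of "\<lambda>a i. a * a"] l' by simp
    ultimately have "?w l' \<le> ?w l" using l(2) lW(3) by simp
    moreover have "?w l < ?w l'"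
    proof -
      obtain d where d: "l (Suc r) = l r + Suc d" using n by (metis add_Suc_right less_iff_Suc_add not_le)
      have "N - r = Suc (N - Suc r)" using r by simp
      moreover have "a * Suc k + (a + Suc d) * k < (a + Suc d) * Suc k + a * k" for a k :: nat
        by (simp add: algebra_simps)
      ultimately have "l r * (N - r) + l (Suc r) * (N - Suc r) < l' r * (N - r) + l' (Suc r) * (N - Suc r)"
        by (simp only: l'(1,2) d)
      then show ?thesis
        unfolding split[of "\<lambda>i. l' i * (N - i)"] split[of "\<lambda>i. l i * (N - i)"]
        using same[of "\<lambda>a i. a * (N - i)"] by simp
    qed
    ultimately show False by simp
  qed
  have "(\<Sum>m\<in>weights N n. alternant N l m * D m) = (\<Sum>m\<in>weights N n. if m = l then D l else 0)"
  proof (rule sum.cong)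
    fix m assume m: "m \<in> weights N n"
    show "alternant N l m * D m = (if m = l then D l else 0)"
    proof (cases "m = l")
      case True
      then show ?thesis using alternant_partition[OF dl dl] by simp
    next
      case False
      then have ne: "\<exists>i\<in>{1..N}. m i \<noteq> l i" using weights_eq_iff[OF m lW(1)] by blast
      have "alternant N l m = 0 \<or> D m = 0"
      proof (rule ccontr)
        assume "\<not> ?thesis"
        then have a: "alternant N l m \<noteq> 0" and B: "m \<in> ?B" using m by simp_all
        show False using alternant_nonzero_larger[OF dl a ne] bspec[OF k(2) B] lW(3) by linarith
      qed
      then show ?thesis using False by (elim disjE) simp_all
    qed
  qed simp
  also have "\<dots> = D l" using lW(1) by (simp add: sum.delta[OF finite_weights])
  finally have "D l = 0" using zero[OF lW(1) dl] by simp
  then show False using lW(2) by simp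
qed

context three_one_free
begin

definition weight_count :: "('a \<Rightarrow> nat) set \<Rightarrow> (nat \<Rightarrow> nat) \<Rightarrow> nat" where
  "weight_count Y m = card {\<kappa>\<in>Y. content \<kappa> = m}"

lemma content_weights:
  assumes "\<kappa> \<in> P \<rightarrow>\<^sub>E {1..}"
  shows "content \<kappa> \<in> weights N (card P) \<longleftrightarrow> \<kappa> ` P \<subseteq> {..N}"
proof
  assume w: "content \<kappa> \<in> weights N (card P)"
  show "\<kappa> ` P \<subseteq> {..N}"
  proof
    fix k assume "k \<in> \<kappa> ` P"
    then have "color_class \<kappa> k \<noteq> {}" by (auto simp: color_class_def)
    then have "content \<kappa> k \<noteq> 0" by (simp add: content_def)
    then show "k \<in> {..N}" using w by (auto simp: weights_def)
  qed
next
  assume b: "\<kappa> ` P \<subseteq> {..N}"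
  have rng: "\<kappa> ` P \<subseteq> {1..N}" using b assms by (auto simp: PiE_iff)
  have "content \<kappa> i = 0" if "i \<notin> {1..N}" for i
    using rng that by (auto simp: content_def color_class_def card_eq_0_iff)
  moreover have "(\<Sum>i\<in>{1..N}. content \<kappa> i) = card P"
  proof -
    have "(\<Sum>i\<in>{1..N}. \<Sum>x\<in>{x\<in>P. \<kappa> x = i}. 1) = (\<Sum>x\<in>P. 1::nat)"
      by (rule sum.group[OF fin _ rng]) simp
    then show ?thesis by (simp add: content_def color_class_def)
  qed
  ultimately show "content \<kappa> \<in> weights N (card P)" by (simp add: weights_def)
qed

lemma alternating_count:
  assumes Y: "\<And>\<kappa>. \<kappa> \<in> Y \<Longrightarrow> \<kappa> \<in> P \<rightarrow>\<^sub>E {1..}" "\<And>\<kappa>. \<kappa> \<in> Y \<Longrightarrow> chain_coloring \<kappa>"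
    and closed: "\<And>r. 1 \<le> r \<Longrightarrow> closed_at r Y"
    and l: "l \<in> weights N (card P)" "decreasing_upto N l"
  shows "(\<Sum>m\<in>weights N (card P). alternant N l m * int (weight_count Y m)) = int (card {\<kappa>\<in>Y. tableau \<kappa> \<and> content \<kappa> = l})"
proof -
  let ?Y = "{\<kappa>\<in>Y. \<kappa> ` P \<subseteq> {..N}}" and ?T = "{\<kappa>\<in>Y. \<kappa> ` P \<subseteq> {..N} \<and> tableau \<kappa>}"
  have "?Y \<subseteq> P \<rightarrow>\<^sub>E {..N}"
  proof
    fix \<kappa> assume "\<kappa> \<in> ?Y"
    then have "\<kappa> \<in> P \<rightarrow>\<^sub>E {1..}" "\<kappa> ` P \<subseteq> {..N}" using Y(1) by auto
    then show "\<kappa> \<in> P \<rightarrow>\<^sub>E {..N}" by (auto simp: PiE_iff)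
  qed
  then have fY: "finite ?Y" using finite_PiE[OF fin, of "\<lambda>_. {..N}"] finite_subset by auto
  have "(\<Sum>m\<in>weights N (card P). alternant N l m * int (weight_count Y m)) =
      (\<Sum>m\<in>weights N (card P). \<Sum>\<kappa>\<in>{\<kappa>\<in>?Y. content \<kappa> = m}. alternant N l (content \<kappa>))"
  proof (rule sum.cong)
    fix m assume m: "m \<in> weights N (card P)"
    have "{\<kappa>\<in>Y. content \<kappa> = m} = {\<kappa>\<in>?Y. content \<kappa> = m}" using m content_weights[OF Y(1)] by blast
    then have "weight_count Y m = card {\<kappa>\<in>?Y. content \<kappa> = m}" by (simp add: weight_count_def)
    moreover have "(\<Sum>\<kappa>\<in>{\<kappa>\<in>?Y. content \<kappa> = m}. alternant N l (content \<kappa>)) = (\<Sum>\<kappa>\<in>{\<kappa>\<in>?Y. content \<kappa> = m}. alternant N l m)"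
      by (rule sum.cong) auto
    ultimately show "alternant N l m * int (weight_count Y m) = (\<Sum>\<kappa>\<in>{\<kappa>\<in>?Y. content \<kappa> = m}. alternant N l (content \<kappa>))" by simp
  qed simp
  also have "\<dots> = (\<Sum>\<kappa>\<in>?Y. alternant N l (content \<kappa>))"
    by (rule sum.group[OF fY finite_weights]) (use content_weights[OF Y(1)] in blast)
  also have "\<dots> = (\<Sum>\<kappa>\<in>?T. alternant N l (content \<kappa>))"
    by (rule signed_sum_tableaux[OF Y closed alternant_dot])
  also have "\<dots> = (\<Sum>\<kappa>\<in>?T. if content \<kappa> = l then 1 else 0)"
  proof (rule sum.cong)
    fix \<kappa> assume \<kappa>: "\<kappa> \<in> ?T"
    have W: "content \<kappa> \<in> weights N (card P)" using \<kappa> content_weights[OF Y(1)] by blast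
    have "decreasing_upto N (content \<kappa>)" using \<kappa> tableau_content_decreasing[OF Y(2)] by (simp add: decreasing_upto_def)
    moreover have "(\<forall>i\<in>{1..N}. content \<kappa> i = l i) \<longleftrightarrow> content \<kappa> = l"
      by (rule weights_eq_iff[OF W l(1)])
    ultimately show "alternant N l (content \<kappa>) = (if content \<kappa> = l then 1 else 0)" using alternant_partition[OF l(2)] by simp
  qed simp
  also have "\<dots> = int (card {\<kappa>\<in>?T. content \<kappa> = l})"
  proof -
    have "finite ?T" by (rule finite_subset[OF _ fY]) blast
    then show ?thesis by (simp add: sum.If_cases Int_def)
  qed
  also have "{\<kappa>\<in>?T. content \<kappa> = l} = {\<kappa>\<in>Y. tableau \<kappa> \<and> content \<kappa> = l}" using l(1) content_weights[OF Y(1)] by blast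
  finally show ?thesis .
qed

end

section \<open>Arrays as chain colorings\<close>

lemma three_plus_one_free_locale:
  fixes P :: "'a::order set"
  assumes "finite P" "three_plus_one_free P"
  shows "three_one_free P (<)"
proof
  show "finite P" by (rule assms(1))
  show "\<not> x < x" for x :: 'a by simp
  show "x < z" if "x < y" "y < z" for x y z :: 'a using that by (rule less_trans)
  fix x y z w assume P: "x \<in> P" "y \<in> P" "z \<in> P" "w \<in> P" and lt: "x < y" "y < z"
  show "x < w \<or> w < z"
  proof (rule ccontr)
    assume n: "\<not> (x < w \<or> w < z)"
    have "x < z" using lt by (rule less_trans)
    have y: "\<not> w \<le> y" "\<not> y \<le> w" using n le_less_trans[OF _ lt(2), of w] less_le_trans[OF lt(1), of w] by blast+
    have x: "\<not> w \<le> x" "\<not> x \<le> w" using n le_less_trans[OF _ \<open>x < z\<close>, of w] \<open>x < z\<close> le_less[of x w] by blast+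
    have z: "\<not> w \<le> z" "\<not> z \<le> w" using n less_le_trans[OF \<open>x < z\<close>, of w] \<open>x < z\<close> le_less[of w z] by blast+
    have "\<forall>v\<in>{x, y, z}. \<not> w \<le> v \<and> \<not> v \<le> w" using x y z by simp
    then show False using assms(2) P lt unfolding three_plus_one_free_def by blast
  qed
qed

locale free_order =
  fixes P :: "'a::order set"
  assumes finite_P: "finite P" and free_P: "three_plus_one_free P"

sublocale free_order \<subseteq> three_one_free P "(<)"
  using three_plus_one_free_locale finite_P free_P .

context free_order
begin

definition coloring :: "'a filling \<Rightarrow> 'a \<Rightarrow> nat" where
  "coloring A x = (if x \<in> P then THE i. \<exists>j. A (i, j) = Some x else undefined)"

text \<open>Inverse to \<open>coloring\<close>: the position of an element in its row is its rank.\<close>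
definition array_of :: "('a \<Rightarrow> nat) \<Rightarrow> 'a filling" where
  "array_of \<kappa> = (\<lambda>(i, j). if \<exists>x. x \<in> color_class \<kappa> i \<and> rk (color_class \<kappa> i) x = j
     then Some (THE x. x \<in> color_class \<kappa> i \<and> rk (color_class \<kappa> i) x = j) else None)"

lemma array_injective:
  assumes "A \<in> P_arrays P" "A p = Some x" "A q = Some x"
  shows "p = q"
proof -
  have "inj_on A (dom A)" using assms(1) by (simp add: P_arrays_def)
  then show ?thesis by (rule inj_onD) (simp_all add: assms(2,3) domI)
qed

lemma array_positive:
  assumes "A \<in> P_arrays P" "A (i, j) = Some x"
  shows "1 \<le> i" "1 \<le> j" "x \<in> P"
proof -
  have "dom A \<subseteq> {1..} \<times> {1..}" "ran A = P" using assms(1) by (simp_all add: P_arrays_def)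
  moreover have "(i, j) \<in> dom A" "x \<in> ran A" using assms(2) by (auto simp: ran_def)
  ultimately show "1 \<le> i" "1 \<le> j" "x \<in> P" by auto
qed

lemma array_occurs:
  assumes "A \<in> P_arrays P" "x \<in> P"
  shows "\<exists>i j. A (i, j) = Some x"
proof -
  have "x \<in> ran A" using assms by (simp add: P_arrays_def)
  then show ?thesis by (auto simp: ran_def)
qed

lemma coloring_eq:
  assumes "A \<in> P_arrays P" "A (i, j) = Some x"
  shows "coloring A x = i"
proof -
  have "(THE i. \<exists>j. A (i, j) = Some x) = i"
  proof (rule the_equality)
    show "\<exists>j. A (i, j) = Some x" using assms(2) by blast
    fix i' assume "\<exists>j. A (i', j) = Some x"
    then obtain j' where "A (i', j') = Some x" ..
    then show "i' = i" using array_injective[OF assms] by blast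
  qed
  then show ?thesis using array_positive(3)[OF assms] by (simp add: coloring_def)
qed

lemma row_eq_color_class:
  assumes A: "A \<in> P_arrays P"
  shows "row A i = color_class (coloring A) i"
proof (rule set_eqI)
  fix x
  show "x \<in> row A i \<longleftrightarrow> x \<in> color_class (coloring A) i"
  proof
    assume "x \<in> row A i"
    then obtain j where "A (i, j) = Some x" by (auto simp: row_def)
    then show "x \<in> color_class (coloring A) i"
      using coloring_eq[OF A] array_positive(3)[OF A] by (auto simp: color_class_def)
  next
    assume x: "x \<in> color_class (coloring A) i"
    then have "x \<in> P" by (simp add: color_class_def)
    from array_occurs[OF A this] obtain i' j where ij: "A (i', j) = Some x" by blast
    then have "i' = i" using coloring_eq[OF A ij] x by (simp add: color_class_def)
    then show "x \<in> row A i" using ij by (auto simp: row_def)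
  qed
qed

lemma array_prefix:
  assumes A: "A \<in> P_arrays P" and y: "A (i, j) = Some y" and k: "1 \<le> k" "k < j"
  shows "\<exists>x. A (i, k) = Some x \<and> x < y"
proof -
  have step: "\<exists>x. A (i, j - 1) = Some x \<and> x < y" if "A (i, j) = Some y" "1 < j" for j y
  proof -
    have "(i, j) \<in> dom A \<and> j > 1 \<longrightarrow> (i, j - 1) \<in> dom A \<and> the (A (i, j - 1)) < the (A (i, j))"
      using A unfolding P_arrays_def by blast
    then have "(i, j - 1) \<in> dom A" "the (A (i, j - 1)) < y" using that by auto
    then show ?thesis by auto
  qed
  show ?thesis using k(2) y
  proof (induction j arbitrary: y)
    case (Suc j)
    obtain x where x: "A (i, j) = Some x" "x < y" using step[OF Suc.prems(2)] Suc.prems(1) k(1) by auto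
    show ?case
    proof (cases "k = j")
      case True
      then show ?thesis using x by blast
    next
      case False
      then obtain z where "A (i, k) = Some z" "z < x" using Suc.IH[OF _ x(1)] Suc.prems(1) by auto
      then show ?thesis using x(2) less_trans by blast
    qed
  qed simp
qed

lemma chain_coloring_array:
  assumes A: "A \<in> P_arrays P"
  shows "chain_coloring (coloring A)"
proof -
  have "x = y \<or> x < y \<or> y < x" if xy: "x \<in> row A i" "y \<in> row A i" for x y i
  proof -
    obtain j k where jk: "A (i, j) = Some x" "A (i, k) = Some y" using xy unfolding row_def by blast
    note p = array_positive(2)[OF A jk(1)] array_positive(2)[OF A jk(2)]
    consider "j < k" | "j = k" | "k < j" by linarith
    then show ?thesis
    proof cases
      case 1
      then show ?thesis using array_prefix[OF A jk(2) p(1)] jk(1) by auto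
    next
      case 2
      then show ?thesis using jk by simp
    next
      case 3
      then show ?thesis using array_prefix[OF A jk(1) p(2)] jk(2) by auto
    qed
  qed
  then have "\<forall>x\<in>color_class (coloring A) i. \<forall>y\<in>color_class (coloring A) i. x = y \<or> x < y \<or> y < x" for i
    unfolding row_eq_color_class[OF A] by blast
  moreover have "color_class (coloring A) i \<subseteq> P" for i by (auto simp: color_class_def)
  ultimately show ?thesis by (simp add: chain_coloring_def is_chain_def)
qed

lemma coloring_PiE:
  assumes A: "A \<in> P_arrays P"
  shows "coloring A \<in> P \<rightarrow>\<^sub>E {1..}"
proof (rule PiE_I)
  fix x assume "x \<in> P"
  then obtain i j where ij: "A (i, j) = Some x" using array_occurs[OF A] by blast
  then show "coloring A x \<in> {1..}" using coloring_eq[OF A ij] array_positive(1)[OF A ij] by simp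
qed (simp add: coloring_def)

lemma array_rank:
  assumes A: "A \<in> P_arrays P"
  shows "A (i, j) = Some x \<longleftrightarrow> x \<in> row A i \<and> rk (row A i) x = j"
proof -
  have rank: "rk (row A i) x = j" if j: "A (i, j) = Some x" for i j x
  proof -
    let ?g = "\<lambda>k. the (A (i, k))"
    have def: "\<exists>y. A (i, k) = Some y \<and> (y < x \<or> y = x)" if k: "k \<in> {1..j}" for k
    proof (cases "k = j")
      case True
      then show ?thesis using j by blast
    next
      case False
      then have "1 \<le> k" "k < j" using k by simp_all
      then show ?thesis using array_prefix[OF A j, of k] by blast
    qed
    have "{y \<in> row A i. y < x \<or> y = x} = ?g ` {1..j}"
    proof (rule set_eqI, rule iffI)
      fix y assume "y \<in> {y \<in> row A i. y < x \<or> y = x}"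
      then obtain k where k: "A (i, k) = Some y" and yx: "y < x \<or> y = x" unfolding row_def by blast
      have "\<not> j < k"
      proof
        assume "j < k"
        then obtain x' where "A (i, j) = Some x'" "x' < y"
          using array_prefix[OF A k array_positive(2)[OF A j]] by blast
        then have "x < y" using j by simp
        then show False using yx by (simp add: less_not_sym)
      qed
      then have "k \<in> {1..j}" "y = ?g k" using array_positive(2)[OF A k] k by simp_all
      then show "y \<in> ?g ` {1..j}" by (rule rev_image_eqI)
    next
      fix y assume "y \<in> ?g ` {1..j}"
      then obtain k where k: "k \<in> {1..j}" "y = ?g k" by blast
      obtain y' where y': "A (i, k) = Some y'" "y' < x \<or> y' = x" using def[OF k(1)] by blast
      then have "y' \<in> row A i" unfolding row_def by blast
      moreover have "y = y'" using k(2) y'(1) by simp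
      ultimately show "y \<in> {y \<in> row A i. y < x \<or> y = x}" using y'(2) by simp
    qed
    moreover have "inj_on ?g {1..j}"
    proof (rule inj_onI)
      fix k l assume kl: "k \<in> {1..j}" "l \<in> {1..j}" "?g k = ?g l"
      obtain y where y: "A (i, k) = Some y" using def[OF kl(1)] by blast
      obtain z where z: "A (i, l) = Some z" using def[OF kl(2)] by blast
      have "y = z" using kl(3) y z by simp
      then show "k = l" using array_injective[OF A y, of "(i, l)"] z by simp
    qed
    ultimately show ?thesis unfolding rk_def by (simp add: card_image)
  qed
  show ?thesis
  proof
    assume "A (i, j) = Some x"
    then show "x \<in> row A i \<and> rk (row A i) x = j" using rank unfolding row_def by blast
  next
    assume x: "x \<in> row A i \<and> rk (row A i) x = j"
    then obtain k where k: "A (i, k) = Some x" unfolding row_def by blast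
    then show "A (i, j) = Some x" using rank[OF k] x by simp
  qed
qed

lemma array_eqI:
  assumes "A \<in> P_arrays P" "B \<in> P_arrays P" "\<And>i. row A i = row B i"
  shows "A = B"
proof (rule ext)
  fix p :: "nat \<times> nat"
  obtain i j where p: "p = (i, j)" by (cases p)
  have eq: "A (i, j) = Some x \<longleftrightarrow> B (i, j) = Some x" for x
    unfolding array_rank[OF assms(1)] array_rank[OF assms(2)] assms(3) ..
  show "A p = B p"
  proof (cases "A (i, j)")
    case None
    then have "B (i, j) \<noteq> Some x" for x using eq[of x] by simp
    then have "B (i, j) = None" by (metis not_Some_eq)
    then show ?thesis unfolding p None by (rule sym)
  next
    case (Some x)
    then have "B (i, j) = Some x" using eq[of x] by blast
    then show ?thesis unfolding p Some by (rule sym)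
  qed
qed

lemma array_of_rank:
  assumes "chain_coloring \<kappa>"
  shows "array_of \<kappa> (i, j) = Some x \<longleftrightarrow> x \<in> color_class \<kappa> i \<and> rk (color_class \<kappa> i) x = j"
proof -
  define Q where "Q x \<longleftrightarrow> x \<in> color_class \<kappa> i \<and> rk (color_class \<kappa> i) x = j" for x
  have uniq: "y = x" if "Q x" "Q y" for x y
    using that rk_eq_iff[OF chain_color_class[OF assms], of y i x] unfolding Q_def by simp
  have the: "(THE x. Q x) = x" if "Q x" for x
    by (rule the_equality[of Q x, OF that]) (rule uniq[OF that])
  have def: "array_of \<kappa> (i, j) = (if \<exists>x. Q x then Some (THE x. Q x) else None)"
    unfolding array_of_def prod.case Q_def ..
  have "array_of \<kappa> (i, j) = Some x \<longleftrightarrow> Q x"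
  proof (cases "\<exists>y. Q y")
    case True
    then obtain y where y: "Q y" ..
    have Some: "array_of \<kappa> (i, j) = Some y" unfolding def if_P[OF True] the[OF y] ..
    have "x = y \<longleftrightarrow> Q x" using y uniq[OF y, of x] by blast
    then show ?thesis unfolding Some option.inject by (simp only: eq_commute[of y x])
  next
    case False
    then show ?thesis unfolding def if_not_P[OF False] by simp
  qed
  then show ?thesis unfolding Q_def .
qed

lemma row_array_of:
  assumes "chain_coloring \<kappa>"
  shows "row (array_of \<kappa>) i = color_class \<kappa> i"
  unfolding row_def array_of_rank[OF assms] by blast

lemma array_of_P_arrays:
  assumes \<kappa>: "chain_coloring \<kappa>" "\<kappa> \<in> P \<rightarrow>\<^sub>E {1..}"
  shows "array_of \<kappa> \<in> P_arrays P"
proof -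
  let ?A = "array_of \<kappa>"
  note rank = array_of_rank[OF \<kappa>(1)] and ch = chain_color_class[OF \<kappa>(1)]
  have dom: "(i, j) \<in> dom ?A \<longleftrightarrow> (\<exists>x. x \<in> color_class \<kappa> i \<and> rk (color_class \<kappa> i) x = j)" for i j
    unfolding dom_def mem_Collect_eq not_None_eq rank ..
  have "dom ?A \<subseteq> {1..} \<times> {1..}"
  proof
    fix p assume p: "p \<in> dom ?A"
    obtain i j where ij: "p = (i, j)" by (cases p)
    obtain x where x: "x \<in> color_class \<kappa> i" "rk (color_class \<kappa> i) x = j" using p unfolding ij dom by blast
    have "x \<in> P" "\<kappa> x = i" using x(1) by (simp_all add: color_class_def)
    then have "1 \<le> i" using \<kappa>(2) by auto
    then show "p \<in> {1..} \<times> {1..}" using rk_bounds[OF ch x(1)] x(2) by (simp add: ij)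
  qed
  moreover have "ran ?A = P"
  proof (rule set_eqI)
    fix x
    have "x \<in> ran ?A \<longleftrightarrow> (\<exists>i j. ?A (i, j) = Some x)" by (auto simp: ran_def)
    also have "\<dots> \<longleftrightarrow> x \<in> P" unfolding rank by (auto simp: color_class_def)
    finally show "x \<in> ran ?A \<longleftrightarrow> x \<in> P" .
  qed
  moreover have "inj_on ?A (dom ?A)"
  proof (rule inj_onI)
    fix p q assume pq: "p \<in> dom ?A" "q \<in> dom ?A" "?A p = ?A q"
    obtain i j k l where ij: "p = (i, j)" "q = (k, l)" by (cases p; cases q)
    obtain x where x: "?A p = Some x" using pq(1) by auto
    then have "?A q = Some x" using pq(3) by simp
    then show "p = q" using x unfolding ij rank by (simp add: color_class_def)
  qed
  moreover have "(i, j - 1) \<in> dom ?A \<and> the (?A (i, j - 1)) < the (?A (i, j))" if ij: "(i, j) \<in> dom ?A" "1 < j" for i j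
  proof -
    obtain x where x: "x \<in> color_class \<kappa> i" "rk (color_class \<kappa> i) x = j" using ij(1) unfolding dom by blast
    have "1 \<le> j - 1" "j - 1 \<le> card (color_class \<kappa> i)" using rk_bounds[OF ch x(1)] x(2) ij(2) by auto
    then obtain y where y: "y \<in> color_class \<kappa> i" "rk (color_class \<kappa> i) y = j - 1" by (rule rk_obtain[OF ch])
    have "y < x" using rk_less_iff[OF ch y(1) x(1)] x(2) y(2) ij(2) by simp
    moreover have "?A (i, j) = Some x" "?A (i, j - 1) = Some y" using x y unfolding rank by simp_all
    ultimately show ?thesis by auto
  qed
  ultimately show ?thesis unfolding P_arrays_def by blast
qed

lemma array_of_coloring:
  assumes A: "A \<in> P_arrays P"
  shows "array_of (coloring A) = A"
proof (rule array_eqI)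
  note c = chain_coloring_array[OF A]
  show "array_of (coloring A) \<in> P_arrays P" by (rule array_of_P_arrays[OF c coloring_PiE[OF A]])
  show "row (array_of (coloring A)) i = row A i" for i
    by (simp add: row_array_of[OF c] row_eq_color_class[OF A])
qed (rule A)

lemma coloring_array_of:
  assumes \<kappa>: "chain_coloring \<kappa>" "\<kappa> \<in> P \<rightarrow>\<^sub>E {1..}"
  shows "coloring (array_of \<kappa>) = \<kappa>"
proof (rule ext)
  fix x
  show "coloring (array_of \<kappa>) x = \<kappa> x"
  proof (cases "x \<in> P")
    case True
    then have "array_of \<kappa> (\<kappa> x, rk (color_class \<kappa> (\<kappa> x)) x) = Some x"
      unfolding array_of_rank[OF \<kappa>(1)] by (simp add: color_class_def)
    then show ?thesis by (rule coloring_eq[OF array_of_P_arrays[OF \<kappa>]])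
  next
    case False
    then show ?thesis using PiE_arb[OF \<kappa>(2) False] by (simp add: coloring_def)
  qed
qed

lemma wt_coloring: "A \<in> P_arrays P \<Longrightarrow> wt A = content (coloring A)"
  by (simp add: fun_eq_iff wt_def content_def row_eq_color_class)

lemma tableau_coloring:
  assumes A: "A \<in> P_arrays P"
  shows "A \<in> P_tableaux P \<longleftrightarrow> tableau (coloring A)"
proof -
  have rank: "A (i, j) = Some x \<longleftrightarrow> x \<in> at_rank (coloring A) i j" for i j x
    unfolding at_rank_def array_rank[OF A] row_eq_color_class[OF A] by simp
  have fails_iff: "fails (coloring A) r c \<longleftrightarrow> (r + 1, c) \<in> dom A \<and> \<not> ((r, c) \<in> dom A \<and> \<not> the (A (r, c)) > the (A (r + 1, c)))" for r c
  proof -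
    have F: "fails (coloring A) r c \<longleftrightarrow> (\<exists>b. A (r + 1, c) = Some b \<and> (\<forall>a. A (r, c) = Some a \<longrightarrow> b < a))"
      unfolding fails_def rank Ball_def Bex_def Suc_eq_plus1 ..
    show ?thesis
    proof (cases "A (r + 1, c)")
      case None
      show ?thesis unfolding F domIff None by simp
    next
      case b: (Some b)
      show ?thesis
      proof (cases "A (r, c)")
        case None
        show ?thesis unfolding F domIff b None by simp
      next
        case a: (Some a)
        show ?thesis unfolding F domIff a b by simp
      qed
    qed
  qed
  then have "tableau (coloring A) \<longleftrightarrow> (\<forall>r\<ge>1. \<forall>c. (r + 1, c) \<in> dom A \<longrightarrow>
      (r, c) \<in> dom A \<and> \<not> the (A (r, c)) > the (A (r + 1, c)))"
    unfolding tableau_def fails_iff by blast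
  also have "\<dots> \<longleftrightarrow> (\<forall>i j. (i, j) \<in> dom A \<and> i > 1 \<longrightarrow> (i - 1, j) \<in> dom A \<and> \<not> the (A (i - 1, j)) > the (A (i, j)))"
    (is "?L \<longleftrightarrow> ?R")
  proof
    assume L: ?L
    show ?R
    proof (intro allI impI)
      fix i j assume ij: "(i, j) \<in> dom A \<and> i > 1"
      then have "1 \<le> i - 1" "i - 1 + 1 = i" by linarith+
      then show "(i - 1, j) \<in> dom A \<and> \<not> the (A (i - 1, j)) > the (A (i, j))"
        using L[rule_format, of "i - 1" j] ij by simp
    qed
  next
    assume R: ?R
    show ?L
    proof (intro allI impI)
      fix r c assume "1 \<le> r" "(r + 1, c) \<in> dom A"
      then show "(r, c) \<in> dom A \<and> \<not> the (A (r, c)) > the (A (r + 1, c))"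
        using R[rule_format, of "r + 1" c] by simp
    qed
  qed
  finally show ?thesis by (simp only: P_tableaux_def mem_Collect_eq A simp_thms)
qed

lemma exchange_eq:
  assumes A: "A \<in> P_arrays P" and \<kappa>: "chain_coloring \<kappa>" "\<kappa> \<in> P \<rightarrow>\<^sub>E {1..}"
    and r: "color_class \<kappa> r = (row A r - S) \<union> T" "color_class \<kappa> (r + 1) = (row A (r + 1) - T) \<union> S"
    and other: "\<And>i. i \<noteq> r \<Longrightarrow> i \<noteq> r + 1 \<Longrightarrow> color_class \<kappa> i = row A i"
  shows "exchange r S T A = array_of \<kappa>"
proof -
  have ran: "ran A = P" using A by (simp add: P_arrays_def)
  note row = row_array_of[OF \<kappa>(1)]
  show ?thesis
    unfolding exchange_def ran
  proof (rule the_equality)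
    show "array_of \<kappa> \<in> P_arrays P \<and> row (array_of \<kappa>) r = row A r - S \<union> T \<and>
      row (array_of \<kappa>) (r + 1) = row A (r + 1) - T \<union> S \<and>
      (\<forall>i. i \<noteq> r \<and> i \<noteq> r + 1 \<longrightarrow> row (array_of \<kappa>) i = row A i)"
      unfolding row using other by (intro conjI allI impI array_of_P_arrays[OF \<kappa>] r) simp
    fix B assume B: "B \<in> P_arrays P \<and> row B r = row A r - S \<union> T \<and> row B (r + 1) = row A (r + 1) - T \<union> S \<and>
      (\<forall>i. i \<noteq> r \<and> i \<noteq> r + 1 \<longrightarrow> row B i = row A i)"
    show "B = array_of \<kappa>"
    proof (rule array_eqI)
      show "B \<in> P_arrays P" using B by blast
      show "array_of \<kappa> \<in> P_arrays P" by (rule array_of_P_arrays[OF \<kappa>])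
      fix i
      consider "i = r" | "i = r + 1" | "i \<noteq> r" "i \<noteq> r + 1" by blast
      then show "row B i = row (array_of \<kappa>) i"
      proof cases
        case 1
        then show ?thesis unfolding row using B r(1) by metis
      next
        case 2
        then show ?thesis unfolding row using B r(2) by metis
      next
        case 3
        then show ?thesis unfolding row using B other[OF 3] by metis
      qed
    qed
  qed
qed

end

section \<open>The alignment and the lowering operator\<close>

text \<open>Whether two initial segments form a cut is decided by their last elements and the first elements
behind them.\<close>
lemma (in three_one_free) rank_cut:
  assumes U: "is_chain U" and V: "is_chain V" and i: "i \<le> card U" and j: "j \<le> card V"
    and uv: "\<And>u v. \<lbrakk>u \<in> U; v \<in> V; rk U u = i; rk V v = Suc j\<rbrakk> \<Longrightarrow> u \<prec> v"
    and vu: "\<And>u v. \<lbrakk>u \<in> U; v \<in> V; rk U u = Suc i; rk V v = j\<rbrakk> \<Longrightarrow> v \<prec> u"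
  shows "{u \<in> U. rk U u \<le> i} \<union> {v \<in> V. rk V v \<le> j} \<in> cuts (U \<union> V)"
proof -
  have cross: "x \<prec> y"
    if W: "is_chain W" "is_chain Z" "x \<in> W" "y \<in> Z" "rk W x \<le> k" "l < rk Z y"
      and step: "\<And>u v. \<lbrakk>u \<in> W; v \<in> Z; rk W u = k; rk Z v = Suc l\<rbrakk> \<Longrightarrow> u \<prec> v"
      and k: "k \<le> card W" for W Z x y k l
  proof -
    have "1 \<le> k" using rk_bounds[OF W(1,3)] W(5) by linarith
    then obtain u where u: "u \<in> W" "rk W u = k" using k by (rule rk_obtain[OF W(1)])
    have "1 \<le> Suc l" "Suc l \<le> card Z" using rk_bounds[OF W(2,4)] W(6) by linarith+
    then obtain v where v: "v \<in> Z" "rk Z v = Suc l" by (rule rk_obtain[OF W(2)])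
    have "x = u \<or> x \<prec> u" using rk_le_iff[OF W(1,3) u(1)] W(5) u(2) by blast
    moreover have "v = y \<or> v \<prec> y" using rk_le_iff[OF W(2) v(1) W(4)] W(6) v(2) by simp
    ultimately show ?thesis using step[OF u(1) v(1) u(2) v(2)] tr by blast
  qed
  have "x \<prec> y" if x: "x \<in> {u \<in> U. rk U u \<le> i} \<union> {v \<in> V. rk V v \<le> j}"
    and y: "y \<in> (U \<union> V) - ({u \<in> U. rk U u \<le> i} \<union> {v \<in> V. rk V v \<le> j})" for x y
  proof -
    consider (1) "x \<in> U" "rk U x \<le> i" "y \<in> U" "i < rk U y"
      | (2) "x \<in> U" "rk U x \<le> i" "y \<in> V" "j < rk V y"
      | (3) "x \<in> V" "rk V x \<le> j" "y \<in> U" "i < rk U y"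
      | (4) "x \<in> V" "rk V x \<le> j" "y \<in> V" "j < rk V y" using x y not_le by blast
    then show ?thesis
    proof cases
      case c: 1
      have "rk U x < rk U y" using c by linarith
      then show ?thesis using rk_less_iff[OF U c(1,3)] by blast
    next
      case c: 2
      show ?thesis by (rule cross[OF U V c(1,3,2,4) uv i])
    next
      case c: 3
      show ?thesis by (rule cross[OF V U c(1,3,2,4) vu j])
    next
      case c: 4
      have "rk V x < rk V y" using c by linarith
      then show ?thesis using rk_less_iff[OF V c(1,3)] by blast
    qed
  qed
  then show ?thesis unfolding cuts_def by blast
qed

text \<open>Two adjacent rows \<open>U\<close> and \<open>V\<close> of an array together with the last lowest cut \<open>D\<close>, which may be all
of \<open>U \<union> V\<close>. It has \<open>p0\<close> elements in \<open>U\<close> and \<open>q0 = p0 + x0\<close> in \<open>V\<close>; beyond \<open>D\<close>, the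
column of an element of \<open>U\<close> is its rank plus \<open>x0\<close>.\<close>
locale aligned = free_order P for P :: "'a::order set" +
  fixes A :: "'a filling" and r :: nat and D :: "'a set"
  assumes A: "A \<in> P_arrays P" and r: "1 \<le> r"
    and cut: "D \<in> cuts (two_rows (coloring A) r)"
    and lowest: "height (coloring A) r D = min_height (coloring A) r"
    and last: "\<And>E. E \<in> cuts (two_rows (coloring A) r) \<Longrightarrow> D \<subset> E \<Longrightarrow> min_height (coloring A) r < height (coloring A) r E"
begin

definition "U = row A r"
definition "V = row A (r + 1)"
definition "X = U \<union> V"
definition "m = card U"
definition "n = card V"
definition "p0 = card (D \<inter> U)"
definition "q0 = card (D \<inter> V)"
definition "x0 = q0 - p0"

lemma U_color_class: "U = color_class (coloring A) r" and V_color_class: "V = color_class (coloring A) (Suc r)"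
  by (simp_all add: U_def V_def row_eq_color_class[OF A])

lemma X_two_rows: "X = two_rows (coloring A) r"
  by (simp add: X_def U_color_class V_color_class two_rows_def)

lemma chU: "is_chain U" and chV: "is_chain V"
  unfolding U_color_class V_color_class by (rule chain_color_class[OF chain_coloring_array[OF A]])+

lemma finX: "finite X"
  unfolding X_two_rows by simp

lemma UV: "U \<inter> V = {}"
  unfolding U_color_class V_color_class by (rule color_class_disjoint) simp

lemma UP: "x \<in> X \<Longrightarrow> x \<in> P"
  by (auto simp: X_two_rows two_rows_def color_class_def)

lemma XU: "x \<in> U \<Longrightarrow> x \<in> X" and XV: "x \<in> V \<Longrightarrow> x \<in> X"
  by (simp_all add: X_def)

lemma heightE: "height (coloring A) r E = int (card (E \<inter> U)) - int (card (E \<inter> V))"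
  by (simp add: height_def U_color_class V_color_class)

lemma cutD: "D \<in> cuts X"
  unfolding X_two_rows by (rule cut)

lemma min_height_eq: "min_height (coloring A) r = int p0 - int q0"
  using lowest unfolding heightE p0_def q0_def by simp

lemma pq: "p0 \<le> q0" "q0 = p0 + x0"
  using min_height_nonpos[of "coloring A" r] unfolding min_height_eq x0_def by simp_all

lemma no_lower_cut: "E \<in> cuts X \<Longrightarrow> card (E \<inter> V) \<le> card (E \<inter> U) + x0"
  using min_height_le[of E "coloring A" r] pq unfolding X_two_rows min_height_eq heightE by simp

lemma last_cut: "E \<in> cuts X \<Longrightarrow> D \<subset> E \<Longrightarrow> card (E \<inter> V) < card (E \<inter> U) + x0"
  using last[of E] pq unfolding X_two_rows min_height_eq heightE by simp

lemma size: "n \<le> m + x0"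
  using no_lower_cut[OF cuts_self] by (simp add: X_def n_def m_def Int_absorb1)

lemma q0n: "q0 \<le> n"
  unfolding q0_def n_def by (rule card_mono[OF chain_finite[OF chV]]) simp

lemma inD_U: "x \<in> U \<Longrightarrow> x \<in> D \<longleftrightarrow> rk U x \<le> p0"
  unfolding p0_def by (rule cut_rk[OF chU _ cutD]) (auto simp: X_def)

lemma inD_V: "x \<in> V \<Longrightarrow> x \<in> D \<longleftrightarrow> rk V x \<le> q0"
  unfolding q0_def by (rule cut_rk[OF chV _ cutD]) (auto simp: X_def)

lemma D_below: "x \<in> D \<Longrightarrow> y \<in> X \<Longrightarrow> y \<notin> D \<Longrightarrow> x < y"
  using cutD unfolding cuts_def by blast

lemma array_U: "A (r, k) = Some a \<longleftrightarrow> a \<in> U \<and> rk U a = k"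
  unfolding U_def by (rule array_rank[OF A])

lemma array_V: "A (r + 1, k) = Some b \<longleftrightarrow> b \<in> V \<and> rk V b = k"
  unfolding V_def by (rule array_rank[OF A])

abbreviation uc :: "nat \<Rightarrow> nat" where "uc \<equiv> upper_column A r"

lemma uc_eq:
  assumes "a \<in> U"
  shows "uc (rk U a) = Max ({0} \<union> {rk V b | b. b \<in> V \<and> b < a} \<union> uc ` {1..<rk U a}) + 1"
proof -
  have "A (r, rk U a) = Some a" unfolding array_U using assms by simp
  moreover have "{i. \<exists>b. A (r + 1, i) = Some b \<and> b < a} = {rk V b | b. b \<in> V \<and> b < a}"
    unfolding array_V by blast
  ultimately show ?thesis by (subst upper_column.simps) simp
qed

lemma uc_gt:
  assumes a: "a \<in> U" and i: "i \<in> {0} \<union> {rk V b | b. b \<in> V \<and> b < a} \<union> uc ` {1..<rk U a}"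
  shows "i < uc (rk U a)"
proof -
  have "{rk V b | b. b \<in> V \<and> b < a} \<subseteq> rk V ` V" by blast
  then have "finite {rk V b | b. b \<in> V \<and> b < a}" by (rule finite_subset) (rule finite_imageI[OF chain_finite[OF chV]])
  then have "finite ({0} \<union> {rk V b | b. b \<in> V \<and> b < a} \<union> uc ` {1..<rk U a})" by simp
  from Max_ge[OF this i] show ?thesis unfolding uc_eq[OF a] by linarith
qed

lemma uc_mono:
  assumes "a \<in> U" "1 \<le> k" "k < rk U a"
  shows "uc k < uc (rk U a)"
  by (rule uc_gt[OF assms(1)]) (use assms(2,3) in simp)

text \<open>If an element of \<open>V\<close> below \<open>a\<close> had rank at least \<open>rk U a + x0\<close>, then \<open>fail_gives_cut\<close> would provide
a cut lower than \<open>D\<close>.\<close>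
lemma uc_le: "a \<in> U \<Longrightarrow> uc (rk U a) \<le> rk U a + x0"
proof (induction "rk U a" arbitrary: a rule: less_induct)
  case less
  note a = \<open>a \<in> U\<close>
  let ?S = "{0} \<union> {rk V b | b. b \<in> V \<and> b < a} \<union> uc ` {1..<rk U a}"
  have k1: "1 \<le> rk U a" using rk_bounds[OF chU a] by blast
  have bound: "i < rk U a + x0" if "i \<in> ?S" for i
  proof -
    from that consider (1) "i = 0" | (2) b where "b \<in> V" "b < a" "i = rk V b" | (3) k where "k \<in> {1..<rk U a}" "i = uc k"
      by blast
    then show ?thesis
    proof cases
      case 1
      then show ?thesis using k1 by simp
    next
      case (2 b)
      show ?thesis
      proof (rule ccontr)
        assume "\<not> ?thesis"
        then have le: "rk U a + x0 \<le> rk V b" using 2(3) by simp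
        have "1 \<le> rk U a + x0" "rk U a + x0 \<le> card V" using k1 le rk_bounds[OF chV 2(1)] by linarith+
        then obtain c where c: "c \<in> V" "rk V c = rk U a + x0" by (rule rk_obtain[OF chV])
        have "c = b \<or> c < b" using rk_le_iff[OF chV c(1) 2(1)] le c(2) by simp
        then have ca: "c < a" using 2(2) less_trans by blast
        have "c < a'" if "a' \<in> U" "rk U a' = rk U a" for a'
          using ca rk_eq_iff[OF chU that(1) a] that(2) by simp
        note f = fail_gives_cut[OF chU chV UV c k1 this]
        obtain j where j: "1 \<le> j" "j \<le> rk U a"
          and E: "{a \<in> U. rk U a < j} \<union> {b \<in> V. rk V b \<le> j + x0} \<in> cuts (U \<union> V)" (is "?E \<in> _")
          and card: "card {a \<in> U. rk U a < j} = j - 1" "card {b \<in> V. rk V b \<le> j + x0} = j + x0"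
          by (rule f)
        have "?E \<inter> U = {a \<in> U. rk U a < j}" "?E \<inter> V = {b \<in> V. rk V b \<le> j + x0}" using UV by auto
        then have "j + x0 \<le> j - 1 + x0" using no_lower_cut[OF E[folded X_def]] card by simp
        then show False using j(1) by simp
      qed
    next
      case (3 k)
      have "1 \<le> k" "k \<le> card U" using 3(1) rk_bounds[OF chU a] by simp_all
      then obtain c where c: "c \<in> U" "rk U c = k" by (rule rk_obtain[OF chU])
      then have "uc k \<le> k + x0" using less.hyps[of c] 3(1) by simp
      then show ?thesis using 3 by simp
    qed
  qed
  have "?S \<noteq> {}" by simp
  have "{rk V b | b. b \<in> V \<and> b < a} \<subseteq> rk V ` V" by blast
  then have "finite {rk V b | b. b \<in> V \<and> b < a}" by (rule finite_subset) (rule finite_imageI[OF chain_finite[OF chV]])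
  then have "finite ?S" by simp
  from Max_in[OF this \<open>?S \<noteq> {}\<close>] have "Max ?S < rk U a + x0" by (rule bound)
  then show ?case unfolding uc_eq[OF a] by linarith
qed

lemma uc_after: "a \<in> U \<Longrightarrow> p0 < rk U a \<Longrightarrow> rk U a + x0 \<le> uc (rk U a)"
proof (induction "rk U a" arbitrary: a rule: less_induct)
  case less
  note a = \<open>a \<in> U\<close> and gt = \<open>p0 < rk U a\<close>
  show ?case
  proof (cases "rk U a = p0 + 1")
    case True
    have "q0 < uc (rk U a)"
    proof (cases "q0 = 0")
      case True
      have "0 < uc (rk U a)" by (rule uc_gt[OF a]) simp
      then show ?thesis using True by simp
    next
      case False
      then have "1 \<le> q0" "q0 \<le> card V" using q0n by (simp_all add: n_def)
      then obtain b where b: "b \<in> V" "rk V b = q0" by (rule rk_obtain[OF chV])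
      have "b \<in> D" using inD_V[OF b(1)] b(2) by simp
      moreover have "a \<notin> D" using inD_U[OF a] gt by simp
      ultimately have "b < a" using D_below XU[OF a] by blast
      then have "rk V b < uc (rk U a)" by (intro uc_gt[OF a]) (use b(1) in blast)
      then show ?thesis using b(2) by simp
    qed
    then show ?thesis using True pq by simp
  next
    case False
    then have k: "p0 < rk U a - 1" "rk U a - 1 < rk U a" using gt by linarith+
    have "1 \<le> rk U a - 1" "rk U a - 1 \<le> card U" using k rk_bounds[OF chU a] by linarith+
    then obtain c where c: "c \<in> U" "rk U c = rk U a - 1" by (rule rk_obtain[OF chU])
    have "rk U c + x0 \<le> uc (rk U c)" by (rule less.hyps) (use c k in simp_all)
    moreover have "uc (rk U c) < uc (rk U a)" by (rule uc_mono[OF a]) (use c k rk_bounds[OF chU c(1)] in simp_all)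
    ultimately show ?thesis using c(2) k by simp
  qed
qed

lemma pre_U: "a \<in> U \<Longrightarrow> pre_alignment A r a = uc (rk U a)"
proof -
  assume "a \<in> U"
  then have p: "A (r, rk U a) = Some a" unfolding array_U by simp
  have "(THE p. A p = Some a) = (r, rk U a)"
    by (rule the_equality[of "\<lambda>p. A p = Some a", OF p]) (rule array_injective[OF A _ p])
  then show ?thesis by (simp add: pre_alignment_def)
qed

lemma pre_V: "b \<in> V \<Longrightarrow> pre_alignment A r b = rk V b"
proof -
  assume "b \<in> V"
  then have p: "A (r + 1, rk V b) = Some b" unfolding array_V by simp
  have "(THE p. A p = Some b) = (r + 1, rk V b)"
    by (rule the_equality[of "\<lambda>p. A p = Some b", OF p]) (rule array_injective[OF A _ p])
  then show ?thesis by (simp add: pre_alignment_def)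
qed

text \<open>What every stage of the alignment procedure preserves. In particular the part of \<open>U\<close> beyond \<open>D\<close> never
moves, and \<open>D\<close> never leaves the columns up to \<open>q0\<close>, since it is below the first element of \<open>U\<close>
beyond it.\<close>
definition column_invariant :: "('a \<Rightarrow> nat) \<Rightarrow> bool" where
  "column_invariant \<phi> \<longleftrightarrow>
     (\<forall>x\<in>U. \<forall>y\<in>U. x < y \<longrightarrow> \<phi> x < \<phi> y) \<and> (\<forall>x\<in>V. \<forall>y\<in>V. x < y \<longrightarrow> \<phi> x < \<phi> y) \<and>
     (\<forall>b\<in>V. \<forall>a\<in>U. b < a \<longrightarrow> \<phi> b < \<phi> a) \<and>
     (\<forall>b\<in>V. rk V b \<le> \<phi> b) \<and> (\<forall>a\<in>U. 1 \<le> \<phi> a) \<and>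
     (\<forall>a\<in>U. p0 < rk U a \<longrightarrow> \<phi> a = rk U a + x0) \<and>
     (\<forall>x\<in>X. \<phi> x \<le> m + x0) \<and> (\<forall>x\<in>D. \<phi> x \<le> q0)"

lemma column_invariantD:
  assumes "column_invariant \<phi>"
  shows "x \<in> U \<Longrightarrow> y \<in> U \<Longrightarrow> x < y \<Longrightarrow> \<phi> x < \<phi> y"
    "x \<in> V \<Longrightarrow> y \<in> V \<Longrightarrow> x < y \<Longrightarrow> \<phi> x < \<phi> y"
    "b \<in> V \<Longrightarrow> a \<in> U \<Longrightarrow> b < a \<Longrightarrow> \<phi> b < \<phi> a"
    "b \<in> V \<Longrightarrow> rk V b \<le> \<phi> b" "a \<in> U \<Longrightarrow> 1 \<le> \<phi> a"
    "a \<in> U \<Longrightarrow> p0 < rk U a \<Longrightarrow> \<phi> a = rk U a + x0"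
    "x \<in> X \<Longrightarrow> \<phi> x \<le> m + x0" "x \<in> D \<Longrightarrow> \<phi> x \<le> q0"
  using assms unfolding column_invariant_def by blast+

lemma column_invariant_pre: "column_invariant (pre_alignment A r)"
  unfolding column_invariant_def
proof (intro conjI ballI impI)
  fix x y assume "x \<in> U" "y \<in> U" "x < y"
  then show "pre_alignment A r x < pre_alignment A r y"
    using uc_mono[of y "rk U x"] rk_less_iff[OF chU, of x y] rk_bounds[OF chU, of x] by (simp add: pre_U)
next
  fix x y assume "x \<in> V" "y \<in> V" "x < y"
  then show "pre_alignment A r x < pre_alignment A r y"
    using rk_less_iff[OF chV, of x y] by (simp add: pre_V)
next
  fix b a assume ba: "b \<in> V" "a \<in> U" "b < a"
  have "rk V b < uc (rk U a)" by (rule uc_gt[OF ba(2)]) (use ba in blast)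
  then show "pre_alignment A r b < pre_alignment A r a" using ba by (simp add: pre_U pre_V)
next
  fix b assume "b \<in> V"
  then show "rk V b \<le> pre_alignment A r b" by (simp add: pre_V)
next
  fix a assume a: "a \<in> U"
  have "0 < uc (rk U a)" by (rule uc_gt[OF a]) simp
  then show "1 \<le> pre_alignment A r a" using a by (simp add: pre_U)
next
  fix a assume "a \<in> U" "p0 < rk U a"
  then show "pre_alignment A r a = rk U a + x0"
    using uc_le[of a] uc_after[of a] by (simp add: pre_U)
next
  fix x assume "x \<in> X"
  then consider "x \<in> U" | "x \<in> V" unfolding X_def by blast
  then show "pre_alignment A r x \<le> m + x0"
  proof cases
    case 1
    then show ?thesis using uc_le[of x] rk_bounds[OF chU, of x] by (simp add: pre_U m_def)
  next
    case 2
    then show ?thesis using size rk_bounds[OF chV, of x] by (simp add: pre_V n_def)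
  qed
next
  fix x assume D: "x \<in> D"
  then have "x \<in> X" using cutD unfolding cuts_def by blast
  then consider "x \<in> U" | "x \<in> V" unfolding X_def by blast
  then show "pre_alignment A r x \<le> q0"
  proof cases
    case 1
    then show ?thesis using uc_le[of x] inD_U[of x] D pq by (simp add: pre_U)
  next
    case 2
    then show ?thesis using inD_V[of x] D by (simp add: pre_V)
  qed
qed

lemma next_U: "1 \<le> k \<Longrightarrow> k \<le> m \<Longrightarrow> \<exists>a\<in>U. rk U a = k"
  unfolding m_def by (meson rk_obtain[OF chU])

text \<open>An element of \<open>U\<close> beyond \<open>D\<close> is blocked by its successor in \<open>U\<close>, and the last one by the empty
column behind it. The order between elements is kept because a shift never enters a column that
contains a larger element.\<close>
lemma column_invariant_step:
  assumes I: "column_invariant \<phi>" and sh: "shiftable X \<phi> x"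
  shows "column_invariant (\<phi>(x := \<phi> x + 1))" "\<phi> x < m + x0" "x \<in> X"
proof -
  let ?\<psi> = "\<phi>(x := \<phi> x + 1)"
  note i = column_invariantD[OF I]
  show xX: "x \<in> X" using sh unfolding shiftable_def by blast
  obtain y where y: "y \<in> X" "\<phi> y = \<phi> x + 1" using sh unfolding shiftable_def by blast
  have blocked: "\<phi> z \<noteq> \<phi> x + 1" if "z \<in> X" "x < z" for z using sh that unfolding shiftable_def by blast
  show lt: "\<phi> x < m + x0" using i(7)[OF y(1)] y(2) by linarith
  have inc: "?\<psi> u < ?\<psi> v" if uv: "v \<in> X" "u < v" "\<phi> u < \<phi> v" for u v
  proof (cases "u = x")
    case True
    then have "\<phi> v \<noteq> \<phi> x + 1" "v \<noteq> x" using blocked uv by auto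
    then show ?thesis using True uv(3) by simp
  next
    case False
    then show ?thesis using uv(3) by (cases "v = x") simp_all
  qed
  have ge: "\<phi> z \<le> ?\<psi> z" for z by simp
  have fixed: "a \<noteq> x" if a: "a \<in> U" "p0 < rk U a" for a
  proof
    assume ax: "a = x"
    show False
    proof (cases "rk U a < m")
      case True
      then obtain a' where a': "a' \<in> U" "rk U a' = Suc (rk U a)" using next_U[of "Suc (rk U a)"] by auto
      have "\<phi> a' = \<phi> x + 1" using i(6)[OF a] i(6)[OF a'(1)] a'(2) a(2) ax by simp
      moreover have "x < a'" using rk_less_iff[OF chU a(1) a'(1)] a'(2) ax by simp
      ultimately show False using blocked[OF XU[OF a'(1)]] by blast
    next
      case False
      then show False using i(6)[OF a] lt ax by simp
    qed
  qed
  have small: "\<phi> x < q0" if D: "x \<in> D"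
  proof (rule ccontr)
    assume "\<not> ?thesis"
    then have eq: "\<phi> x = q0" using i(8)[OF D] by simp
    have "p0 < m" using eq lt pq by linarith
    then obtain a where a: "a \<in> U" "rk U a = Suc p0" using next_U[of "Suc p0"] by auto
    have "\<phi> a = \<phi> x + 1" using i(6)[OF a(1)] a(2) eq pq by simp
    moreover have "a \<notin> D" using inD_U[OF a(1)] a(2) by simp
    ultimately show False using blocked[OF XU[OF a(1)]] D_below[OF D XU[OF a(1)]] by blast
  qed
  show "column_invariant ?\<psi>"
    unfolding column_invariant_def
  proof (intro conjI ballI impI)
    fix u v assume "u \<in> U" "v \<in> U" "u < v"
    then show "?\<psi> u < ?\<psi> v" using inc i(1) XU by blast
  next
    fix u v assume "u \<in> V" "v \<in> V" "u < v"
    then show "?\<psi> u < ?\<psi> v" using inc i(2) XV by blast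
  next
    fix b a assume "b \<in> V" "a \<in> U" "b < a"
    then show "?\<psi> b < ?\<psi> a" using inc i(3) XU by blast
  next
    fix b assume "b \<in> V"
    then show "rk V b \<le> ?\<psi> b" using i(4)[of b] ge[of b] by linarith
  next
    fix a assume "a \<in> U"
    then show "1 \<le> ?\<psi> a" using i(5)[of a] ge[of a] by linarith
  next
    fix a assume "a \<in> U" "p0 < rk U a"
    then show "?\<psi> a = rk U a + x0" using fixed[of a] i(6)[of a] by simp
  next
    fix z assume "z \<in> X"
    then show "?\<psi> z \<le> m + x0" using i(7)[of z] lt by (cases "z = x") simp_all
  next
    fix z assume "z \<in> D"
    then show "?\<psi> z \<le> q0" using i(8)[of z] small by (cases "z = x") simp_all
  qed
qed

lemma alignment_invariant: "column_invariant (alignment A r)" and alignment_final: "\<not> shiftable X (alignment A r) x"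
proof -
  let ?c = "\<lambda>\<phi>. let x = (ARG_MAX \<phi> x. shiftable X \<phi> x) in \<phi>(x := \<phi> x + 1)"
  have al: "alignment A r = while (\<lambda>\<phi>. \<exists>x. shiftable X \<phi> x) ?c (pre_alignment A r)"
    unfolding alignment_def Let_def X_def U_def V_def ..
  have step: "column_invariant (?c \<phi>) \<and> (\<Sum>x\<in>X. m + x0 - ?c \<phi> x) < (\<Sum>x\<in>X. m + x0 - \<phi> x)"
    if I: "column_invariant \<phi>" and ex: "\<exists>x. shiftable X \<phi> x" for \<phi>
  proof -
    define x where "x = (ARG_MAX \<phi> x. shiftable X \<phi> x)"
    obtain z where z: "shiftable X \<phi> z" using ex ..
    have "\<forall>y. shiftable X \<phi> y \<longrightarrow> \<phi> y < m + x0" using column_invariant_step(2)[OF I] by blast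
    from arg_max_natI[of "shiftable X \<phi>", OF z this] have sh: "shiftable X \<phi> x" unfolding x_def .
    have c: "?c \<phi> = \<phi>(x := \<phi> x + 1)" unfolding x_def Let_def ..
    note s = column_invariant_step[OF I sh]
    have "(\<Sum>y\<in>X. m + x0 - (\<phi>(x := \<phi> x + 1)) y) < (\<Sum>y\<in>X. m + x0 - \<phi> y)"
    proof (rule sum_strict_mono_ex1[OF finX])
      show "\<forall>y\<in>X. m + x0 - (\<phi>(x := \<phi> x + 1)) y \<le> m + x0 - \<phi> y"
        by (intro ballI diff_le_mono2) simp
      show "\<exists>y\<in>X. m + x0 - (\<phi>(x := \<phi> x + 1)) y < m + x0 - \<phi> y"
        using s(2,3) by (intro bexI[of _ x]) simp_all
    qed
    then show ?thesis using s(1) unfolding c by blast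
  qed
  have "column_invariant (alignment A r) \<and> \<not> (\<exists>x. shiftable X (alignment A r) x)"
    unfolding al
  proof (rule while_rule[where P = column_invariant and r = "measure (\<lambda>\<phi>. \<Sum>x\<in>X. m + x0 - \<phi> x)"])
    show "column_invariant (pre_alignment A r)" by (rule column_invariant_pre)
    show "column_invariant (?c \<phi>)" if "column_invariant \<phi>" "\<exists>x. shiftable X \<phi> x" for \<phi> using step[OF that] by (rule conjunct1)
    show "column_invariant \<phi> \<and> \<not> (\<exists>x. shiftable X \<phi> x)" if "column_invariant \<phi>" "\<not> (\<exists>x. shiftable X \<phi> x)" for \<phi>
      using that by (rule conjI)
    show "(?c \<phi>, \<phi>) \<in> measure (\<lambda>\<phi>. \<Sum>x\<in>X. m + x0 - \<phi> x)" if "column_invariant \<phi>" "\<exists>x. shiftable X \<phi> x" for \<phi>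
      unfolding in_measure using step[OF that] by (rule conjunct2)
  qed (rule wf_measure)
  then show "column_invariant (alignment A r)" "\<not> shiftable X (alignment A r) x" by blast+
qed

end

context aligned
begin

abbreviation al :: "'a \<Rightarrow> nat" where "al \<equiv> alignment A r"

lemmas al = column_invariantD[OF alignment_invariant]

lemma al_inj_V: "b \<in> V \<Longrightarrow> c \<in> V \<Longrightarrow> al b = al c \<Longrightarrow> b = c"
proof -
  assume b: "b \<in> V" and c: "c \<in> V" and eq: "al b = al c"
  have "\<not> b < c" "\<not> c < b" using al(2)[OF b c] al(2)[OF c b] eq by auto
  then show "b = c" using chV b c unfolding is_chain_def by blast
qed

lemma al_inj_U: "a \<in> U \<Longrightarrow> c \<in> U \<Longrightarrow> al a = al c \<Longrightarrow> a = c"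
proof -
  assume a: "a \<in> U" and c: "c \<in> U" and eq: "al a = al c"
  have "\<not> a < c" "\<not> c < a" using al(1)[OF a c] al(1)[OF c a] eq by auto
  then show "a = c" using chU a c unfolding is_chain_def by blast
qed

lemma rank_U_less: "a \<in> U \<Longrightarrow> c \<in> U \<Longrightarrow> rk U a < rk U c \<Longrightarrow> a < c"
  using rk_less_iff[OF chU] by blast

lemma rank_V_less: "a \<in> V \<Longrightarrow> c \<in> V \<Longrightarrow> rk V a < rk V c \<Longrightarrow> a < c"
  using rk_less_iff[OF chV] by blast

lemma column_partner:
  assumes v: "v \<in> X" and k: "p0 < k" "al v = k + x0"
  shows "\<exists>a\<in>U. rk U a = k \<and> al a = al v"
proof -
  have "k \<le> m" using al(7)[OF v] k(2) by linarith
  then obtain a where a: "a \<in> U" "rk U a = k" using next_U[of k] k(1) by auto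
  then show ?thesis using al(6)[OF a(1)] k by (intro bexI[of _ a]) simp_all
qed

text \<open>The column of \<open>v\<close> contains an element of \<open>U\<close>, which is not above \<open>v\<close>. It is at least two steps
above \<open>a\<close> in \<open>U\<close>, so (3+1)-freeness applies to this chain and \<open>v\<close>.\<close>
lemma far_above:
  assumes a: "a \<in> U" "p0 < rk U a" and v: "v \<in> V" "rk U a + x0 + 2 \<le> al v"
  shows "a < v"
proof -
  define k where "k = al v - x0"
  have k: "p0 < k" "al v = k + x0" "rk U a + 2 \<le> k" using a(2) v(2) unfolding k_def by linarith+
  obtain c where c: "c \<in> U" "rk U c = k" "al c = al v" using column_partner[OF XV[OF v(1)] k(1,2)] by blast
  have "\<not> v < c" using al(3)[OF v(1) c(1)] c(3) by auto
  have "1 \<le> rk U a + 1" "rk U a + 1 \<le> card U" using k(3) c(2) rk_bounds[OF chU c(1)] by linarith+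
  then obtain d where d: "d \<in> U" "rk U d = rk U a + 1" by (rule rk_obtain[OF chU])
  have "a < d" "d < c" using rank_U_less[OF a(1) d(1)] rank_U_less[OF d(1) c(1)] d(2) c(2) k(3) by simp_all
  from free[OF UP[OF XU[OF a(1)]] UP[OF XU[OF d(1)]] UP[OF XU[OF c(1)]] UP[OF XV[OF v(1)]] this] \<open>\<not> v < c\<close>
  show ?thesis by blast
qed

text \<open>A cut strictly beyond \<open>D\<close> has larger height than \<open>D\<close>.\<close>
lemma rank_cut_beyond_D:
  assumes i: "p0 < i" "i \<le> m" and j: "j \<le> n" "q0 \<le> j"
    and uv: "\<And>u v. \<lbrakk>u \<in> U; v \<in> V; rk U u = i; rk V v = Suc j\<rbrakk> \<Longrightarrow> u < v"
    and vu: "\<And>u v. \<lbrakk>u \<in> U; v \<in> V; rk U u = Suc i; rk V v = j\<rbrakk> \<Longrightarrow> v < u"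
  shows "{u \<in> U. rk U u \<le> i} \<union> {v \<in> V. rk V v \<le> j} \<in> cuts X"
    "D \<subset> {u \<in> U. rk U u \<le> i} \<union> {v \<in> V. rk V v \<le> j}" (is "_ \<subset> ?E")
    "({u \<in> U. rk U u \<le> i} \<union> {v \<in> V. rk V v \<le> j}) \<inter> U = {u \<in> U. rk U u \<le> i}"
    "j < i + x0"
proof -
  show cut: "?E \<in> cuts X" unfolding X_def
    by (rule rank_cut[OF chU chV i(2)[unfolded m_def] j(1)[unfolded n_def] uv vu])
  have "x \<in> ?E" if x: "x \<in> D" for x
  proof -
    have "x \<in> X" using x cutD unfolding cuts_def by blast
    then consider "x \<in> U" | "x \<in> V" unfolding X_def by blast
    then show ?thesis
    proof cases
      case 1
      then show ?thesis using inD_U[OF 1] x i(1) by simp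
    next
      case 2
      then show ?thesis using inD_V[OF 2] x j(2) by simp
    qed
  qed
  then have sub: "D \<subseteq> ?E" by blast
  obtain a where a: "a \<in> U" "rk U a = i" using next_U[of i] i by auto
  have "a \<in> ?E" "a \<notin> D" using a inD_U[OF a(1)] i(1) by simp_all
  then show strict: "D \<subset> ?E" using sub by blast
  show EU: "?E \<inter> U = {u \<in> U. rk U u \<le> i}" using UV by blast
  have EV: "?E \<inter> V = {v \<in> V. rk V v \<le> j}" using UV by blast
  have "card {u \<in> U. rk U u \<le> i} = i" by (rule card_rk_le[OF chU i(2)[unfolded m_def]])
  moreover have "card {v \<in> V. rk V v \<le> j} = j" by (rule card_rk_le[OF chV j(1)[unfolded n_def]])
  ultimately show "j < i + x0" using last_cut[OF cut strict] unfolding EU EV by simp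
qed

text \<open>The first element of \<open>U\<close> beyond \<open>D\<close> is in column \<open>q0 + 1\<close> and has no partner in \<open>V\<close>.\<close>
lemma column_unpaired:
  assumes b: "b \<in> V" shows "al b \<noteq> q0 + 1"
proof
  assume col: "al b = q0 + 1"
  \<comment> \<open>Follow the elements of \<open>V\<close> beyond \<open>D\<close> that are in the column given by their rank. The last of
      them could be shifted unless the element of \<open>U\<close> in the next column is above it, and in this case
      there is a cut beyond \<open>D\<close> that is as low as \<open>D\<close>.\<close>
  define R where "R s \<longleftrightarrow> 1 \<le> s \<and> (\<exists>b\<in>V. rk V b = q0 + s \<and> al b = q0 + s)" for s
  have "b \<notin> D" using al(8)[of b] col by auto
  then have "q0 < rk V b" using inD_V[OF b] by simp
  moreover have "rk V b \<le> q0 + 1" using al(4)[OF b] col by simp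
  ultimately have "rk V b = q0 + 1" by linarith
  then have R1: "R 1" unfolding R_def using b col by blast
  have "s < Suc n" if "R s" for s
  proof -
    from that obtain c where "c \<in> V" "rk V c = q0 + s" unfolding R_def by blast
    then show ?thesis using rk_bounds[OF chV, of c] by (simp add: n_def)
  qed
  then have "\<forall>s. R s \<longrightarrow> s < Suc n" by blast
  from ex_has_greatest_nat[of R 1 "\<lambda>s. s", OF R1 this]
  obtain s where Rs: "R s" and greatest: "\<forall>s'. R s' \<longrightarrow> s' \<le> s" by blast
  have no: "\<not> R (s + 1)" using greatest[rule_format, of "s + 1"] by auto
  obtain c where c: "c \<in> V" "rk V c = q0 + s" "al c = q0 + s" and s1: "1 \<le> s" using Rs unfolding R_def by blast
  have next_col: "al v \<noteq> q0 + s + 1" if v: "v \<in> V" "q0 + s < rk V v" for v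
  proof
    assume e: "al v = q0 + s + 1"
    then have "rk V v = q0 + s + 1" using al(4)[OF v(1)] v(2) by linarith
    then show False using no v(1) e unfolding R_def by auto
  qed
  have "al c = (p0 + s) + x0" using c(3) pq by simp
  from column_partner[OF XV[OF c(1)] _ this] s1
  obtain a where a: "a \<in> U" "rk U a = p0 + s" by auto
  have am: "p0 + s \<le> m" using rk_bounds[OF chU a(1)] a(2) by (simp add: m_def)
  have sn: "q0 + s \<le> n" using rk_bounds[OF chV c(1)] c(2) by (simp add: n_def)
  have above: "v < u" if u: "u \<in> U" "rk U u = Suc (p0 + s)" and v: "v \<in> V" "rk V v = q0 + s" for u v
  proof -
    have vc: "v = c" using rk_eq_iff[OF chV v(1) c(1)] v(2) c(2) by simp
    have ucol: "al u = q0 + s + 1" using al(6)[OF u(1)] u(2) pq by simp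
    have "\<exists>y\<in>X. al y = al c + 1" using XU[OF u(1)] ucol c(3) by (intro bexI[of _ u]) simp_all
    then have "\<exists>y\<in>X. al y = al c + 1 \<and> c < y"
      using alignment_final[of c] XV[OF c(1)] unfolding shiftable_def by blast
    then obtain y where y: "y \<in> X" "al y = q0 + s + 1" "c < y" using c(3) by auto
    have "y \<in> U"
    proof (rule ccontr)
      assume "y \<notin> U"
      then have yV: "y \<in> V" using y(1) unfolding X_def by blast
      have "q0 + s < rk V y" using rk_less_iff[OF chV c(1) yV] y(3) c(2) by simp
      then show False using next_col[OF yV] y(2) by simp
    qed
    then have "y = u" by (rule al_inj_U[OF _ u(1)]) (simp add: y(2) ucol)
    then show ?thesis using y(3) vc by simp
  qed
  have below: "u < v" if u: "u \<in> U" "rk U u = p0 + s" and v: "v \<in> V" "rk V v = Suc (q0 + s)" for u v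
  proof (rule far_above[OF u(1) _ v(1)])
    show "p0 < rk U u" using u(2) s1 by simp
    have "q0 + s + 1 \<le> al v" using al(4)[OF v(1)] v(2) by simp
    moreover have "al v \<noteq> q0 + s + 1" using next_col[OF v(1)] v(2) by simp
    ultimately show "rk U u + x0 + 2 \<le> al v" using u(2) pq by simp
  qed
  have "q0 + s < p0 + s + x0"
    by (rule rank_cut_beyond_D(4)[of "p0 + s" "q0 + s"]) (use s1 am sn above below in simp_all)
  then show False using pq by simp
qed

text \<open>The \<open>q0\<close> elements of \<open>V\<close> in \<open>D\<close> have distinct columns among the first \<open>q0\<close>.\<close>
lemma columns_of_D:
  assumes "1 \<le> c" "c \<le> q0"
  shows "\<exists>b\<in>V. al b = c"
proof -
  have fin: "finite (D \<inter> V)" using chain_finite[OF chV] by simp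
  have inj: "inj_on al (D \<inter> V)" by (rule inj_onI) (use al_inj_V in blast)
  have "al ` (D \<inter> V) \<subseteq> {1..q0}"
  proof
    fix k assume "k \<in> al ` (D \<inter> V)"
    then obtain b where b: "b \<in> D" "b \<in> V" "k = al b" by blast
    have "1 \<le> al b" using al(4)[OF b(2)] rk_bounds[OF chV b(2)] by linarith
    then show "k \<in> {1..q0}" using al(8)[OF b(1)] b(3) by simp
  qed
  moreover have "card (al ` (D \<inter> V)) = card {1..q0}" using card_image[OF inj] by (simp add: q0_def)
  ultimately have "al ` (D \<inter> V) = {1..q0}" by (intro card_subset_eq) simp_all
  then have "c \<in> al ` (D \<inter> V)" using assms by simp
  then show ?thesis by blast
qed

lemma lowering_none:
  assumes "D = X" shows "lowering r A = None"
proof -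
  have "\<forall>a\<in>U. \<exists>b\<in>V. al b = al a"
  proof
    fix a assume a: "a \<in> U"
    then have "al a \<le> q0" using al(8)[of a] XU[OF a] assms by simp
    then show "\<exists>b\<in>V. al b = al a" by (rule columns_of_D[OF al(5)[OF a]])
  qed
  then show ?thesis unfolding lowering_def Let_def U_def[symmetric] V_def[symmetric] by (rule if_P)
qed

end

text \<open>Now \<open>D'\<close> is the cut following \<open>D\<close>, so that \<open>D' - D\<close> is the part whose colors are exchanged.\<close>
locale lowerable = aligned P A r D for P :: "'a::order set" and A r D +
  fixes D' :: "'a set"
  assumes pair: "low_pair (coloring A) r D D'"
begin

lemma cutD': "D' \<in> cuts X" "D \<subset> D'" "E \<in> cuts X \<Longrightarrow> E \<subseteq> D \<or> D' \<subseteq> E"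
  using coversD[OF low_pairD(1)[OF pair]] unfolding X_two_rows by blast+

lemma size_strict: "n < m + x0"
proof -
  have "D \<subset> X" using cutD'(1,2) unfolding cuts_def by blast
  from last_cut[OF cuts_self this] show ?thesis
    by (simp add: X_def n_def m_def Int_absorb1)
qed

lemma p0_less: "p0 < m"
  using q0n size_strict pq by simp

text \<open>The condition that determines the number of elements moved to the lower row, counted from the first
element of \<open>U\<close> beyond \<open>D\<close>.\<close>
definition "stop t \<longleftrightarrow> (\<exists>a. A (r, p0 + 1 + t) = Some a \<and> \<not> (\<exists>b\<in>V. al b = al a + 1 \<and> \<not> b > a))"

definition "p1 = card (D' \<inter> U)"

lemma D'_X: "D' \<subseteq> X" using cutD'(1) by (simp add: cuts_def)

lemma height_D': "card (D' \<inter> V) + 1 = p1 + x0"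
proof -
  note c = low_pairD(1)[OF pair]
  have "height (coloring A) r D = int p0 - int q0" using low_pairD(2)[OF pair] min_height_eq by simp
  moreover have "min_height (coloring A) r < height (coloring A) r D'"
    by (rule low_pairD(3)[OF pair coversD(2)[OF c] coversD(3)[OF c]])
  moreover have "\<bar>height (coloring A) r D' - height (coloring A) r D\<bar> \<le> 1"
    by (rule covers_step[OF chain_coloring_array[OF A] c])
  ultimately have "height (coloring A) r D' = int p0 - int q0 + 1" using min_height_eq by linarith
  then show ?thesis using pq unfolding heightE p1_def by simp
qed

lemma p1: "p0 < p1" "p1 \<le> m"
proof -
  show "p1 \<le> m" unfolding p1_def m_def by (rule card_mono[OF chain_finite[OF chU]]) simp
  have "card (D \<inter> V) \<le> card (D' \<inter> V)" "card (D \<inter> U) \<le> card (D' \<inter> U)"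
    using cutD'(2) chain_finite[OF chU] chain_finite[OF chV] by (intro card_mono; blast)+
  then show "p0 < p1" using height_D' pq by (simp add: p0_def q0_def p1_def)
qed

lemma inD'_U: "x \<in> U \<Longrightarrow> x \<in> D' \<longleftrightarrow> rk U x \<le> p1"
  unfolding p1_def by (rule cut_rk[OF chU _ cutD'(1)]) (auto simp: X_def)

lemma inD'_V: "x \<in> V \<Longrightarrow> x \<in> D' \<longleftrightarrow> rk V x + 1 \<le> p1 + x0"
  using cut_rk[OF chV _ cutD'(1), of x] height_D' by (auto simp: X_def)

text \<open>An element of \<open>V\<close> one column right of the last element of \<open>U\<close> in \<open>D'\<close> is not in \<open>D'\<close>, and is therefore
above that element.\<close>
lemma stop_at_end: "stop (p1 - p0 - 1)"
proof -
  obtain a where a: "a \<in> U" "rk U a = p1" using next_U[of p1] p1 by auto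
  have idx: "p0 + 1 + (p1 - p0 - 1) = p1" using p1(1) by simp
  have ala: "al a = p1 + x0" using al(6)[OF a(1)] a(2) p1(1) by simp
  have "a < b" if b: "b \<in> V" "al b = al a + 1" for b
  proof -
    have "b \<notin> D'"
    proof
      assume bD: "b \<in> D'"
      have "al b = (p1 + 1) + x0" using b(2) ala by simp
      from column_partner[OF XV[OF b(1)] _ this] p1(1)
      obtain c where c: "c \<in> U" "rk U c = p1 + 1" "al c = al b" by auto
      have "c \<notin> D'" using inD'_U[OF c(1)] c(2) by simp
      then have "b < c" using bD cutD'(1) XU[OF c(1)] unfolding cuts_def by blast
      then show False using al(3)[OF b(1) c(1)] c(3) by simp
    qed
    moreover have "a \<in> D'" using inD'_U[OF a(1)] a(2) by simp
    ultimately show ?thesis using cutD'(1) XV[OF b(1)] unfolding cuts_def by blast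
  qed
  then have "\<not> (\<exists>b\<in>V. al b = al a + 1 \<and> \<not> b > a)" by blast
  moreover have "A (r, p0 + 1 + (p1 - p0 - 1)) = Some a" unfolding idx array_U using a by simp
  ultimately show ?thesis unfolding stop_def by blast
qed

lemma not_stopE:
  assumes "\<not> stop s" "p0 + 1 + s \<le> m"
  obtains a b where "a \<in> U" "rk U a = p0 + 1 + s" "b \<in> V" "al b = q0 + s + 2" "\<not> a < b"
proof -
  obtain a where a: "a \<in> U" "rk U a = p0 + 1 + s" using next_U[of "p0 + 1 + s"] assms(2) by auto
  then have "A (r, p0 + 1 + s) = Some a" unfolding array_U by simp
  then obtain b where b: "b \<in> V" "al b = al a + 1" "\<not> a < b" using assms(1) unfolding stop_def by blast
  have "al a = p0 + 1 + s + x0" using al(6)[OF a(1)] a(2) by simp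
  then have "al b = q0 + s + 2" using b(2) pq(2) by simp
  then show ?thesis by (rule that[OF a b(1) _ b(3)])
qed

text \<open>Before the chain of moves stops, the elements of \<open>V\<close> beyond \<open>D\<close> fill the columns from \<open>q0 + 2\<close> on
without gaps, in the order of their ranks.\<close>
lemma staircase:
  assumes "1 \<le> i" "i \<le> t" "\<And>s. s < t \<Longrightarrow> \<not> stop s" "p0 + t \<le> m"
  shows "\<exists>b\<in>V. rk V b = q0 + i \<and> al b = q0 + i + 1 \<and> (\<forall>a\<in>U. rk U a = p0 + i \<longrightarrow> \<not> a < b)"
  using assms(1,2)
proof (induction i)
  case (Suc i)
  have ns: "\<not> stop i" "p0 + 1 + i \<le> m" using Suc.prems assms(3)[of i] assms(4) by simp_all
  obtain a b where a: "a \<in> U" "rk U a = p0 + 1 + i" and b: "b \<in> V" "al b = q0 + i + 2" "\<not> a < b"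
    by (rule not_stopE[OF ns])
  have free_col: "al c \<noteq> q0 + i + 1" if c: "c \<in> V" "rk V c = q0 + i + 1" for c
  proof (cases "i = 0")
    case True
    then show ?thesis using column_unpaired[OF c(1)] by simp
  next
    case False
    then obtain b' where b': "b' \<in> V" "rk V b' = q0 + i" "al b' = q0 + i + 1" using Suc by auto
    show ?thesis
    proof
      assume "al c = q0 + i + 1"
      then have "c = b'" using al_inj_V[OF c(1) b'(1)] b'(3) by simp
      then show False using c(2) b'(2) by simp
    qed
  qed
  have low: "q0 + i < rk V b"
  proof (cases "i = 0")
    case True
    have "b \<notin> D" using al(8)[of b] b(2) by auto
    then show ?thesis using inD_V[OF b(1)] True by simp
  next
    case False
    then obtain b' where b': "b' \<in> V" "rk V b' = q0 + i" "al b' = q0 + i + 1" using Suc by auto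
    have "b' \<noteq> b" "\<not> b < b'" using al(2)[OF b(1) b'(1)] b(2) b'(3) by auto
    then have "b' < b" using chV b(1) b'(1) unfolding is_chain_def by blast
    then show ?thesis using rk_less_iff[OF chV b'(1) b(1)] b'(2) by simp
  qed
  have "rk V b = q0 + i + 1"
  proof (rule ccontr)
    assume n: "rk V b \<noteq> q0 + i + 1"
    have "1 \<le> q0 + i + 1" "q0 + i + 1 \<le> card V" using low rk_bounds[OF chV b(1)] by linarith+
    then obtain c where c: "c \<in> V" "rk V c = q0 + i + 1" by (rule rk_obtain[OF chV])
    have "c < b" using rank_V_less[OF c(1) b(1)] c(2) low n by simp
    then have "al c < q0 + i + 2" using al(2)[OF c(1) b(1)] b(2) by simp
    then have "al c = q0 + i + 1" using al(4)[OF c(1)] c(2) by linarith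
    then show False using free_col[OF c] by simp
  qed
  moreover have "\<not> a' < b" if "a' \<in> U" "rk U a' = p0 + Suc i" for a'
    using b(3) rk_eq_iff[OF chU that(1) a(1)] that(2) a(2) by simp
  ultimately show ?case using b(1,2) by (intro bexI[of _ b]) simp_all
qed simp

text \<open>Where the chain of moves stops, a cut ends. Hence it cannot stop before \<open>D'\<close>.\<close>
lemma stop_cut:
  assumes t: "stop t" "\<And>s. s < t \<Longrightarrow> \<not> stop s" and tm: "p0 + t + 1 \<le> m"
  shows "{u \<in> U. rk U u \<le> p0 + t + 1} \<union> {v \<in> V. rk V v \<le> q0 + t} \<in> cuts X" (is ?cut)
    "D \<subset> {u \<in> U. rk U u \<le> p0 + t + 1} \<union> {v \<in> V. rk V v \<le> q0 + t}" (is ?after)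
proof -
  have st: "\<exists>b\<in>V. rk V b = q0 + t \<and> al b = q0 + t + 1 \<and> (\<forall>a\<in>U. rk U a = p0 + t \<longrightarrow> \<not> a < b)" if "1 \<le> t"
    by (rule staircase[OF that order_refl t(2)]) (use tm in simp_all)
  have tn: "q0 + t \<le> n"
  proof (cases "t = 0")
    case True
    then show ?thesis using q0n by simp
  next
    case False
    then obtain b where "b \<in> V" "rk V b = q0 + t" using st by auto
    then show ?thesis using rk_bounds[OF chV, of b] by (simp add: n_def)
  qed
  have uv: "u < v" if u: "u \<in> U" "rk U u = p0 + t + 1" and v: "v \<in> V" "rk V v = Suc (q0 + t)" for u v
  proof -
    have ne: "al v \<noteq> q0 + t + 1"
    proof (cases "t = 0")
      case True
      then show ?thesis using column_unpaired[OF v(1)] by simp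
    next
      case False
      then obtain b where b: "b \<in> V" "rk V b = q0 + t" "al b = q0 + t + 1" using st by auto
      then show ?thesis using al_inj_V[OF v(1) b(1)] v(2) by auto
    qed
    have ge: "q0 + t + 2 \<le> al v" using al(4)[OF v(1)] v(2) ne by linarith
    have alu: "al u = q0 + t + 1" using al(6)[OF u(1)] u(2) pq by simp
    show ?thesis
    proof (cases "al v = q0 + t + 2")
      case True
      obtain a where a: "A (r, p0 + 1 + t) = Some a" and none: "\<not> (\<exists>b\<in>V. al b = al a + 1 \<and> \<not> b > a)"
        using t(1) unfolding stop_def by blast
      have "a = u" using a rk_eq_iff[OF chU _ u(1), of a] u(2) unfolding array_U by simp
      then show ?thesis using none v(1) True alu by auto
    next
      case False
      then have "rk U u + x0 + 2 \<le> al v" using ge u(2) pq by linarith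
      then show ?thesis using far_above[OF u(1) _ v(1)] u(2) by simp
    qed
  qed
  have vu: "v < u" if u: "u \<in> U" "rk U u = Suc (p0 + t + 1)" and v: "v \<in> V" "rk V v = q0 + t" for u v
  proof (cases "t = 0")
    case True
    then have "v \<in> D" "u \<notin> D" using inD_V[OF v(1)] inD_U[OF u(1)] u(2) v(2) by simp_all
    then show ?thesis using D_below XU[OF u(1)] by blast
  next
    case False
    then obtain b where b: "b \<in> V" "rk V b = q0 + t" and nb: "\<forall>a\<in>U. rk U a = p0 + t \<longrightarrow> \<not> a < b" using st by auto
    have vb: "v = b" using rk_eq_iff[OF chV v(1) b(1)] v(2) b(2) by simp
    obtain a where a: "a \<in> U" "rk U a = p0 + t" using next_U[of "p0 + t"] False tm by auto
    obtain c where c: "c \<in> U" "rk U c = p0 + t + 1" using next_U[of "p0 + t + 1"] tm by auto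
    have "a < c" "c < u" using rank_U_less[OF a(1) c(1)] rank_U_less[OF c(1) u(1)] a(2) c(2) u(2) by simp_all
    from free[OF UP[OF XU[OF a(1)]] UP[OF XU[OF c(1)]] UP[OF XU[OF u(1)]] UP[OF XV[OF v(1)]] this]
    show ?thesis using nb a vb by blast
  qed
  show ?cut ?after
    by (rule rank_cut_beyond_D(1,2)[of "p0 + t + 1" "q0 + t"]; use tm tn uv vu in simp)+
qed

lemma first_stop: "(LEAST t. stop t) = p1 - p0 - 1"
proof -
  define t where "t = (LEAST t. stop t)"
  have st: "stop t" unfolding t_def by (rule LeastI[of stop, OF stop_at_end])
  have before: "\<not> stop s" if "s < t" for s using not_less_Least[of s stop] that unfolding t_def by simp
  have le: "t \<le> p1 - p0 - 1" unfolding t_def by (rule Least_le[of stop, OF stop_at_end])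
  have "\<not> t < p1 - p0 - 1"
  proof
    assume lt: "t < p1 - p0 - 1"
    have tm: "p0 + t + 1 \<le> m" using lt p1(2) by linarith
    let ?E = "{u \<in> U. rk U u \<le> p0 + t + 1} \<union> {v \<in> V. rk V v \<le> q0 + t}"
    have "D' \<subseteq> ?E" using cutD'(3)[OF stop_cut(1)[OF st before tm]] stop_cut(2)[OF st before tm] by blast
    moreover obtain a where a: "a \<in> U" "rk U a = p1" using next_U[of p1] p1 by auto
    ultimately have "a \<in> ?E" using inD'_U[OF a(1)] by auto
    then have "p1 \<le> p0 + t + 1" using a UV by auto
    then show False using lt by linarith
  qed
  then show ?thesis using le unfolding t_def by linarith
qed

lemma steps_before_end:
  assumes "1 \<le> i" "i \<le> p1 - p0 - 1"
  shows "\<exists>b\<in>V. rk V b = q0 + i \<and> al b = q0 + i + 1"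
proof -
  have "\<not> stop s" if "s < p1 - p0 - 1" for s
    using not_less_Least[of s stop] that unfolding first_stop by blast
  moreover have "p0 + (p1 - p0 - 1) \<le> m" using p1 by linarith
  ultimately show ?thesis using staircase[OF assms] by blast
qed

lemma first_unpaired: "(LEAST p. \<exists>a. A (r, p) = Some a \<and> \<not> (\<exists>b\<in>V. al b = al a)) = p0 + 1"
proof (rule Least_equality)
  obtain a where a: "a \<in> U" "rk U a = p0 + 1" using next_U[of "p0 + 1"] p0_less by auto
  have "al a = q0 + 1" using al(6)[OF a(1)] a(2) pq by simp
  then show "\<exists>a. A (r, p0 + 1) = Some a \<and> \<not> (\<exists>b\<in>V. al b = al a)"
    using a column_unpaired unfolding array_U by (intro exI[of _ a]) auto
next
  fix p assume "\<exists>a. A (r, p) = Some a \<and> \<not> (\<exists>b\<in>V. al b = al a)"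
  then obtain a where a: "a \<in> U" "rk U a = p" and un: "\<not> (\<exists>b\<in>V. al b = al a)" unfolding array_U by blast
  show "p0 + 1 \<le> p"
  proof (rule ccontr)
    assume "\<not> ?thesis"
    then have "a \<in> D" using inD_U[OF a(1)] a(2) by simp
    then show False using columns_of_D[OF al(5)[OF a(1)] al(8)] un by blast
  qed
qed

lemma moved_down: "{a. \<exists>k\<in>{p0 + 1..p1}. A (r, k) = Some a} = (D' - D) \<inter> U"
proof (rule set_eqI)
  fix a
  have "a \<in> {a. \<exists>k\<in>{p0 + 1..p1}. A (r, k) = Some a} \<longleftrightarrow> a \<in> U \<and> rk U a \<in> {p0 + 1..p1}"
    unfolding array_U by blast
  also have "\<dots> \<longleftrightarrow> a \<in> (D' - D) \<inter> U" using inD_U[of a] inD'_U[of a] by auto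
  finally show "a \<in> {a. \<exists>k\<in>{p0 + 1..p1}. A (r, k) = Some a} \<longleftrightarrow> a \<in> (D' - D) \<inter> U" .
qed

lemma moved_up: "{b \<in> V. \<exists>a\<in>(D' - D) \<inter> U. al b = al a} = (D' - D) \<inter> V"
proof (rule set_eqI, rule iffI)
  fix b assume "b \<in> {b \<in> V. \<exists>a\<in>(D' - D) \<inter> U. al b = al a}"
  then obtain a where b: "b \<in> V" and a: "a \<in> U" "a \<in> D'" "a \<notin> D" "al b = al a" by blast
  have rka: "p0 < rk U a" "rk U a \<le> p1" using inD_U[OF a(1)] inD'_U[OF a(1)] a(2,3) by simp_all
  have alb: "al b = rk U a + x0" using al(6)[OF a(1) rka(1)] a(4) by simp
  then have "rk U a \<noteq> p0 + 1" using column_unpaired[OF b] pq by auto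
  then have i: "1 \<le> rk U a - p0 - 1" "rk U a - p0 - 1 \<le> p1 - p0 - 1" using rka by linarith+
  obtain c where c: "c \<in> V" "rk V c = q0 + (rk U a - p0 - 1)" "al c = q0 + (rk U a - p0 - 1) + 1"
    using steps_before_end[OF i] by blast
  have "al c = al b" using c(3) alb pq i by linarith
  then have "b = c" using al_inj_V[OF b c(1)] by simp
  then have "rk V b = q0 + (rk U a - p0 - 1)" using c(2) by simp
  then have "q0 < rk V b" "rk V b + 1 \<le> p1 + x0" using i rka pq by linarith+
  then show "b \<in> (D' - D) \<inter> V" using inD_V[OF b] inD'_V[OF b] b by simp
next
  fix b assume "b \<in> (D' - D) \<inter> V"
  then have b: "b \<in> V" and rkb: "q0 < rk V b" "rk V b + 1 \<le> p1 + x0"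
    using inD_V[of b] inD'_V[of b] by auto
  have i: "1 \<le> rk V b - q0" "rk V b - q0 \<le> p1 - p0 - 1" using rkb pq by linarith+
  obtain c where c: "c \<in> V" "rk V c = q0 + (rk V b - q0)" "al c = q0 + (rk V b - q0) + 1"
    using steps_before_end[OF i] by blast
  have "b = c" using rk_eq_iff[OF chV b c(1)] c(2) rkb by simp
  then have "al b = q0 + (rk V b - q0) + 1" using c(3) by simp
  then have alb: "al b = rk V b + 1" using rkb by linarith
  define k where "k = rk V b + 1 - x0"
  have k: "p0 < k" "k \<le> p1" "rk V b + 1 = k + x0" using rkb pq unfolding k_def by linarith+
  obtain a where a: "a \<in> U" "rk U a = k" using next_U[of k] k p1 by auto
  have "al a = al b" using al(6)[OF a(1)] a(2) k alb by simp
  moreover have "a \<in> (D' - D) \<inter> U" using inD_U[OF a(1)] inD'_U[OF a(1)] a k by simp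
  ultimately have "\<exists>a\<in>(D' - D) \<inter> U. al b = al a" by (intro bexI[of _ a]) simp_all
  then show "b \<in> {b \<in> V. \<exists>a\<in>(D' - D) \<inter> U. al b = al a}" using b by blast
qed

lemma phi_positive: "0 < phi (coloring A) r"
  using size_strict pq unfolding phi_def min_height_eq total_def U_color_class[symmetric] V_color_class[symmetric] m_def n_def by linarith

text \<open>With all data of the lowering operator identified, it exchanges \<open>(D' - D) \<inter> U\<close> and \<open>(D' - D) \<inter> V\<close>.\<close>
lemma lowering_eq: "lowering r A = Some (array_of (low r (coloring A)))"
proof -
  let ?K = "D' - D" and ?\<kappa> = "flip r (D' - D) (coloring A)"
  obtain a where a: "a \<in> U" "rk U a = p0 + 1" using next_U[of "p0 + 1"] p0_less by auto
  have "al a = q0 + 1" using al(6)[OF a(1)] a(2) pq by simp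
  then have some: "\<not> (\<forall>a\<in>U. \<exists>b\<in>V. al b = al a)" using a(1) column_unpaired by metis
  have end_eq: "p0 + 1 + (p1 - p0 - 1) = p1" using p1(1) by linarith
  have "lowering r A = Some (exchange r (?K \<inter> U) (?K \<inter> V) A)"
    unfolding lowering_def Let_def U_def[symmetric] V_def[symmetric] if_not_P[OF some]
      first_unpaired first_stop[unfolded stop_def] end_eq moved_down moved_up ..
  also have "exchange r (?K \<inter> U) (?K \<inter> V) A = array_of ?\<kappa>"
  proof (rule exchange_eq[OF A])
    have low: "low r (coloring A) = ?\<kappa>" by (rule low_eq[OF pair])
    show "chain_coloring ?\<kappa>" using low_string(1)[OF chain_coloring_array[OF A] phi_positive] unfolding low .
    show "?\<kappa> \<in> P \<rightarrow>\<^sub>E {1..}"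
    proof (rule PiE_I)
      fix x assume "x \<in> P"
      then have "coloring A x \<in> {1..}" using coloring_PiE[OF A] by blast
      then show "?\<kappa> x \<in> {1..}" using r unfolding flip_def by simp
    next
      fix x assume x: "x \<notin> P"
      then have "x \<notin> ?K" using D'_X UP by blast
      then show "?\<kappa> x = undefined" using x by (simp add: flip_def coloring_def)
    qed
    show "color_class ?\<kappa> r = row A r - ?K \<inter> U \<union> ?K \<inter> V"
      unfolding U_def[symmetric] U_color_class V_color_class by (auto simp: color_class_def flip_def split: if_splits)
    show "color_class ?\<kappa> (r + 1) = row A (r + 1) - ?K \<inter> V \<union> ?K \<inter> U"
      unfolding V_def[symmetric] U_color_class V_color_class by (auto simp: color_class_def flip_def split: if_splits)
    show "color_class ?\<kappa> i = row A i" if "i \<noteq> r" "i \<noteq> r + 1" for i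
      unfolding row_eq_color_class[OF A] using that by (auto simp: color_class_def flip_def split: if_splits)
  qed
  finally show ?thesis by (simp only: low_eq[OF pair])
qed

end

lemma (in free_order) lowering_eq_low:
  assumes A: "A \<in> P_arrays P" and r: "1 \<le> r" and phi: "0 < phi (coloring A) r"
  shows "lowering r A = Some (array_of (low r (coloring A)))"
proof -
  obtain D D' where p: "low_pair (coloring A) r D D'" by (rule low_pair_exists[OF phi])
  interpret lowerable P A r D D'
    by unfold_locales (rule A r coversD(1)[OF low_pairD(1)[OF p]] low_pairD(2)[OF p] low_pairD(3)[OF p] p; assumption)+
  show ?thesis by (rule lowering_eq)
qed

text \<open>If no lowering step remains in the string, then the set of all elements in the two rows is the last
lowest cut.\<close>
lemma (in free_order) lowering_eq_None:
  assumes A: "A \<in> P_arrays P" and r: "1 \<le> r" and phi: "\<not> 0 < phi (coloring A) r"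
  shows "lowering r A = None"
proof -
  let ?X = "two_rows (coloring A) r"
  have h: "height (coloring A) r ?X = min_height (coloring A) r"
    using phi phi_nonneg[of "coloring A" r] by (simp add: phi_def total_height)
  have last: "min_height (coloring A) r < height (coloring A) r E" if "E \<in> cuts ?X" "?X \<subset> E" for E
    using that unfolding cuts_def by blast
  interpret aligned P A r ?X
    by unfold_locales (rule A r cuts_self h last; assumption)+
  show ?thesis by (rule lowering_none[OF X_two_rows[symmetric]])
qed

section \<open>Semistandard tableaux as chain colorings\<close>

lemma (in three_one_free) tableauI:
  assumes "chain_coloring \<kappa>" "\<And>r D. 1 \<le> r \<Longrightarrow> D \<in> cuts (two_rows \<kappa> r) \<Longrightarrow> 0 \<le> height \<kappa> r D"
  shows "tableau \<kappa>"
proof (rule ccontr)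
  assume "\<not> tableau \<kappa>"
  then obtain c r where b: "canonical_failure \<kappa> c r" by (rule canonical_failure_exists)
  obtain D where D: "negcut \<kappa> r D" by (rule canonical_failure_negcut[OF assms(1) b])
  show False using assms(2)[OF canonical_failureD(1)[OF b] negcutD(1)[OF D]] negcutD(2)[OF D] by simp
qed

lemma (in three_one_free) tableau_height:
  assumes "chain_coloring \<kappa>" "tableau \<kappa>" "1 \<le> r" "D \<in> cuts (two_rows \<kappa> r)"
  shows "0 \<le> height \<kappa> r D"
proof (rule ccontr)
  assume "\<not> ?thesis"
  then have "fails \<kappa> r (card (D \<inter> color_class \<kappa> r) + 1)" by (intro cut_fails[OF assms(1,4)]) simp
  then show False using assms(2,3) unfolding tableau_def by blast
qed

locale shape =
  fixes l :: "nat \<Rightarrow> nat"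
  assumes l: "is_partition l"
begin

lemma l_decreasing:
  assumes "1 \<le> i" "i \<le> k"
  shows "l k \<le> l i"
  using assms(2)
proof (induction k rule: dec_induct)
  case (step k)
  have "1 \<le> k" using assms(1) step(1) by linarith
  then have "l (k + 1) \<le> l k" using l unfolding is_partition_def by blast
  then show ?case using step(3) by simp
qed simp

lemma cell: "(i, j) \<in> diagram l \<longleftrightarrow> 1 \<le> i \<and> 1 \<le> j \<and> j \<le> l i"
  by (simp add: diagram_def)

lemma cell_up: "(k, j) \<in> diagram l \<Longrightarrow> 1 \<le> i \<Longrightarrow> i \<le> k \<Longrightarrow> (i, j) \<in> diagram l"
  using l_decreasing[of i k] unfolding cell by linarith

lemma cell_left: "(i, k) \<in> diagram l \<Longrightarrow> 1 \<le> j \<Longrightarrow> j \<le> k \<Longrightarrow> (i, j) \<in> diagram l"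
  unfolding cell by linarith

lemma finite_diagram: "finite (diagram l)"
proof -
  have "finite {i. l i \<noteq> 0}" using l by (simp add: is_partition_def)
  then have "finite (SIGMA i:{i. l i \<noteq> 0}. {1..l i})" by (rule finite_SigmaI) simp
  moreover have "diagram l \<subseteq> (SIGMA i:{i. l i \<noteq> 0}. {1..l i})" by (auto simp: diagram_def)
  ultimately show ?thesis by (rule finite_subset[rotated])
qed

end

sublocale shape \<subseteq> three_one_free "diagram l" "\<lambda>c d. snd d < snd c"
proof
  show "finite (diagram l)" by (rule finite_diagram)
  show "\<not> snd x < snd x" for x :: "nat \<times> nat" by simp
  show "snd z < snd x" if "snd y < snd x" "snd z < snd y" for x y z :: "nat \<times> nat" using that by linarith
  show "snd w < snd x \<or> snd z < snd w" if "snd y < snd x" "snd z < snd y" for x y z w :: "nat \<times> nat" using that by linarith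
qed

context shape
begin

lemma ssytD:
  assumes "T \<in> ssyt l"
  shows "T \<in> diagram l \<rightarrow>\<^sub>E {1..}"
    "(i, j) \<in> diagram l \<Longrightarrow> (i, j + 1) \<in> diagram l \<Longrightarrow> T (i, j) \<le> T (i, j + 1)"
    "(i, j) \<in> diagram l \<Longrightarrow> (i + 1, j) \<in> diagram l \<Longrightarrow> T (i, j) < T (i + 1, j)"
  using assms unfolding ssyt_def by blast+

lemma row_weak:
  assumes T: "T \<in> ssyt l" and k: "(i, k) \<in> diagram l" and j: "1 \<le> j" "j \<le> k"
  shows "T (i, j) \<le> T (i, k)"
  using j(2) k
proof (induction k rule: dec_induct)
  case (step k)
  have "1 \<le> k" using j(1) step(1) by linarith
  then have c: "(i, k) \<in> diagram l" by (rule cell_left[OF step.prems]) simp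
  have "T (i, k) \<le> T (i, k + 1)" by (rule ssytD(2)[OF T c]) (use step.prems in simp)
  then show ?case using step.IH[OF c] by simp
qed simp

lemma column_strict:
  assumes T: "T \<in> ssyt l" and k: "(k, j) \<in> diagram l" and i: "1 \<le> i" "i < k"
  shows "T (i, j) < T (k, j)"
proof -
  have "Suc i \<le> k" using i(2) by simp
  then show ?thesis using k
  proof (induction k rule: dec_induct)
    case base
    have c: "(i, j) \<in> diagram l" by (rule cell_up[OF base i(1)]) simp
    have "T (i, j) < T (i + 1, j)" by (rule ssytD(3)[OF T c]) (use base in simp)
    then show ?case by simp
  next
    case (step k)
    have "1 \<le> k" using step(1) by linarith
    then have c: "(k, j) \<in> diagram l" by (rule cell_up[OF step.prems]) simp
    have "T (k, j) < T (k + 1, j)" by (rule ssytD(3)[OF T c]) (use step.prems in simp)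
    then show ?case using step.IH[OF c] by simp
  qed
qed

lemma same_column:
  assumes T: "T \<in> ssyt l" and x: "x \<in> diagram l" and y: "y \<in> diagram l" and eq: "T x = T y" "snd x = snd y"
  shows "x = y"
proof -
  obtain i j k where ij: "x = (i, j)" "y = (k, j)" using eq(2) by (cases x; cases y) simp
  have p: "1 \<le> i" "1 \<le> k" using x y unfolding ij cell by blast+
  have "\<not> i < k" "\<not> k < i"
    using column_strict[OF T y[unfolded ij] p(1)] column_strict[OF T x[unfolded ij] p(2)] eq(1) unfolding ij by auto
  then show ?thesis unfolding ij by simp
qed

lemma chain_coloring_ssyt:
  assumes "T \<in> ssyt l" shows "chain_coloring T"
  unfolding chain_coloring_def is_chain_def
proof (intro allI conjI ballI)
  fix r show "color_class T r \<subseteq> diagram l" by (auto simp: color_class_def)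
  fix x y assume "x \<in> color_class T r" "y \<in> color_class T r"
  then have "x \<in> diagram l" "y \<in> diagram l" "T x = T y" by (simp_all add: color_class_def)
  then show "x = y \<or> snd y < snd x \<or> snd x < snd y" using same_column[OF assms] by (meson linorder_less_linear)
qed

definition from_column :: "((nat \<times> nat) \<Rightarrow> nat) \<Rightarrow> nat \<Rightarrow> nat \<Rightarrow> (nat \<times> nat) set" where
  "from_column T r j = {c \<in> two_rows T r. j \<le> snd c}"

definition column_cells :: "((nat \<times> nat) \<Rightarrow> nat) \<Rightarrow> nat \<Rightarrow> nat \<Rightarrow> (nat \<times> nat) set" where
  "column_cells T r j = {c \<in> two_rows T r. snd c = j}"

lemma from_column_cut: "from_column T r j \<in> cuts (two_rows T r)"
  unfolding cuts_def from_column_def by auto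

lemma from_column_height: "height T r (from_column T r j) = height T r (from_column T r (j + 1)) + height T r (column_cells T r j)"
proof -
  have sub: "from_column T r (j + 1) \<subseteq> from_column T r j" by (auto simp: from_column_def)
  have "from_column T r j - from_column T r (j + 1) = column_cells T r j"
    by (auto simp: from_column_def column_cells_def)
  then show ?thesis using height_split[OF sub, of T r] by simp
qed

lemma in_two_rows: "c \<in> two_rows T r \<longleftrightarrow> c \<in> diagram l \<and> (T c = r \<or> T c = Suc r)"
  by (auto simp: two_rows_def color_class_def)

text \<open>The cuts are the unions of final columns, because cells are comparable unless they share a column.\<close>
lemma covers_column:
  assumes c: "covers (two_rows T r) D D'"
  obtains j where "D = from_column T r (j + 1)" "D' = from_column T r j" "D' - D = column_cells T r j"
proof -
  note c = coversD[OF c]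
  let ?X = "two_rows T r"
  obtain x where x: "x \<in> D'" "x \<notin> D" using c(3) by blast
  have X: "D \<subseteq> ?X" "D' \<subseteq> ?X" using c(1,2) unfolding cuts_def by blast+
  define j where "j = snd x"
  have "D' \<subseteq> from_column T r j"
  proof -
    have "x \<in> from_column T r j" using x X unfolding from_column_def j_def by blast
    then show ?thesis using c(4)[OF from_column_cut, of j] x(2) by blast
  qed
  moreover have "from_column T r j \<subseteq> D'"
  proof
    fix y assume y: "y \<in> from_column T r j"
    show "y \<in> D'"
    proof (rule ccontr)
      assume "y \<notin> D'"
      then have "snd y < snd x" using c(2) x(1) y unfolding cuts_def from_column_def by blast
      then show False using y unfolding from_column_def j_def by simp
    qed
  qed
  ultimately have D': "D' = from_column T r j" by (rule subset_antisym)
  have "from_column T r (j + 1) \<subseteq> D"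
  proof -
    have "x \<notin> from_column T r (j + 1)" unfolding from_column_def j_def by simp
    then show ?thesis using c(4)[OF from_column_cut, of "j + 1"] x(1) by blast
  qed
  moreover have "D \<subseteq> from_column T r (j + 1)"
  proof
    fix y assume y: "y \<in> D"
    have "x \<in> ?X - D" using x X by blast
    then have "snd x < snd y" using c(1) y unfolding cuts_def by blast
    then show "y \<in> from_column T r (j + 1)" using X(1) y unfolding from_column_def j_def by auto
  qed
  ultimately have D: "D = from_column T r (j + 1)" by (rule subset_antisym[rotated])
  have "D' - D = column_cells T r j" unfolding D D' by (auto simp: from_column_def column_cells_def)
  then show ?thesis by (rule that[OF D D'])
qed

lemma column_color_class_single:
  assumes T: "T \<in> ssyt l" and x: "x \<in> column_cells T r j \<inter> color_class T s"
  shows "column_cells T r j \<inter> color_class T s = {x}"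
proof (rule set_eqI, rule iffI)
  fix y assume y: "y \<in> column_cells T r j \<inter> color_class T s"
  have "y = x" by (rule same_column[OF T]) (use x y in \<open>simp_all add: column_cells_def color_class_def\<close>)
  then show "y \<in> {x}" by simp
qed (use x in simp)

lemma column_color_class_card:
  assumes T: "T \<in> ssyt l"
  shows "card (column_cells T r j \<inter> color_class T s) \<le> 1"
proof (cases "column_cells T r j \<inter> color_class T s = {}")
  case False
  then obtain x where "x \<in> column_cells T r j \<inter> color_class T s" by blast
  from column_color_class_single[OF T this] show ?thesis by simp
qed simp

text \<open>The colors \<open>s\<close> and \<open>s'\<close> are \<open>r\<close> and \<open>r + 1\<close> in either order, so that the lemma applies to lowering
and to raising.\<close>
lemma column_single:
  assumes T: "T \<in> ssyt l" and s: "s = r \<and> s' = Suc r \<or> s = Suc r \<and> s' = r"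
    and h: "int (card (column_cells T r j \<inter> color_class T s)) - int (card (column_cells T r j \<inter> color_class T s')) = 1"
  obtains i where "column_cells T r j = {(i, j)}" "(i, j) \<in> diagram l" "T (i, j) = s"
proof -
  let ?C = "column_cells T r j"
  have c: "card (?C \<inter> color_class T s) = 1" "card (?C \<inter> color_class T s') = 0" using h column_color_class_card[OF T, of r j s] by linarith+
  obtain x where x: "?C \<inter> color_class T s = {x}" using c(1) by (rule card_1_singletonE)
  have "?C \<inter> color_class T s' = {}" using c(2) finite_color_class by (simp add: card_eq_0_iff)
  moreover have "?C \<subseteq> color_class T s \<union> color_class T s'" using s by (auto simp: column_cells_def two_rows_def)
  ultimately have C: "?C = {x}" using x by blast
  have "snd x = j" using C by (auto simp: column_cells_def)
  then obtain i where i: "x = (i, j)" by (cases x) simp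
  have "x \<in> color_class T s" using x by blast
  then show ?thesis using that[of i] C unfolding i color_class_def by simp
qed

lemma ssyt_update:
  assumes T: "T \<in> ssyt l" and c: "(i, j) \<in> diagram l" and v: "1 \<le> v"
    and right: "(i, j + 1) \<in> diagram l \<Longrightarrow> v \<le> T (i, j + 1)"
    and left: "1 < j \<Longrightarrow> T (i, j - 1) \<le> v"
    and down: "(i + 1, j) \<in> diagram l \<Longrightarrow> v < T (i + 1, j)"
    and up: "1 < i \<Longrightarrow> T (i - 1, j) < v"
  shows "T((i, j) := v) \<in> ssyt l"
proof -
  let ?T = "T((i, j) := v)"
  have "?T \<in> diagram l \<rightarrow>\<^sub>E {1..}"
  proof (rule PiE_I)
    fix x assume "x \<in> diagram l"
    then show "?T x \<in> {1..}" using ssytD(1)[OF T] v by (cases "x = (i, j)") auto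
  next
    fix x assume "x \<notin> diagram l"
    then show "?T x = undefined" using PiE_arb[OF ssytD(1)[OF T]] c by (cases "x = (i, j)") simp_all
  qed
  moreover have "?T (a, b) \<le> ?T (a, b + 1)" if ab: "(a, b) \<in> diagram l" "(a, b + 1) \<in> diagram l" for a b
  proof -
    have b1: "1 \<le> b" using ab(1) unfolding cell by blast
    consider "(a, b) = (i, j)" | "(a, b + 1) = (i, j)" | "(a, b) \<noteq> (i, j)" "(a, b + 1) \<noteq> (i, j)" by blast
    then show ?thesis
    proof cases
      case 1
      then show ?thesis using right ab(2) by simp
    next
      case 2
      then have "a = i" "b = j - 1" "1 < j" using b1 by auto
      then show ?thesis using left by simp
    next
      case 3
      then show ?thesis unfolding fun_upd_other[OF 3(1)] fun_upd_other[OF 3(2)] by (intro ssytD(2)[OF T ab])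
    qed
  qed
  moreover have "?T (a, b) < ?T (a + 1, b)" if ab: "(a, b) \<in> diagram l" "(a + 1, b) \<in> diagram l" for a b
  proof -
    have a1: "1 \<le> a" using ab(1) unfolding cell by blast
    consider "(a, b) = (i, j)" | "(a + 1, b) = (i, j)" | "(a, b) \<noteq> (i, j)" "(a + 1, b) \<noteq> (i, j)" by blast
    then show ?thesis
    proof cases
      case 1
      then show ?thesis using down ab(2) by simp
    next
      case 2
      then have "b = j" "a = i - 1" "1 < i" using a1 by auto
      then show ?thesis using up by simp
    next
      case 3
      then show ?thesis unfolding fun_upd_other[OF 3(1)] fun_upd_other[OF 3(2)] by (intro ssytD(3)[OF T ab])
    qed
  qed
  ultimately show ?thesis unfolding ssyt_def by blast
qed

text \<open>The only danger is an entry \<open>r\<close> to the right of the changed cell. Then the column to the right has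
an entry \<open>r\<close> but no entry \<open>r + 1\<close>, as the latter would force an entry \<open>r + 1\<close> below the changed
cell. Without that column the cut would be lower than the lowest one.\<close>
lemma ssyt_low:
  assumes T: "T \<in> ssyt l" and phi: "0 < phi T r"
  shows "low r T \<in> ssyt l"
proof -
  obtain D D' where p: "low_pair T r D D'" by (rule low_pair_exists[OF phi])
  note lp = low_pairD[OF p]
  obtain j where D: "D = from_column T r (j + 1)" and D': "D' = from_column T r j" and K: "D' - D = column_cells T r j"
    by (rule covers_column[OF lp(1)])
  have "height T r D' - height T r D \<le> 1" using covers_step[OF chain_coloring_ssyt[OF T] lp(1)] by linarith
  moreover have "height T r D < height T r D'" using lp(3)[OF coversD(2,3)[OF lp(1)]] lp(2) by simp
  ultimately have h: "height T r (column_cells T r j) = 1" using from_column_height[of T r j] unfolding D D' by linarith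
  have "r = r \<and> Suc r = Suc r \<or> r = Suc r \<and> Suc r = r" by simp
  from column_single[OF T this h[unfolded height_def]]
  obtain i where C: "column_cells T r j = {(i, j)}" and c: "(i, j) \<in> diagram l" and Tr: "T (i, j) = r" .
  have low: "low r T = T((i, j) := Suc r)"
    unfolding low_eq[OF p] K C by (rule ext) (simp add: flip_def Tr)
  have i1: "1 \<le> i" "1 \<le> j" using c unfolding cell by blast+
  have nor: "T (k, j) \<noteq> Suc r" if "(k, j) \<in> diagram l" for k
  proof
    assume s: "T (k, j) = Suc r"
    then have "(k, j) \<in> column_cells T r j" using that by (simp add: column_cells_def in_two_rows)
    then show False using C s Tr by simp
  qed
  show ?thesis
    unfolding low
  proof (rule ssyt_update[OF T c])
    show "Suc r \<le> T (i, j + 1)" if R: "(i, j + 1) \<in> diagram l"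
    proof (rule ccontr)
      assume "\<not> ?thesis"
      then have eq: "T (i, j + 1) = r" using ssytD(2)[OF T c R] Tr by simp
      let ?C = "column_cells T r (j + 1)"
      have mem: "(i, j + 1) \<in> ?C \<inter> color_class T r" using R eq by (simp add: column_cells_def in_two_rows color_class_def)
      have "?C \<inter> color_class T (Suc r) = {}"
      proof (rule ccontr)
        assume "?C \<inter> color_class T (Suc r) \<noteq> {}"
        then obtain y where y: "y \<in> ?C \<inter> color_class T (Suc r)" by blast
        obtain k where k: "y = (k, j + 1)" using y by (cases y) (simp add: column_cells_def)
        have yd: "(k, j + 1) \<in> diagram l" "T (k, j + 1) = Suc r" using y unfolding k by (simp_all add: color_class_def)
        have k1: "1 \<le> k" using yd(1) unfolding cell by blast
        have "\<not> k < i" using column_strict[OF T R k1] eq yd(2) by auto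
        moreover have "k \<noteq> i" using eq yd(2) by auto
        ultimately have ik: "i < k" by simp
        have kj: "(k, j) \<in> diagram l" by (rule cell_left[OF yd(1) i1(2)]) simp
        have "T (i, j) < T (k, j)" by (rule column_strict[OF T kj i1(1) ik])
        moreover have "T (k, j) \<le> T (k, j + 1)" by (rule ssytD(2)[OF T kj yd(1)])
        ultimately have "T (k, j) = Suc r" using Tr yd(2) by simp
        then show False using nor[OF kj] by simp
      qed
      then have "height T r ?C = 1" unfolding height_def column_color_class_single[OF T mem] by simp
      then have "height T r (from_column T r (j + 1 + 1)) < min_height T r"
        using from_column_height[of T r "j + 1"] lp(2) unfolding D by linarith
      then show False using min_height_le[OF from_column_cut, of T r "j + 1 + 1"] by linarith
    qed
    show "T (i, j - 1) \<le> Suc r" if "1 < j"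
    proof -
      have "T (i, j - 1) \<le> T (i, j)" by (rule row_weak[OF T c]) (use that in linarith)+
      then show ?thesis using Tr by simp
    qed
    show "Suc r < T (i + 1, j)" if "(i + 1, j) \<in> diagram l"
      using ssytD(3)[OF T c that] nor[OF that] Tr by simp
    show "T (i - 1, j) < Suc r" if "1 < i"
    proof -
      have "T (i - 1, j) < T (i, j)" by (rule column_strict[OF T c]) (use that in linarith)+
      then show ?thesis using Tr by simp
    qed
  qed simp
qed

text \<open>The mirror image of the previous argument, with the column to the left.\<close>
lemma ssyt_raise:
  assumes T: "T \<in> ssyt l" and r: "1 \<le> r" and eps: "0 < eps T r"
  shows "raise r T \<in> ssyt l"
proof -
  obtain D D' where p: "raise_pair T r D D'" by (rule raise_pair_exists[OF eps])
  note rp = raise_pairD[OF p]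
  obtain j where D: "D = from_column T r (j + 1)" and D': "D' = from_column T r j" and K: "D' - D = column_cells T r j"
    by (rule covers_column[OF rp(1)])
  have "height T r D - height T r D' \<le> 1" using covers_step[OF chain_coloring_ssyt[OF T] rp(1)] by linarith
  moreover have "height T r D' < height T r D" using rp(3)[OF coversD(1,3)[OF rp(1)]] rp(2) by simp
  ultimately have h: "height T r (column_cells T r j) = -1" using from_column_height[of T r j] unfolding D D' by linarith
  have h': "int (card (column_cells T r j \<inter> color_class T (Suc r))) - int (card (column_cells T r j \<inter> color_class T r)) = 1"
    using h unfolding height_def by linarith
  have "Suc r = r \<and> r = Suc r \<or> Suc r = Suc r \<and> r = r" by simp
  from column_single[OF T this h']
  obtain i where C: "column_cells T r j = {(i, j)}" and c: "(i, j) \<in> diagram l" and Tr: "T (i, j) = Suc r" .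
  have raise: "raise r T = T((i, j) := r)"
    unfolding raise_eq[OF p] K C by (rule ext) (simp add: flip_def Tr)
  have i1: "1 \<le> i" "1 \<le> j" using c unfolding cell by blast+
  have nor: "T (k, j) \<noteq> r" if "(k, j) \<in> diagram l" for k
  proof
    assume s: "T (k, j) = r"
    then have "(k, j) \<in> column_cells T r j" using that by (simp add: column_cells_def in_two_rows)
    then show False using C s Tr by simp
  qed
  show ?thesis
    unfolding raise
  proof (rule ssyt_update[OF T c r])
    show "r \<le> T (i, j + 1)" if R: "(i, j + 1) \<in> diagram l"
      using ssytD(2)[OF T c R] Tr by simp
    show "T (i, j - 1) \<le> r" if j: "1 < j"
    proof (rule ccontr)
      assume n: "\<not> ?thesis"
      have j1: "1 \<le> j - 1" "j - 1 \<le> j" "j - 1 + 1 = j" using j by linarith+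
      have L: "(i, j - 1) \<in> diagram l" by (rule cell_left[OF c j1(1,2)])
      have "T (i, j - 1) \<le> T (i, j)" by (rule row_weak[OF T c j1(1,2)])
      then have eq: "T (i, j - 1) = Suc r" using n Tr by simp
      let ?C = "column_cells T r (j - 1)"
      have mem: "(i, j - 1) \<in> ?C \<inter> color_class T (Suc r)" using L eq by (simp add: column_cells_def in_two_rows color_class_def)
      have "?C \<inter> color_class T r = {}"
      proof (rule ccontr)
        assume "?C \<inter> color_class T r \<noteq> {}"
        then obtain y where y: "y \<in> ?C \<inter> color_class T r" by blast
        obtain k where k: "y = (k, j - 1)" using y by (cases y) (simp add: column_cells_def)
        have yd: "(k, j - 1) \<in> diagram l" "T (k, j - 1) = r" using y unfolding k by (simp_all add: color_class_def)
        have k1: "1 \<le> k" using yd(1) unfolding cell by blast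
        have "\<not> i < k" using column_strict[OF T yd(1) i1(1)] eq yd(2) by auto
        moreover have "k \<noteq> i" using eq yd(2) by auto
        ultimately have ki: "k < i" by simp
        have kj: "(k, j) \<in> diagram l" by (rule cell_up[OF c k1]) (use ki in simp)
        have "T (k, j) < T (i, j)" by (rule column_strict[OF T c k1 ki])
        moreover have "T (k, j - 1) \<le> T (k, j)" by (rule row_weak[OF T kj j1(1,2)])
        ultimately have "T (k, j) = r" using Tr yd(2) by simp
        then show False using nor[OF kj] by simp
      qed
      then have "height T r ?C = -1" unfolding height_def column_color_class_single[OF T mem] by simp
      then have "height T r (from_column T r (j - 1)) < min_height T r"
        using from_column_height[of T r "j - 1"] rp(2) unfolding D' j1(3) by linarith
      then show False using min_height_le[OF from_column_cut, of T r "j - 1"] by linarith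
    qed
    show "r < T (i + 1, j)" if "(i + 1, j) \<in> diagram l"
      using ssytD(3)[OF T c that] Tr by simp
    show "T (i - 1, j) < r" if i: "1 < i"
    proof -
      have i2: "1 \<le> i - 1" "i - 1 < i" using i by linarith+
      have "T (i - 1, j) < T (i, j)" by (rule column_strict[OF T c i2])
      moreover have "T (i - 1, j) \<noteq> r" by (rule nor[OF cell_up[OF c i2(1)]]) simp
      ultimately show ?thesis using Tr by simp
    qed
  qed
qed

lemma ssyt_closed: "1 \<le> r \<Longrightarrow> closed_at r (ssyt l)"
  unfolding closed_at_def using ssyt_low ssyt_raise by blast

definition superstandard :: "nat \<times> nat \<Rightarrow> nat" where
  "superstandard = (\<lambda>c\<in>diagram l. fst c)"

lemma superstandard_color_class: "c \<in> color_class superstandard s \<longleftrightarrow> c \<in> diagram l \<and> fst c = s"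
  by (cases "c \<in> diagram l") (simp_all add: color_class_def superstandard_def)

lemma superstandard_ssyt: "superstandard \<in> ssyt l"
  unfolding ssyt_def by (auto simp: superstandard_def cell)

text \<open>Moving a cell up by one row keeps its column, hence stays inside a cut.\<close>
lemma superstandard_tableau: "tableau superstandard"
proof (rule tableauI[OF chain_coloring_ssyt[OF superstandard_ssyt]])
  fix r D assume r: "1 \<le> r" and D: "D \<in> cuts (two_rows superstandard r)"
  let ?V = "D \<inter> color_class superstandard (Suc r)" and ?U = "D \<inter> color_class superstandard r"
  have "card ?V \<le> card ?U"
  proof (rule card_inj_on_le[where f = "\<lambda>c. (r, snd c)"])
    show "inj_on (\<lambda>c. (r, snd c)) ?V"
    proof (rule inj_onI)
      fix x y assume xy: "x \<in> ?V" "y \<in> ?V" "(r, snd x) = (r, snd y)"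
      have "fst x = Suc r" "fst y = Suc r" using xy(1,2) by (simp_all add: superstandard_color_class)
      then show "x = y" using xy(3) by (simp add: prod_eq_iff)
    qed
    show "(\<lambda>c. (r, snd c)) ` ?V \<subseteq> ?U"
    proof
      fix x assume "x \<in> (\<lambda>c. (r, snd c)) ` ?V"
      then obtain y where y: "y \<in> ?V" "x = (r, snd y)" by blast
      have yd: "y \<in> diagram l" "fst y = Suc r" using y(1) by (simp_all add: superstandard_color_class)
      then have "(Suc r, snd y) \<in> diagram l" by (metis prod.collapse)
      then have xd: "(r, snd y) \<in> diagram l" by (rule cell_up[OF _ r]) simp
      then have xU: "x \<in> color_class superstandard r" unfolding y(2) by (simp add: superstandard_color_class)
      have "x \<in> D"
      proof (rule ccontr)
        assume "x \<notin> D"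
        then have "x \<in> two_rows superstandard r - D" using xU by (simp add: two_rows_def)
        then have "snd x < snd y" using D y(1) unfolding cuts_def by blast
        then show False using y(2) by simp
      qed
      then show "x \<in> ?U" using xU by simp
    qed
    show "finite ?U" by simp
  qed
  then show "0 \<le> height superstandard r D" unfolding height_def by simp
qed

lemma entry_ge_row:
  assumes T: "T \<in> ssyt l" and c: "(i, j) \<in> diagram l"
  shows "i \<le> T (i, j)"
  using c
proof (induction i)
  case (Suc i)
  show ?case
  proof (cases "i = 0")
    case True
    then show ?thesis using ssytD(1)[OF T] Suc.prems by auto
  next
    case False
    then have c: "(i, j) \<in> diagram l" by (intro cell_up[OF Suc.prems]) simp_all
    have "T (i, j) < T (i + 1, j)" by (rule ssytD(3)[OF T c]) (use Suc.prems in simp)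
    then show ?thesis using Suc.IH[OF c] by simp
  qed
qed simp

lemma tableau_superstandard:
  assumes T: "T \<in> ssyt l" and tab: "tableau T"
  shows "T = superstandard"
proof (rule ccontr)
  assume ne: "T \<noteq> superstandard"
  \<comment> \<open>In the rightmost column with a wrong entry take the topmost wrong entry, \<open>k + 1\<close> say. No
      entry \<open>k\<close> lies weakly to the right of it, so that the cut of these columns is negative.\<close>
  define B where "B = {c \<in> diagram l. T c \<noteq> fst c}"
  have fB: "finite B" unfolding B_def using finite_diagram by simp
  have "B \<noteq> {}"
  proof
    assume "B = {}"
    have "T c = superstandard c" for c
    proof (cases "c \<in> diagram l")
      case True
      then have "T c = fst c" using \<open>B = {}\<close> unfolding B_def by blast
      then show ?thesis using True by (simp add: superstandard_def)
    next
      case False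
      then show ?thesis using PiE_arb[OF ssytD(1)[OF T] False] by (simp add: superstandard_def)
    qed
    then show False using ne by blast
  qed
  then obtain b0 where "b0 \<in> B" by blast
  from finite_max_nat[OF fB this, of snd] obtain b where b: "b \<in> B" "\<forall>c\<in>B. snd c \<le> snd b" by blast
  define j where "j = snd b"
  have "(fst b, j) \<in> B" using b(1) unfolding j_def by simp
  then have ex: "\<exists>i. (i, j) \<in> B" ..
  define i where "i = (LEAST i. (i, j) \<in> B)"
  have iB: "(i, j) \<in> B" unfolding i_def by (rule LeastI_ex[OF ex])
  have imin: "(k, j) \<notin> B" if "k < i" for k using that not_less_Least unfolding i_def by blast
  have c: "(i, j) \<in> diagram l" and "T (i, j) \<noteq> i" using iB unfolding B_def by simp_all
  then have gt: "i < T (i, j)" using entry_ge_row[OF T c] by simp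
  have i1: "1 \<le> i" "1 \<le> j" using c unfolding cell by blast+
  define k where "k = T (i, j) - 1"
  have k: "i \<le> k" "T (i, j) = Suc k" "1 \<le> k" using gt i1 unfolding k_def by linarith+
  let ?D = "from_column T k j"
  have "(i, j) \<in> ?D \<inter> color_class T (Suc k)" using c k(2) by (simp add: from_column_def in_two_rows color_class_def)
  then have "0 < card (?D \<inter> color_class T (Suc k))" by (subst card_gt_0_iff) auto
  moreover have "?D \<inter> color_class T k = {}"
  proof (rule ccontr)
    assume "?D \<inter> color_class T k \<noteq> {}"
    then obtain y where y: "y \<in> ?D \<inter> color_class T k" by blast
    obtain i' j' where y': "y = (i', j')" by (cases y)
    have yd: "(i', j') \<in> diagram l" "T (i', j') = k" "j \<le> j'" using y unfolding y' by (simp_all add: color_class_def from_column_def)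
    have i'1: "1 \<le> i'" using yd(1) unfolding cell by blast
    show False
    proof (cases "j' = j")
      case True
      have "i' < i"
      proof (rule ccontr)
        assume "\<not> ?thesis"
        moreover have "i' \<noteq> i" using True yd(2) k(2) by auto
        ultimately have "T (i, j) < T (i', j)" using column_strict[OF T yd(1)[unfolded True] i1(1)] by simp
        then show False using True yd(2) k(2) by simp
      qed
      then have "(i', j) \<notin> B" by (rule imin)
      then have "T (i', j) = i'" using yd(1) True unfolding B_def by simp
      then show False using yd(2) True k(1) \<open>i' < i\<close> by simp
    next
      case False
      then have j: "j < j'" using yd(3) by simp
      have nB: "(a, j') \<notin> B" for a using b(2) j unfolding j_def by auto
      have "T (i', j') = i'" using nB yd(1) unfolding B_def by simp
      then have "i \<le> i'" using yd(2) k(1) by simp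
      then have ij': "(i, j') \<in> diagram l" by (rule cell_up[OF yd(1) i1(1)])
      then have "T (i, j') = i" using nB unfolding B_def by simp
      moreover have "T (i, j) \<le> T (i, j')" by (rule row_weak[OF T ij' i1(2) yd(3)])
      ultimately show False using gt by simp
    qed
  qed
  ultimately have "height T k ?D < 0" unfolding height_def by simp
  then show False using tableau_height[OF chain_coloring_ssyt[OF T] tab k(3) from_column_cut, of j] by simp
qed

lemma content_superstandard: "content superstandard = l"
proof (rule ext)
  fix i
  have "color_class superstandard i = (\<lambda>j. (i, j)) ` (if i = 0 then {} else {1..l i})"
    by (auto simp: color_class_def superstandard_def cell image_iff)
  moreover have "card ((\<lambda>j. (i, j)) ` (if i = 0 then {} else {1..l i})) = card (if i = 0 then {} else {1..l i})"
    by (rule card_image) (simp add: inj_on_def)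
  moreover have "l 0 = 0" using l by (simp add: is_partition_def)
  ultimately show "content superstandard i = l i" unfolding content_def by simp
qed

lemma schur_weight_count: "schur l m = weight_count (ssyt l) m"
  unfolding schur_def weight_count_def content_def color_class_def fun_eq_iff ..

lemma ssyt_tableaux: "card {T \<in> ssyt l. tableau T \<and> content T = m} = (if m = l then 1 else 0)"
proof -
  have "{T \<in> ssyt l. tableau T \<and> content T = m} = (if m = l then {superstandard} else {})"
  proof (cases "m = l")
    case True
    have "{T \<in> ssyt l. tableau T \<and> content T = m} = {superstandard}"
      using tableau_superstandard superstandard_ssyt superstandard_tableau content_superstandard True by blast
    then show ?thesis using True by simp
  next
    case False
    have "{T \<in> ssyt l. tableau T \<and> content T = m} = {}"
      using tableau_superstandard content_superstandard False by blast
    then show ?thesis using False by simp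
  qed
  then show ?thesis by simp
qed

end

section \<open>Schur expansions of characters\<close>

lemma weights_mono:
  assumes "N \<le> N'" "m \<in> weights N n"
  shows "m \<in> weights N' n"
proof -
  have zero: "m i = 0" if "i \<notin> {1..N}" for i using assms(2) that by (simp add: weights_def)
  have "sum m {1..N'} = sum m {1..N}"
    by (rule sum.mono_neutral_right) (use assms(1) zero in auto)
  moreover have "m i = 0" if "i \<notin> {1..N'}" for i by (rule zero) (use that assms(1) in auto)
  ultimately show ?thesis using assms(2) by (simp add: weights_def)
qed

lemma weights_partition:
  assumes m: "m \<in> weights N n" and d: "decreasing_upto N m"
  shows "is_partition m"
proof -
  have zero: "m i = 0" if "i \<notin> {1..N}" for i using m that by (simp add: weights_def)
  have "m (i + 1) \<le> m i" if "1 \<le> i" for i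
  proof (cases "Suc i \<le> N")
    case True
    then show ?thesis using d that unfolding decreasing_upto_def by simp
  next
    case False
    then show ?thesis using zero[of "i + 1"] by simp
  qed
  moreover have "finite {i. m i \<noteq> 0}"
  proof (rule finite_subset)
    show "{i. m i \<noteq> 0} \<subseteq> {1..N}"
    proof (rule subsetI, rule ccontr)
      fix i assume "i \<in> {i. m i \<noteq> 0}" "i \<notin> {1..N}"
      then show False using zero[of i] by simp
    qed
  qed simp
  moreover have "m 0 = 0" by (rule zero) simp
  ultimately show ?thesis by (simp add: is_partition_def)
qed

context three_one_free
begin

lemma content_in_weights:
  assumes "\<kappa> \<in> P \<rightarrow>\<^sub>E {1..}"
  shows "\<exists>N\<ge>M. content \<kappa> \<in> weights N (card P)"
proof -
  have "\<kappa> ` P \<subseteq> {..max M (Max (\<kappa> ` P))}"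
  proof
    fix i assume "i \<in> \<kappa> ` P"
    then have "i \<le> Max (\<kappa> ` P)" by (rule Max_ge[OF finite_imageI[OF fin]])
    then show "i \<in> {..max M (Max (\<kappa> ` P))}" by simp
  qed
  then have "content \<kappa> \<in> weights (max M (Max (\<kappa> ` P))) (card P)" unfolding content_weights[OF assms] .
  then show ?thesis by (intro exI[of _ "max M (Max (\<kappa> ` P))"]) simp
qed

lemma weight_count_support:
  assumes Y: "Y \<subseteq> P \<rightarrow>\<^sub>E {1..}" and "weight_count Y m \<noteq> 0"
  shows "\<exists>N\<ge>M. m \<in> weights N (card P)"
proof -
  have "{\<kappa>\<in>Y. content \<kappa> = m} \<noteq> {}" using assms(2) unfolding weight_count_def by (metis card.empty)
  then obtain \<kappa> where "\<kappa> \<in> Y" "content \<kappa> = m" by blast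
  then show ?thesis using content_in_weights[of \<kappa> M] Y by auto
qed

lemma tableau_rows:
  assumes \<kappa>: "\<kappa> \<in> P \<rightarrow>\<^sub>E {1..}" "chain_coloring \<kappa>" "tableau \<kappa>"
  shows "content \<kappa> \<in> weights (card P) (card P)"
proof -
  have "i \<le> card P" if iP: "i \<in> \<kappa> ` P" for i
  proof -
    obtain x where x: "x \<in> P" "\<kappa> x = i" using iP by blast
    then have "color_class \<kappa> i \<noteq> {}" by (auto simp: color_class_def)
    then have i: "1 \<le> content \<kappa> i" by (simp add: content_def Suc_le_eq card_gt_0_iff)
    have pos: "1 \<le> content \<kappa> k" if k: "1 \<le> k" "k \<le> i" for k
    proof -
      have "decreasing_upto i (content \<kappa>)" using tableau_content_decreasing[OF \<kappa>(2,3)] by (simp add: decreasing_upto_def)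
      from decreasing_upto_antimono[OF this k(1,2)] show ?thesis using i by simp
    qed
    have "\<exists>x\<in>P. \<kappa> x = k" if k: "k \<in> {1..i}" for k
    proof -
      have "1 \<le> card (color_class \<kappa> k)" using pos[of k] k unfolding content_def by simp
      then have "color_class \<kappa> k \<noteq> {}" by (metis card.empty not_one_le_zero)
      then show ?thesis by (auto simp: color_class_def)
    qed
    then have "{1..i} \<subseteq> \<kappa> ` P" by blast
    then have "card {1..i} \<le> card (\<kappa> ` P)" by (rule card_mono[OF finite_imageI[OF fin]])
    also have "\<dots> \<le> card P" by (rule card_image_le[OF fin])
    finally show ?thesis by simp
  qed
  then have "\<kappa> ` P \<subseteq> {..card P}" by blast
  then show ?thesis unfolding content_weights[OF \<kappa>(1)] .
qed

lemma row_equiv_PiE: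
  assumes "row_equiv r \<kappa> \<kappa>'" "\<kappa> \<in> P \<rightarrow>\<^sub>E {1..}" "1 \<le> r"
  shows "\<kappa>' \<in> P \<rightarrow>\<^sub>E {1..}"
proof (rule PiE_I)
  fix x assume x: "x \<in> P"
  show "\<kappa>' x \<in> {1..}"
  proof (cases "x \<in> two_rows \<kappa> r")
    case True
    then have "x \<in> two_rows \<kappa>' r" using assms(1) by (simp add: row_equiv_def)
    then show ?thesis using assms(3) by (auto simp: two_rows_def color_class_def)
  next
    case False
    then have "\<kappa>' x = \<kappa> x" using assms(1) by (simp add: row_equiv_def)
    then show ?thesis using PiE_mem[OF assms(2) x] by simp
  qed
next
  fix x assume x: "x \<notin> P"
  then have "x \<notin> two_rows \<kappa> r" by (auto simp: two_rows_def color_class_def)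
  then have "\<kappa>' x = \<kappa> x" using assms(1) by (simp add: row_equiv_def)
  then show "\<kappa>' x = undefined" using PiE_arb[OF assms(2) x] by simp
qed

end

context shape
begin

lemma ssyt_PiE: "ssyt l \<subseteq> diagram l \<rightarrow>\<^sub>E {1..}"
  using ssytD(1) by blast

lemma schur_support: "schur l m \<noteq> 0 \<Longrightarrow> \<exists>N\<ge>M. m \<in> weights N (card (diagram l))"
  unfolding schur_weight_count by (rule weight_count_support[OF ssyt_PiE])

lemma schur_symmetric:
  assumes "1 \<le> r" "m' r = m (Suc r)" "m' (Suc r) = m r" "\<And>s. s \<noteq> r \<Longrightarrow> s \<noteq> Suc r \<Longrightarrow> m' s = m s"
  shows "schur l m = schur l m'"
  unfolding schur_weight_count weight_count_def
  by (rule weights_symmetric[OF chain_coloring_ssyt ssyt_closed[OF assms(1)] assms(2-4)])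

lemma schur_alternating:
  assumes "l' \<in> weights N (card (diagram l))" "decreasing_upto N l'"
  shows "(\<Sum>m\<in>weights N (card (diagram l)). alternant N l' m * int (schur l m)) = (if l' = l then 1 else 0)"
proof -
  have "(\<Sum>m\<in>weights N (card (diagram l)). alternant N l' m * int (weight_count (ssyt l) m)) =
      int (card {T \<in> ssyt l. tableau T \<and> content T = l'})"
    by (rule alternating_count[OF ssytD(1) chain_coloring_ssyt ssyt_closed assms])
  then show ?thesis unfolding schur_weight_count ssyt_tableaux by simp
qed

lemma card_diagram:
  assumes "l \<in> weights N n"
  shows "card (diagram l) = n"
proof -
  obtain N' where "N \<le> N'" "l \<in> weights N' (card (diagram l))"
    using content_in_weights[OF ssytD(1)[OF superstandard_ssyt], of N] unfolding content_superstandard by blast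
  then show ?thesis using weights_mono[OF _ assms, of N'] by (simp add: weights_def)
qed

end

text \<open>The difference of the two sides is symmetric, and all its alternating sums vanish. The bounds on
weights let the sums be taken in finitely many variables.\<close>
lemma schur_expansion:
  fixes f :: "(nat \<Rightarrow> nat) \<Rightarrow> nat" and t :: "(nat \<Rightarrow> nat) \<Rightarrow> nat"
  assumes support: "\<And>m. f m \<noteq> 0 \<Longrightarrow> \<exists>N\<ge>n. m \<in> weights N n"
    and sym: "\<And>r m m'. \<lbrakk>1 \<le> r; m' r = m (Suc r); m' (Suc r) = m r;
        \<And>s. s \<noteq> r \<Longrightarrow> s \<noteq> Suc r \<Longrightarrow> m' s = m s\<rbrakk> \<Longrightarrow> f m = f m'"
    and alternating: "\<And>N l. l \<in> weights N n \<Longrightarrow> decreasing_upto N l \<Longrightarrow> (\<Sum>m\<in>weights N n. alternant N l m * int (f m)) = int (t l)"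
    and t: "\<And>l. t l \<noteq> 0 \<Longrightarrow> l \<in> weights n n"
  shows "f m = (\<Sum>l | is_partition l \<and> t l \<noteq> 0. t l * schur l m)"
proof -
  let ?L = "{l. is_partition l \<and> t l \<noteq> 0}"
  have finL: "finite ?L" by (rule finite_subset[OF _ finite_weights[of n n]]) (use t in blast)
  have sh: "shape l" "card (diagram l) = n" if "l \<in> ?L" for l
  proof -
    show "shape l" using that by unfold_locales blast
    then show "card (diagram l) = n" using t that by (intro shape.card_diagram[of l n]) blast+
  qed
  define D where "D m = int (f m) - (\<Sum>l\<in>?L. int (t l) * int (schur l m))" for m
  have "D m = 0" if N: "n \<le> N" and m: "m \<in> weights N n" for N
  proof (rule symmetric_vanishing[OF _ _ m])
    fix r and m m' :: "nat \<Rightarrow> nat" assume r: "1 \<le> r" "Suc r \<le> N" and sw: "m' r = m (Suc r)" "m' (Suc r) = m r"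
      "\<And>s. s \<noteq> r \<Longrightarrow> s \<noteq> Suc r \<Longrightarrow> m' s = m s"
    have "f m = f m'" by (rule sym[OF r(1) sw])
    moreover have "(\<Sum>l\<in>?L. int (t l) * int (schur l m)) = (\<Sum>l\<in>?L. int (t l) * int (schur l m'))"
    proof (rule sum.cong[OF refl])
      fix l assume "l \<in> ?L"
      from shape.schur_symmetric[of l r m' m, OF sh(1)[OF this] r(1) sw]
      show "int (t l) * int (schur l m) = int (t l) * int (schur l m')" by simp
    qed
    ultimately show "D m = D m'" unfolding D_def by simp
  next
    fix l' assume l': "l' \<in> weights N n" "decreasing_upto N l'"
    let ?W = "weights N n"
    have "(\<Sum>m\<in>?W. alternant N l' m * D m) =
        (\<Sum>m\<in>?W. alternant N l' m * int (f m) - (\<Sum>l\<in>?L. int (t l) * (alternant N l' m * int (schur l m))))"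
    proof (rule sum.cong[OF refl])
      fix m
      have "alternant N l' m * (\<Sum>l\<in>?L. int (t l) * int (schur l m)) = (\<Sum>l\<in>?L. int (t l) * (alternant N l' m * int (schur l m)))"
        unfolding sum_distrib_left by (rule sum.cong[OF refl]) (rule mult.left_commute)
      then show "alternant N l' m * D m = alternant N l' m * int (f m) - (\<Sum>l\<in>?L. int (t l) * (alternant N l' m * int (schur l m)))"
        unfolding D_def right_diff_distrib by simp
    qed
    also have "\<dots> = int (t l') - (\<Sum>l\<in>?L. int (t l) * (\<Sum>m\<in>?W. alternant N l' m * int (schur l m)))"
      unfolding sum_subtractf alternating[OF l'] sum.swap[of _ ?L ?W] sum_distrib_left ..
    also have "(\<Sum>l\<in>?L. int (t l) * (\<Sum>m\<in>?W. alternant N l' m * int (schur l m))) = (\<Sum>l\<in>?L. if l = l' then int (t l') else 0)"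
    proof (rule sum.cong[OF refl])
      fix l assume l: "l \<in> ?L"
      have "(\<Sum>m\<in>?W. alternant N l' m * int (schur l m)) = (if l' = l then 1 else 0)"
        using shape.schur_alternating[OF sh(1)[OF l], of l' N] l' unfolding sh(2)[OF l] by blast
      then show "int (t l) * (\<Sum>m\<in>?W. alternant N l' m * int (schur l m)) = (if l = l' then int (t l') else 0)"
        by (cases "l = l'") simp_all
    qed
    also have "\<dots> = (if l' \<in> ?L then int (t l') else 0)" by (rule sum.delta[OF finL])
    also have "\<dots> = int (t l')" using weights_partition[OF l'] by simp
    finally show "(\<Sum>m\<in>?W. alternant N l' m * D m) = 0" by simp
  qed
  note vanish = this
  have "D m = 0"
  proof (cases "\<exists>N\<ge>n. m \<in> weights N n")
    case True
    then show ?thesis using vanish by blast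
  next
    case False
    then have "f m = 0" using support by blast
    moreover have "schur l m = 0" if "l \<in> ?L" for l
      using shape.schur_support[OF sh(1)[OF that], of m n] False unfolding sh(2)[OF that] by blast
    ultimately show ?thesis unfolding D_def by simp
  qed
  then have "int (f m) = int (\<Sum>l\<in>?L. t l * schur l m)" unfolding D_def by simp
  then show ?thesis by (simp only: of_nat_eq_iff)
qed

context free_order
begin

lemma coloring_inj: "A \<in> P_arrays P \<Longrightarrow> B \<in> P_arrays P \<Longrightarrow> coloring A = coloring B \<Longrightarrow> A = B"
  using array_of_coloring by metis

lemma low_coloring:
  assumes A: "A \<in> P_arrays P" and r: "1 \<le> r" and phi: "0 < phi (coloring A) r"
  shows "chain_coloring (low r (coloring A))" "low r (coloring A) \<in> P \<rightarrow>\<^sub>E {1..}"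
  using low_string(1)[OF chain_coloring_array[OF A] phi] row_equiv_PiE[OF row_equiv_low[OF phi] coloring_PiE[OF A] r]
  by blast+

text \<open>For colorings, the edges of the crystal are the lowering steps in strings.\<close>
lemma crystal_edge_iff:
  "(A, B) \<in> crystal_edges P \<longleftrightarrow>
    A \<in> P_arrays P \<and> (\<exists>r\<ge>1. 0 < phi (coloring A) r \<and> B = array_of (low r (coloring A)))"
proof -
  have "lowering r A = Some B \<longleftrightarrow> 0 < phi (coloring A) r \<and> B = array_of (low r (coloring A))"
    if "A \<in> P_arrays P" "1 \<le> r" for r
    using lowering_eq_low[OF that] lowering_eq_None[OF that] by (cases "0 < phi (coloring A) r") auto
  then show ?thesis unfolding crystal_edges_def by blast
qed

lemma crystal_edge_arrays:
  assumes "(A, B) \<in> crystal_edges P"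
  shows "A \<in> P_arrays P" "B \<in> P_arrays P"
proof -
  obtain r where A: "A \<in> P_arrays P" and r: "1 \<le> r" "0 < phi (coloring A) r" "B = array_of (low r (coloring A))"
    using assms unfolding crystal_edge_iff by blast
  show "A \<in> P_arrays P" by (rule A)
  show "B \<in> P_arrays P" unfolding r(3) by (rule array_of_P_arrays[OF low_coloring[OF A r(1,2)]])
qed

lemma component_arrays:
  assumes "C \<in> crystal_components P" shows "C \<subseteq> P_arrays P"
proof
  let ?R = "crystal_edges P \<union> (crystal_edges P)\<inverse>"
  obtain A0 where A0: "A0 \<in> P_arrays P" "C = ?R\<^sup>* `` {A0}"
    using assms unfolding crystal_components_def by (rule quotientE)
  fix A assume "A \<in> C"
  then have "(A0, A) \<in> ?R\<^sup>*" unfolding A0(2) by blast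
  then show "A \<in> P_arrays P"
  proof (induction rule: rtrancl_induct)
    case base
    show ?case by (rule A0(1))
  next
    case (step A B)
    then show ?case using crystal_edge_arrays by blast
  qed
qed

lemma component_edge:
  assumes C: "C \<in> crystal_components P" and A: "A \<in> C" and e: "(A, B) \<in> crystal_edges P \<or> (B, A) \<in> crystal_edges P"
  shows "B \<in> C"
proof -
  let ?R = "crystal_edges P \<union> (crystal_edges P)\<inverse>"
  obtain A0 where A0: "A0 \<in> P_arrays P" "C = ?R\<^sup>* `` {A0}"
    using C unfolding crystal_components_def by (rule quotientE)
  have "(A0, A) \<in> ?R\<^sup>*" using A unfolding A0(2) by blast
  moreover have "(A, B) \<in> ?R" using e by blast
  ultimately have "(A0, B) \<in> ?R\<^sup>*" by (rule rtrancl_into_rtrancl)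
  then show ?thesis unfolding A0(2) by blast
qed

lemma component_closed:
  assumes C: "C \<in> crystal_components P" and r: "1 \<le> r"
  shows "closed_at r (coloring ` C)"
  unfolding closed_at_def
proof (intro ballI conjI impI)
  fix \<kappa> assume "\<kappa> \<in> coloring ` C"
  then obtain A where AC: "A \<in> C" and \<kappa>: "\<kappa> = coloring A" by blast
  have A: "A \<in> P_arrays P" using component_arrays[OF C] AC by blast
  { assume phi: "0 < phi \<kappa> r"
    note low = low_coloring[OF A r phi[unfolded \<kappa>]]
    have "(A, array_of (low r (coloring A))) \<in> crystal_edges P"
      unfolding crystal_edge_iff using A r phi \<kappa> by blast
    then have "array_of (low r (coloring A)) \<in> C" using component_edge[OF C AC] by blast
    then have "coloring (array_of (low r (coloring A))) \<in> coloring ` C" by (rule imageI)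
    then show "low r \<kappa> \<in> coloring ` C" unfolding coloring_array_of[OF low] \<kappa> . }
  { assume eps: "0 < eps \<kappa> r"
    note string = raise_string[OF chain_coloring_array[OF A] eps[unfolded \<kappa>]]
    have PiE: "raise r (coloring A) \<in> P \<rightarrow>\<^sub>E {1..}"
      by (rule row_equiv_PiE[OF row_equiv_raise[OF eps[unfolded \<kappa>]] coloring_PiE[OF A] r])
    let ?B = "array_of (raise r (coloring A))"
    have B: "?B \<in> P_arrays P" by (rule array_of_P_arrays[OF string(1) PiE])
    have cB: "coloring ?B = raise r (coloring A)" by (rule coloring_array_of[OF string(1) PiE])
    have "0 < phi (coloring ?B) r" unfolding cB using string(4) phi_nonneg[of "coloring A" r] by simp
    moreover have "A = array_of (low r (coloring ?B))"
      unfolding cB string(2) by (rule array_of_coloring[OF A, symmetric])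
    ultimately have "(?B, A) \<in> crystal_edges P" unfolding crystal_edge_iff using B r by blast
    then have "?B \<in> C" using component_edge[OF C AC] by blast
    then have "coloring ?B \<in> coloring ` C" by (rule imageI)
    then show "raise r \<kappa> \<in> coloring ` C" unfolding cB \<kappa> . }
qed

lemma card_coloring_image:
  assumes C: "C \<subseteq> P_arrays P" and QR: "\<And>A. A \<in> C \<Longrightarrow> Q A \<longleftrightarrow> R (coloring A)"
  shows "card {A \<in> C. Q A} = card {\<kappa> \<in> coloring ` C. R \<kappa>}"
proof -
  have "{\<kappa> \<in> coloring ` C. R \<kappa>} = coloring ` {A \<in> C. Q A}" using QR by blast
  moreover have "inj_on coloring {A \<in> C. Q A}" by (rule inj_onI) (use C coloring_inj in blast)
  ultimately show ?thesis by (simp add: card_image)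
qed

lemma character_component:
  assumes C: "C \<in> crystal_components P"
  shows "character C m = (\<Sum>l | is_partition l \<and> tableau_count P C l \<noteq> 0. tableau_count P C l * schur l m)"
proof (rule schur_expansion[where n = "card P"])
  let ?Y = "coloring ` C"
  note CA = component_arrays[OF C]
  have Y: "\<kappa> \<in> P \<rightarrow>\<^sub>E {1..}" "chain_coloring \<kappa>" if "\<kappa> \<in> ?Y" for \<kappa>
    using that CA coloring_PiE chain_coloring_array by blast+
  have character: "character C m = weight_count ?Y m" for m
    unfolding character_def weight_count_def by (rule card_coloring_image[OF CA]) (use CA wt_coloring in auto)
  have count: "tableau_count P C l = card {\<kappa> \<in> ?Y. tableau \<kappa> \<and> content \<kappa> = l}" for l
    unfolding tableau_count_def
  proof (rule card_coloring_image[OF CA])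
    fix A assume "A \<in> C"
    then have A: "A \<in> P_arrays P" using CA by blast
    show "A \<in> P_tableaux P \<and> wt A = l \<longleftrightarrow> tableau (coloring A) \<and> content (coloring A) = l"
      unfolding tableau_coloring[OF A] wt_coloring[OF A] ..
  qed
  show "\<exists>N\<ge>card P. m \<in> weights N (card P)" if "character C m \<noteq> 0" for m
    by (rule weight_count_support[of ?Y]) (use that Y(1) character in auto)
  show "character C m = character C m'"
    if "1 \<le> r" "m' r = m (Suc r)" "m' (Suc r) = m r" "\<And>s. s \<noteq> r \<Longrightarrow> s \<noteq> Suc r \<Longrightarrow> m' s = m s" for r m m'
    unfolding character weight_count_def
    by (rule weights_symmetric[OF Y(2) component_closed[OF C that(1)] that(2-4)])
  show "(\<Sum>m\<in>weights N (card P). alternant N l m * int (character C m)) = int (tableau_count P C l)"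
    if "l \<in> weights N (card P)" "decreasing_upto N l" for N l
    unfolding character count by (rule alternating_count[OF Y component_closed[OF C] that])
  show "l \<in> weights (card P) (card P)" if "tableau_count P C l \<noteq> 0" for l
  proof -
    have "{\<kappa> \<in> ?Y. tableau \<kappa> \<and> content \<kappa> = l} \<noteq> {}" using that unfolding count by (metis card.empty)
    then obtain \<kappa> where \<kappa>: "\<kappa> \<in> ?Y" "tableau \<kappa>" "content \<kappa> = l" by blast
    show ?thesis using tableau_rows[OF Y[OF \<kappa>(1)] \<kappa>(2)] unfolding \<kappa>(3) .
  qed
qed

end

theorem theorem6p2:
  fixes P :: "'a::order set" and C :: "'a filling set"
  assumes "finite P"
    and "three_plus_one_free P"
    and "C \<in> crystal_components P"
  shows "character C =
    (\<lambda>m. \<Sum>l | is_partition l \<and> tableau_count P C l \<noteq> 0. tableau_count P C l * schur l m)"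
proof -
  interpret free_order P by unfold_locales (rule assms(1), rule assms(2))
  show ?thesis by (rule ext) (rule character_component[OF assms(3)])
qed

end
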